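(* Let $m\ge 2$, let $L\subset S^3$ be an oriented link with $q$ components satisfying Assumption $\mathcal{A}_m$, and let $j\in\{1,\dots,q\}$. Then the additive homomorphism $\mathcal{I}_j:\Upsilon_m(Q_m)\to\Upsilon_{m+1}(Q_{m+1})$ is injective, and the equality $$\mathcal{I}_j\bigl(\Upsilon_m\circ f_m(\mathfrak{l}_j)\bigr)=\Psi_m(j)$$ holds.
   Context: Groups. $F$ is the free group on $x_1,\dots,x_q$; $\Gamma_1F=F$, $\Gamma_nF=[\Gamma_{n-1}F,F]$; for $n\ge 2$, $Q_n=\Gamma_{n-1}F/\Gamma_nF$, a central subgroup of $F/\Gamma_nF$; $p_{n}:F/\Gamma_{n+1}F\to F/\Gamma_{n}F$ is the projection. Unipotent Magnus embedding. $\Omega_n=\mathbb{Z}[\lambda_i^{(j)}]$ is the commutative polynomial ring in indeterminates $\lambda_i^{(j)}$, $1\le i\le n-1$, $1\le j\le q$. $\Upsilon_n:F\to GL_n(\Omega_n)$ is the homomorphism sending $x_j$ to the upper unitriangular matrix $I_n+\sum_{i=1}^{n-1}\lambda_i^{(j)}E_{i,i+1}$, where $E_{a,b}$ is the matrix with 1 in position $(a,b)$ and zeros elsewhere. It is known that $\Upsilon_n$ kills $\Gamma_nF$ and induces an isomorphism $F/\Gamma_nF\cong\mathrm{Im}(\Upsilon_n)$; through it, $p_n$ is also regarded as a map $\mathrm{Im}(\Upsilon_{n+1})\to\mathrm{Im}(\Upsilon_n)$. $\Upsilon_n(Q_n)$ denotes $\Upsilon_n(\Gamma_{n-1}F)$.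 The map $\mathcal{I}_j$. The map $\Gamma_{m-1}F\to\Gamma_mF$, $y\mapsto x_j^{-1}y^{-1}x_jy$, induces the additive homomorphism $\mathcal{I}_j:\Upsilon_m(Q_m)\to\Upsilon_{m+1}(Q_{m+1})$, that is, $\mathcal{I}_j(\Upsilon_m(y))=\Upsilon_{m+1}(x_j^{-1}y^{-1}x_jy)$ for $y\in\Gamma_{m-1}F$. Link diagram. Let $D$ be a diagram of $L$ in which every component passes under at least one crossing. For each component $j$, traverse it along its orientation, starting from an arc $\alpha_1$ whose Wirtinger generator is the meridian $\mathfrak{m}_j$; let $\alpha_1,\dots,\alpha_{N_j}$ be the successive arcs (over-arcs) of the component, $\beta_k$ the over-passing arc at the crossing separating $\alpha_k$ and $\alpha_{k+1}$ (with $\alpha_{N_j+1}=\alpha_1$), and $\epsilon_k\in\{\pm1\}$ the sign of that crossing. Arcs are identified with Wirtinger generators of $\pi_1(S^3\setminus L)$, with conventions such that the Wirtinger relations are $\alpha_{k+1}=\beta_k^{-\epsilon_k}\alpha_k\beta_k^{\epsilon_k}$. The preferred longitude is $\mathfrak{l}_j=\alpha_1^{-w_j}\beta_1^{\epsilon_1}\cdots\beta_{N_j}^{\epsilon_{N_j}}$, where $w_j$ is the integer making the linking number of $\mathfrak{l}_j$ with the $j$-th component zero. Assumption $\mathcal{A}_m$. There are homomorphisms $f_k:\pi_1(S^3\setminus L)\to F/\Gamma_kF$, $2\le k\le m$, with $f_2$ the abelianization, $p_{k-1}\circ f_k=f_{k-1}$ for $3\le k\le m$, and (normalization) $f_k(\mathfrak{m}_j)=[x_j]$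 for all $j$. Then $f_m(\mathfrak{l}_j)\in Q_m$ for every $j$; the tuple of these elements is the $m$-th Milnor invariant. Via the Wirtinger presentation, $f_m$ is regarded as a map on the arcs of $D$. The assignment $\mathcal{C}$ and $\Psi_m$. For each component $j$ put $\mathcal{C}(\alpha_1)=\Upsilon_{m+1}(x_j)$, and for $1\le k<N_j$ put $\mathcal{C}(\alpha_{k+1})=B_k^{-\epsilon_k}\mathcal{C}(\alpha_k)B_k^{\epsilon_k}$, where for each $1\le k\le N_j$, $B_k\in\mathrm{Im}(\Upsilon_{m+1})$ is any element with $p_m(B_k)=\Upsilon_m(f_m(\beta_k))$ (the result does not depend on the choice of the $B_k$, by centrality). Define $$\Psi_m(j)=\Upsilon_{m+1}(x_j)^{-1}\,B_{N_j}^{-\epsilon_{N_j}}\,\mathcal{C}(\alpha_{N_j})\,B_{N_j}^{\epsilon_{N_j}}\in\Upsilon_{m+1}(Q_{m+1}).$$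
   Formalization: Injectivity of I_j is claimed only for m ≥ 3, because for m = 2 it always fails: Υ_2(x_j) is not the identity, but I_j sends it to the identity; the homomorphism property and the equality are kept for all m ≥ 2. *)

theory Defs
  imports
    "HOL-Algebra.Elementary_Groups"
    "HOL-Algebra.Generated_Groups"
    "HOL-Library.Poly_Mapping"
    "Jordan_Normal_Form.Matrix"
begin

section \<open>Group presentations\<close>

text \<open>The letter \<open>(a, True)\<close> stands for the generator \<open>a\<close> and \<open>(a, False)\<close> for its inverse.
  A relation \<open>r = s\<close> is given as the pair \<open>(r, s)\<close>.\<close>

type_synonym 'a word = "('a \<times> bool) list"

abbreviation words :: "'a set \<Rightarrow> 'a word set" where
  "words S \<equiv> lists (S \<times> UNIV)"

inductive pres_eq :: "'a set \<Rightarrow> ('a word \<times> 'a word) set \<Rightarrow> 'a word \<Rightarrow> 'a word \<Rightarrow> bool"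
  for S :: "'a set" and R :: "('a word \<times> 'a word) set" where
  refl: "u \<in> words S \<Longrightarrow> pres_eq S R u u"
| sym: "pres_eq S R u v \<Longrightarrow> pres_eq S R v u"
| trans: "pres_eq S R u v \<Longrightarrow> pres_eq S R v w \<Longrightarrow> pres_eq S R u w"
| cancel: "u \<in> words S \<Longrightarrow> v \<in> words S \<Longrightarrow> a \<in> S \<Longrightarrow>
    pres_eq S R (u @ [(a, b), (a, \<not> b)] @ v) (u @ v)"
| rel: "u \<in> words S \<Longrightarrow> v \<in> words S \<Longrightarrow> r \<in> words S \<Longrightarrow> s \<in> words S \<Longrightarrow> (r, s) \<in> R \<Longrightarrow>
    pres_eq S R (u @ r @ v) (u @ s @ v)"

definition pres_class :: "'a set \<Rightarrow> ('a word \<times> 'a word) set \<Rightarrow> 'a word \<Rightarrow> 'a word set" where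
  "pres_class S R w = {v. pres_eq S R w v}"

definition presented_group :: "'a set \<Rightarrow> ('a word \<times> 'a word) set \<Rightarrow> 'a word set monoid" where
  "presented_group S R =
    \<lparr>carrier = pres_class S R ` words S,
     monoid.mult = (\<lambda>A B. {w. \<exists>u\<in>A. \<exists>v\<in>B. pres_eq S R (u @ v) w}),
     one = pres_class S R []\<rparr>"

definition word_eval :: "('b, 'c) monoid_scheme \<Rightarrow> ('a \<Rightarrow> 'b) \<Rightarrow> 'a word \<Rightarrow> 'b" where
  "word_eval G g w =
    foldr (\<lambda>(a, b) y. (if b then g a else inv\<^bsub>G\<^esub> (g a)) \<otimes>\<^bsub>G\<^esub> y) w \<one>\<^bsub>G\<^esub>"

text \<open>The homomorphism from a presented group to \<open>G\<close> that extends the map \<open>g\<close> on the generators;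
  meaningful whenever \<open>g\<close> respects the relations.\<close>

definition pres_lift :: "('b, 'c) monoid_scheme \<Rightarrow> ('a \<Rightarrow> 'b) \<Rightarrow> 'a word set \<Rightarrow> 'b" where
  "pres_lift G g A = word_eval G g (SOME w. w \<in> A)"

lemma pres_eq_words: "pres_eq S R u v \<Longrightarrow> u \<in> words S \<and> v \<in> words S"
  by (induction rule: pres_eq.induct) auto

lemma pres_eq_append_left:
  "pres_eq S R u v \<Longrightarrow> w \<in> words S \<Longrightarrow> pres_eq S R (w @ u) (w @ v)"
proof (induction rule: pres_eq.induct)
  case (refl u)
  then show ?case by (intro pres_eq.refl) auto
next
  case (cancel u v a b)
  then show ?case using pres_eq.cancel[of "w @ u" S v a R b] by simp
next
  case (rel u v r s)
  then show ?case using pres_eq.rel[of "w @ u" S v r s R] by simp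
qed (auto intro: pres_eq.intros)

lemma pres_eq_append_right:
  "pres_eq S R u v \<Longrightarrow> w \<in> words S \<Longrightarrow> pres_eq S R (u @ w) (v @ w)"
proof (induction rule: pres_eq.induct)
  case (refl u)
  then show ?case by (intro pres_eq.refl) auto
next
  case (cancel u v a b)
  then show ?case using pres_eq.cancel[of u S "v @ w" a R b] by simp
next
  case (rel u v r s)
  then show ?case using pres_eq.rel[of u S "v @ w" r s R] by simp
qed (auto intro: pres_eq.intros)

lemma pres_eq_append:
  assumes "pres_eq S R u u'" "pres_eq S R v v'"
  shows "pres_eq S R (u @ v) (u' @ v')"
  using assms pres_eq_append_left pres_eq_append_right pres_eq_words pres_eq.trans by metis

lemma pres_class_eq_iff:
  assumes "u \<in> words S"
  shows "pres_class S R u = pres_class S R v \<longleftrightarrow> pres_eq S R u v"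
  using assms unfolding pres_class_def
  by (metis (mono_tags, lifting) Collect_cong mem_Collect_eq pres_eq.refl pres_eq.sym pres_eq.trans)

lemma presented_group_mult:
  assumes "u \<in> words S" "v \<in> words S"
  shows "pres_class S R u \<otimes>\<^bsub>presented_group S R\<^esub> pres_class S R v = pres_class S R (u @ v)"
  using assms unfolding presented_group_def pres_class_def
  by (auto intro: pres_eq.refl pres_eq.trans pres_eq_append)

lemma pres_eq_inverse:
  "w \<in> words S \<Longrightarrow> pres_eq S R (rev (map (\<lambda>(a, b). (a, \<not> b)) w) @ w) []"
proof (induction w)
  case Nil
  then show ?case by (auto intro: pres_eq.refl)
next
  case (Cons x w)
  obtain a b where x: "x = (a, b)" by (cases x)
  have inv: "rev (map (\<lambda>(a, b). (a, \<not> b)) w) \<in> words S"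
    using Cons.prems by (auto simp: in_lists_conv_set)
  have "pres_eq S R (rev (map (\<lambda>(a, b). (a, \<not> b)) w) @ [(a, \<not> b), (a, \<not> \<not> b)] @ w)
          (rev (map (\<lambda>(a, b). (a, \<not> b)) w) @ w)"
    using Cons.prems inv x by (intro pres_eq.cancel) auto
  with Cons show ?case using x by (auto intro: pres_eq.trans)
qed

lemma group_presented_group: "group (presented_group S R)"
proof (rule groupI)
  let ?G = "presented_group S R"
  have car: "carrier ?G = pres_class S R ` words S" and one: "\<one>\<^bsub>?G\<^esub> = pres_class S R []"
    by (simp_all add: presented_group_def)
  show "\<one>\<^bsub>?G\<^esub> \<in> carrier ?G" by (auto simp: car one)
  fix x assume "x \<in> carrier ?G"
  then obtain u where u: "u \<in> words S" "x = pres_class S R u" by (auto simp: car)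
  show "\<one>\<^bsub>?G\<^esub> \<otimes>\<^bsub>?G\<^esub> x = x"
    using u presented_group_mult[of "[]" S u R] by (simp add: one)
  let ?v = "rev (map (\<lambda>(a, b). (a, \<not> b)) u)"
  have v: "?v \<in> words S" using u by (auto simp: in_lists_conv_set)
  have "pres_class S R ?v \<otimes>\<^bsub>?G\<^esub> x = \<one>\<^bsub>?G\<^esub>"
    using u v pres_eq_inverse[of u S R] pres_class_eq_iff[of "?v @ u" S R "[]"]
    by (simp add: presented_group_mult one)
  then show "\<exists>y\<in>carrier ?G. y \<otimes>\<^bsub>?G\<^esub> x = \<one>\<^bsub>?G\<^esub>" using v by (auto simp: car)
  fix y assume "y \<in> carrier ?G"
  then obtain v where v: "v \<in> words S" "y = pres_class S R v" by (auto simp: car)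
  show "x \<otimes>\<^bsub>?G\<^esub> y \<in> carrier ?G" using u v by (auto simp: presented_group_mult car)
  fix z assume "z \<in> carrier ?G"
  then obtain w where w: "w \<in> words S" "z = pres_class S R w" by (auto simp: car)
  show "x \<otimes>\<^bsub>?G\<^esub> y \<otimes>\<^bsub>?G\<^esub> z = x \<otimes>\<^bsub>?G\<^esub> (y \<otimes>\<^bsub>?G\<^esub> z)"
    using u v w by (simp add: presented_group_mult)
qed


section \<open>Free groups and the lower central series\<close>

definition free_group :: "nat \<Rightarrow> nat word set monoid" where
  "free_group q = presented_group {1..q} {}"

definition free_gen :: "nat \<Rightarrow> nat \<Rightarrow> nat word set" where
  "free_gen q j = pres_class {1..q} {} [(j, True)]"

definition commutator_subgroup :: "('a, 'b) monoid_scheme \<Rightarrow> 'a set \<Rightarrow> 'a set \<Rightarrow> 'a set" where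
  "commutator_subgroup G H K =
    generate G {inv\<^bsub>G\<^esub> h \<otimes>\<^bsub>G\<^esub> inv\<^bsub>G\<^esub> k \<otimes>\<^bsub>G\<^esub> h \<otimes>\<^bsub>G\<^esub> k | h k. h \<in> H \<and> k \<in> K}"

text \<open>The series starts at index 1; the value at 0 is a dummy.\<close>

fun lower_central :: "('a, 'b) monoid_scheme \<Rightarrow> nat \<Rightarrow> 'a set" where
  "lower_central G 0 = carrier G"
| "lower_central G (Suc 0) = carrier G"
| "lower_central G (Suc (Suc n)) = commutator_subgroup G (lower_central G (Suc n)) (carrier G)"

abbreviation Gam :: "nat \<Rightarrow> nat \<Rightarrow> nat word set set" where
  "Gam q n \<equiv> lower_central (free_group q) n"

definition nil_quot :: "nat \<Rightarrow> nat \<Rightarrow> nat word set set monoid" where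
  "nil_quot q n = free_group q Mod Gam q n"

text \<open>The projection \<open>F/\<Gamma>\<^sub>n\<^sub>+\<^sub>1F \<rightarrow> F/\<Gamma>\<^sub>nF\<close>.\<close>

definition nil_proj :: "nat \<Rightarrow> nat \<Rightarrow> nat word set set \<Rightarrow> nat word set set" where
  "nil_proj q n C = the_elem ((\<lambda>y. Gam q n #>\<^bsub>free_group q\<^esub> y) ` C)"


section \<open>The unipotent Magnus embedding\<close>

text \<open>Integer polynomials in the indeterminates \<open>\<lambda>\<^sub>i\<^sup>(\<^sup>j\<^sup>)\<close>, indexed by \<open>(i, j)\<close>. All indices \<open>i\<close>, \<open>j\<close> are
  allowed; the polynomials in \<open>\<Omega>\<^sub>n\<close> are those involving only \<open>1 \<le> i \<le> n - 1\<close> and \<open>1 \<le> j \<le> q\<close>, and only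
  those occur in the matrices below.\<close>

type_synonym magnus_ring = "((nat \<times> nat) \<Rightarrow>\<^sub>0 nat) \<Rightarrow>\<^sub>0 int"

definition lam :: "nat \<Rightarrow> nat \<Rightarrow> magnus_ring" where
  "lam i j = Poly_Mapping.single (Poly_Mapping.single (i, j) 1) 1"

definition GL :: "nat \<Rightarrow> magnus_ring mat monoid" where
  "GL n = units_of (ring_mat TYPE(magnus_ring) n ())"

text \<open>Matrix indices of \<^const>\<open>mat\<close> start at 0.\<close>

definition magnus_gen :: "nat \<Rightarrow> nat \<Rightarrow> magnus_ring mat" where
  "magnus_gen n j = 1\<^sub>m n + mat n n (\<lambda>(a, b). if b = a + 1 then lam (a + 1) j else 0)"

definition Upsilon :: "nat \<Rightarrow> nat word set \<Rightarrow> magnus_ring mat" where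
  "Upsilon n = pres_lift (GL n) (magnus_gen n)"

text \<open>The map induced by \<^const>\<open>Upsilon\<close> on \<open>F/\<Gamma>\<^sub>nF\<close>.\<close>

definition Upsilon_quot :: "nat \<Rightarrow> nat word set set \<Rightarrow> magnus_ring mat" where
  "Upsilon_quot n C = the_elem (Upsilon n ` C)"

definition Im_Upsilon :: "nat \<Rightarrow> nat \<Rightarrow> magnus_ring mat set" where
  "Im_Upsilon q n = Upsilon n ` carrier (free_group q)"

definition Upsilon_Q :: "nat \<Rightarrow> nat \<Rightarrow> magnus_ring mat monoid" where
  "Upsilon_Q q n = (GL n)\<lparr>carrier := Upsilon n ` Gam q (n - 1)\<rparr>"

text \<open>The projection \<^const>\<open>nil_proj\<close>, transported to a map from the image of \<open>\<Upsilon>\<^sub>n\<^sub>+\<^sub>1\<close> to the image of \<open>\<Upsilon>\<^sub>n\<close>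
  by the isomorphisms \<open>F/\<Gamma>\<^sub>nF \<cong> Im \<Upsilon>\<^sub>n\<close>.\<close>

definition Im_proj :: "nat \<Rightarrow> nat \<Rightarrow> magnus_ring mat \<Rightarrow> magnus_ring mat" where
  "Im_proj q n M =
    Upsilon_quot n (nil_proj q n
      (inv_into (carrier (nil_quot q (n + 1))) (Upsilon_quot (n + 1)) M))"

definition I_map :: "nat \<Rightarrow> nat \<Rightarrow> nat \<Rightarrow> magnus_ring mat \<Rightarrow> magnus_ring mat" where
  "I_map q m j M =
    (let F = free_group q; x = free_gen q j;
         y = (SOME y. y \<in> Gam q (m - 1) \<and> Upsilon m y = M)
     in Upsilon (m + 1) (inv\<^bsub>F\<^esub> x \<otimes>\<^bsub>F\<^esub> inv\<^bsub>F\<^esub> y \<otimes>\<^bsub>F\<^esub> x \<otimes>\<^bsub>F\<^esub> y))"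


section \<open>Oriented link diagrams\<close>

text \<open>Diagrams are encoded by signed Gauss codes. Component \<open>j\<close> consists of the successive arcs
  \<open>(j, 1), \<dots>, (j, N\<^sub>j)\<close>, the first being the one whose Wirtinger generator is the chosen meridian. The crossing
  at which arc \<open>(j, k)\<close> ends by passing under another arc is also named \<open>(j, k)\<close>, so that arcs and crossings
  have the same names. The list \<open>overs D a\<close> gives the crossings that arc \<open>a\<close> passes over, in the order
  in which they are met, and \<open>csign D c\<close> is the sign of the crossing \<open>c\<close>.\<close>

type_synonym arc = "nat \<times> nat"

record diagram =
  ncomp :: nat
  narcs :: "nat \<Rightarrow> nat"
  overs :: "arc \<Rightarrow> arc list"
  csign :: "arc \<Rightarrow> int"

definition arcs :: "diagram \<Rightarrow> arc set" where
  "arcs D = (SIGMA j:{1..ncomp D}. {1..narcs D j})"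

definition over_arc :: "diagram \<Rightarrow> arc \<Rightarrow> arc" where
  "over_arc D c = (THE a. a \<in> arcs D \<and> c \<in> set (overs D a))"

text \<open>A passage \<open>(c, True)\<close> is the strand going over at the crossing \<open>c\<close>, and \<open>(c, False)\<close> the one going under.
  A dart \<open>(p, True)\<close> is the half-edge leaving the crossing along the passage \<open>p\<close>, and \<open>(p, False)\<close> the one
  entering it.\<close>

type_synonym passage = "arc \<times> bool"
type_synonym dart = "passage \<times> bool"

definition comp_code :: "diagram \<Rightarrow> nat \<Rightarrow> passage list" where
  "comp_code D j =
    concat (map (\<lambda>k. map (\<lambda>c. (c, True)) (overs D (j, k)) @ [((j, k), False)]) [1..<Suc (narcs D j)])"

definition darts :: "diagram \<Rightarrow> dart set" where
  "darts D = (arcs D \<times> UNIV) \<times> UNIV"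

text \<open>The two ends of an edge of the diagram, regarded as a 4-valent graph.\<close>

definition edge_rel :: "diagram \<Rightarrow> (dart \<times> dart) set" where
  "edge_rel D =
    (let E = {((comp_code D j ! i, True), (comp_code D j ! (Suc i mod length (comp_code D j)), False)) | j i.
               j \<in> {1..ncomp D} \<and> i < length (comp_code D j)}
     in E \<union> E\<inverse>)"

text \<open>The next dart counterclockwise around its crossing. At a positive crossing the cyclic order is
  over-out, under-out, over-in, under-in; at a negative one it is the reverse.\<close>

fun rotation :: "diagram \<Rightarrow> dart \<Rightarrow> dart" where
  "rotation D ((c, ov), out) = ((c, \<not> ov), if ov = (csign D c = 1) then out else \<not> out)"

definition faces :: "diagram \<Rightarrow> dart set set" where
  "faces D = darts D // {(d, rotation D e) | d e. (d, e) \<in> edge_rel D}\<^sup>*"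

definition pieces :: "diagram \<Rightarrow> dart set set" where
  "pieces D = darts D // (edge_rel D \<union> {(d, rotation D d) | d. d \<in> darts D})\<^sup>*"

text \<open>The last condition says that the code is realized by a diagram on the sphere: each connected piece of the
  4-valent graph, with the given cyclic orders at its vertices, has Euler characteristic at most 2, and with
  \<open>V\<close> vertices and \<open>2V\<close> edges altogether all of them are spherical iff \<open>V - 2V + F\<close> is twice the number
  of pieces. Every component passes under some crossing by the first condition.\<close>

definition link_diagram :: "diagram \<Rightarrow> bool" where
  "link_diagram D \<longleftrightarrow>
    (\<forall>j\<in>{1..ncomp D}. 1 \<le> narcs D j) \<and>
    (\<forall>a\<in>arcs D. distinct (overs D a) \<and> set (overs D a) \<subseteq> arcs D) \<and>
    (\<forall>c\<in>arcs D. \<exists>!a. a \<in> arcs D \<and> c \<in> set (overs D a)) \<and>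
    (\<forall>c\<in>arcs D. csign D c \<in> {1, -1}) \<and>
    card (faces D) = card (arcs D) + 2 * card (pieces D)"


section \<open>The link group, meridians and longitudes\<close>

definition next_arc :: "diagram \<Rightarrow> arc \<Rightarrow> arc" where
  "next_arc D = (\<lambda>(j, k). (j, if k = narcs D j then 1 else k + 1))"

text \<open>The relations \<open>\<alpha>\<^sub>k\<^sub>+\<^sub>1 = \<beta>\<^sub>k\<^sup>-\<^sup>\<epsilon> \<alpha>\<^sub>k \<beta>\<^sub>k\<^sup>\<epsilon>\<close>.\<close>

definition wirtinger_rels :: "diagram \<Rightarrow> (arc word \<times> arc word) set" where
  "wirtinger_rels D =
    {([(next_arc D c, True)],
      [(over_arc D c, csign D c \<noteq> 1), (c, True), (over_arc D c, csign D c = 1)]) | c. c \<in> arcs D}"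

definition link_group :: "diagram \<Rightarrow> arc word set monoid" where
  "link_group D = presented_group (arcs D) (wirtinger_rels D)"

definition arc_gen :: "diagram \<Rightarrow> arc \<Rightarrow> arc word set" where
  "arc_gen D a = pres_class (arcs D) (wirtinger_rels D) [(a, True)]"

definition meridian :: "diagram \<Rightarrow> nat \<Rightarrow> arc word set" where
  "meridian D j = arc_gen D (j, 1)"

text \<open>The linking number with component \<open>j\<close> is the homomorphism from the link group to the integers
  that sends the meridians of component \<open>j\<close> to 1 and those of the other components to 0.\<close>

definition linking_number :: "diagram \<Rightarrow> nat \<Rightarrow> arc word set \<Rightarrow> int" where
  "linking_number D j = pres_lift integer_group (\<lambda>a. if fst a = j then 1 else 0)"

definition framed_longitude :: "diagram \<Rightarrow> nat \<Rightarrow> int \<Rightarrow> arc word set" where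
  "framed_longitude D j w =
    (let G = link_group D
     in arc_gen D (j, 1) [^]\<^bsub>G\<^esub> (- w) \<otimes>\<^bsub>G\<^esub>
        foldr (\<lambda>k y. arc_gen D (over_arc D (j, k)) [^]\<^bsub>G\<^esub> csign D (j, k) \<otimes>\<^bsub>G\<^esub> y)
          [1..<Suc (narcs D j)] \<one>\<^bsub>G\<^esub>)"

definition longitude :: "diagram \<Rightarrow> nat \<Rightarrow> arc word set" where
  "longitude D j = framed_longitude D j (THE w. linking_number D j (framed_longitude D j w) = 0)"


section \<open>The assumption on the link and the invariant\<close>

definition is_abelianization ::
  "('a, 'c) monoid_scheme \<Rightarrow> ('b, 'd) monoid_scheme \<Rightarrow> ('a \<Rightarrow> 'b) \<Rightarrow> bool" where
  "is_abelianization G H h \<longleftrightarrow>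
    comm_group H \<and> h \<in> hom G H \<and> h ` carrier G = carrier H \<and>
    kernel G H h = derived G (carrier G)"

definition assumption_A :: "diagram \<Rightarrow> nat \<Rightarrow> (nat \<Rightarrow> arc word set \<Rightarrow> nat word set set) \<Rightarrow> bool" where
  "assumption_A D m f \<longleftrightarrow>
    (let q = ncomp D; G = link_group D
     in (\<forall>k\<in>{2..m}. f k \<in> hom G (nil_quot q k)) \<and>
        is_abelianization G (nil_quot q 2) (f 2) \<and>
        (\<forall>k\<in>{3..m}. \<forall>g\<in>carrier G. nil_proj q (k - 1) (f k g) = f (k - 1) g) \<and>
        (\<forall>k\<in>{2..m}. \<forall>j\<in>{1..q}. f k (meridian D j) = Gam q k #>\<^bsub>free_group q\<^esub> free_gen q j))"

text \<open>\<open>admissible_lifts D m f j B\<close>: each \<open>B k\<close> is a lift of \<open>\<Upsilon>\<^sub>m(f\<^sub>m(\<beta>\<^sub>k))\<close>, with \<open>\<beta>\<^sub>k\<close> the \<open>k\<close>-th arc under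
  which component \<open>j\<close> passes.\<close>

definition admissible_lifts ::
  "diagram \<Rightarrow> nat \<Rightarrow> (nat \<Rightarrow> arc word set \<Rightarrow> nat word set set) \<Rightarrow> nat \<Rightarrow> (nat \<Rightarrow> magnus_ring mat) \<Rightarrow> bool"
where
  "admissible_lifts D m f j B \<longleftrightarrow>
    (\<forall>k\<in>{1..narcs D j}.
       B k \<in> Im_Upsilon (ncomp D) (m + 1) \<and>
       Im_proj (ncomp D) m (B k) = Upsilon_quot m (f m (arc_gen D (over_arc D (j, k)))))"

text \<open>\<open>C_assign D m j B k\<close> is the matrix assigned to the arc \<open>(j, k)\<close>; the value at \<open>k = 0\<close> is a dummy.\<close>

fun C_assign :: "diagram \<Rightarrow> nat \<Rightarrow> nat \<Rightarrow> (nat \<Rightarrow> magnus_ring mat) \<Rightarrow> nat \<Rightarrow> magnus_ring mat" where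
  "C_assign D m j B 0 = Upsilon (m + 1) (free_gen (ncomp D) j)"
| "C_assign D m j B (Suc 0) = Upsilon (m + 1) (free_gen (ncomp D) j)"
| "C_assign D m j B (Suc (Suc k)) =
     B (Suc k) [^]\<^bsub>GL (m + 1)\<^esub> (- csign D (j, Suc k)) \<otimes>\<^bsub>GL (m + 1)\<^esub>
     C_assign D m j B (Suc k) \<otimes>\<^bsub>GL (m + 1)\<^esub>
     B (Suc k) [^]\<^bsub>GL (m + 1)\<^esub> csign D (j, Suc k)"

definition Psi :: "diagram \<Rightarrow> nat \<Rightarrow> nat \<Rightarrow> (nat \<Rightarrow> magnus_ring mat) \<Rightarrow> magnus_ring mat" where
  "Psi D m j B =
    (let G = GL (m + 1); N = narcs D j
     in inv\<^bsub>G\<^esub> (Upsilon (m + 1) (free_gen (ncomp D) j)) \<otimes>\<^bsub>G\<^esub>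
        B N [^]\<^bsub>G\<^esub> (- csign D (j, N)) \<otimes>\<^bsub>G\<^esub> C_assign D m j B N \<otimes>\<^bsub>G\<^esub> B N [^]\<^bsub>G\<^esub> csign D (j, N))"

end

theory Submission
  imports Defs "HOL-Computational_Algebra.Formal_Power_Series" "HOL-Library.Nat_Bijection"
begin

text \<open>Through the Magnus expansion \<open>x\<^sub>j \<mapsto> 1 + X\<^sub>j\<close> into noncommutative power series, \<open>\<Upsilon>\<^sub>n\<close> records exactly the
  coefficients of degree less than \<open>n\<close>. By Magnus' theorem, proved here by Hall's collection process, an
  element lies in \<open>\<Gamma>\<^sub>nF\<close> as soon as these coefficients agree with those of 1.

  If \<open>y\<close> expands to \<open>1 + \<delta>\<close> with \<open>\<delta>\<close> of order at least \<open>m - 1\<close>, then \<open>[x\<^sub>j, y]\<close> expands to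
  \<open>1 + X\<^sub>j \<delta> - \<delta> X\<^sub>j\<close> modulo degree \<open>m + 1\<close>; this gives additivity, and injectivity because a series
  commuting with \<open>X\<^sub>j\<close> involves only powers of \<open>X\<^sub>j\<close>, whose coefficients are determined by the exponent sum
  of \<open>x\<^sub>j\<close>. In the same way the longitude, which commutes with the meridian and has linking number 0, is
  mapped to \<open>\<Gamma>\<^sub>m\<^sub>-\<^sub>1F\<close>. Finally \<open>\<Psi>\<^sub>m(j) = \<Upsilon>\<^sub>m\<^sub>+\<^sub>1[x\<^sub>j, P]\<close> for a lift \<open>P\<close> of \<open>\<beta>\<^sub>1\<^sup>\<epsilon>\<^sup>1 \<dots> \<beta>\<^sub>N\<^sup>\<epsilon>\<^sup>N\<close>, and the framing
  factor \<open>x\<^sub>j\<^sup>-\<^sup>w\<close> does not change the commutator.\<close>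

text \<open>The hard half of Magnus' theorem is often drawn from a basis of the free Lie ring. Here
  independence is carried along in a stronger form: no nontrivial combination of the leading terms
  vanishes, even with coefficients from the whole series ring written on the right. Unlike linear
  independence over the integers, this survives Lazard elimination, which removes one member x and
  replaces the others by their iterated commutators with x, simultaneously in the group and on
  leading terms. Only the consequence for integer coefficients is needed to see that the removed
  member has exponent zero.

  Commutation with \<open>X_j\<close> says nothing about the coefficients at powers of
  \<open>X_j\<close>, so the exponent sum of \<open>x_j\<close> has to vanish for a separate reason.
  For the longitude this reason is the zero linking number. For an element of Gamma_{m-1} it is
  membership in Gamma_2, available only for m at least 3. For m = 2 the element \<open>x_j\<close>
  itself is sent to [x_j, x_j] = 1, so injectivity can hold only from m = 3 on.\<close>

section \<open>Noncommutative power series\<close>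

text \<open>Coefficient functions of arbitrary support are allowed, because the inverse of 1 + X is
  an infinite series. A separate type makes the ring instance possible.\<close>

typedef 'a ncps = "UNIV :: ('a list \<Rightarrow> int) set"
  morphisms ncoeff Abs_ncps ..

setup_lifting type_definition_ncps

lemma ncps_eqI: "(\<And>w. ncoeff f w = ncoeff g w) \<Longrightarrow> f = g"
  by (simp add: ncoeff_inject[symmetric] ext)

text \<open>This is the Cauchy product, the sum over all splittings of a word into prefix and
  suffix. Peeling letters off the left factor makes the ring laws provable by induction on the word
  with the left factor generalized.\<close>

fun conv :: "('a list \<Rightarrow> int) \<Rightarrow> ('a list \<Rightarrow> int) \<Rightarrow> 'a list \<Rightarrow> int" where
  "conv f g [] = f [] * g []"
| "conv f g (x # w) = f [] * g (x # w) + conv (\<lambda>w. f (x # w)) g w"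

lemma conv_add_left: "conv (\<lambda>w. f w + g w) h w = conv f h w + conv g h w"
  by (induction w arbitrary: f g) (auto simp: algebra_simps)

lemma conv_scale_left: "conv (\<lambda>w. c * f w) h w = c * conv f h w"
  by (induction w arbitrary: f) (auto simp: algebra_simps)

lemma conv_add_right: "conv f (\<lambda>w. g w + h w) w = conv f g w + conv f h w"
  by (induction w arbitrary: f) (auto simp: algebra_simps)

lemma conv_zero_left: "conv (\<lambda>w. 0) g w = 0"
  by (induction w) auto

lemma conv_assoc: "conv (conv f g) h w = conv f (conv g h) w"
proof (induction w arbitrary: f g)
  case (Cons x w)
  show ?case
    by (simp add: conv_add_left conv_scale_left Cons.IH algebra_simps)
qed simp

lemma conv_one_left: "conv (\<lambda>w. if w = [] then 1 else 0) f w = f w"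
  by (cases w) (simp_all add: conv_zero_left)

lemma conv_one_right: "conv f (\<lambda>w. if w = [] then 1 else 0) w = f w"
  by (induction w arbitrary: f) auto

instantiation ncps :: (type) ring_1
begin

lift_definition zero_ncps :: "'a ncps" is "\<lambda>w. 0" .
lift_definition one_ncps :: "'a ncps" is "\<lambda>w. if w = [] then 1 else 0" .
lift_definition plus_ncps :: "'a ncps \<Rightarrow> 'a ncps \<Rightarrow> 'a ncps" is "\<lambda>f g w. f w + g w" .
lift_definition minus_ncps :: "'a ncps \<Rightarrow> 'a ncps \<Rightarrow> 'a ncps" is "\<lambda>f g w. f w - g w" .
lift_definition uminus_ncps :: "'a ncps \<Rightarrow> 'a ncps" is "\<lambda>f w. - f w" .
lift_definition times_ncps :: "'a ncps \<Rightarrow> 'a ncps \<Rightarrow> 'a ncps" is conv .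

instance
proof
  show "(0::'a ncps) \<noteq> 1" by transfer (metis zero_neq_one)
qed (transfer; auto simp: conv_assoc conv_one_left conv_one_right conv_add_left conv_add_right
      fun_eq_iff)+

end

section \<open>Coefficients, shifts, order and homogeneous components\<close>

lemma ncoeff_simps [simp]:
  "ncoeff 0 w = 0" "ncoeff (f + g) w = ncoeff f w + ncoeff g w"
  "ncoeff (f - g) w = ncoeff f w - ncoeff g w" "ncoeff (- f) w = - ncoeff f w"
  by (transfer; simp)+

lemma ncoeff_one: "ncoeff 1 w = (if w = [] then 1 else 0)"
  by transfer simp

text \<open>A left derivative: \<open>f\<close> is its constant term plus the sum of the
  \<open>X_x\<close> times \<open>nshift x f\<close>. Most arguments below descend along this
  decomposition.\<close>

lift_definition nshift :: "'a \<Rightarrow> 'a ncps \<Rightarrow> 'a ncps" is "\<lambda>x f w. f (x # w)" .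

lemma ncoeff_nshift [simp]: "ncoeff (nshift x f) w = ncoeff f (x # w)"
  by transfer simp

lemma ncoeff_times_Nil [simp]: "ncoeff (f * g) [] = ncoeff f [] * ncoeff g []"
  by transfer simp

lemma ncoeff_times_Cons:
  "ncoeff (f * g) (x # w) = ncoeff f [] * ncoeff g (x # w) + ncoeff (nshift x f * g) w"
  by transfer simp

lemma ncoeff_times_nonzeroD:
  assumes "ncoeff (f * g) w \<noteq> 0"
  obtains u v where "w = u @ v" "ncoeff f u \<noteq> 0" "ncoeff g v \<noteq> 0"
proof -
  have "\<exists>u v. w = u @ v \<and> ncoeff f u \<noteq> 0 \<and> ncoeff g v \<noteq> 0"
    using assms
  proof (induction w arbitrary: f)
    case (Cons x w)
    show ?case
    proof (cases "ncoeff f [] * ncoeff g (x # w) = 0")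
      case True
      then have "ncoeff (nshift x f * g) w \<noteq> 0"
        using Cons.prems unfolding ncoeff_times_Cons by linarith
      from Cons.IH[OF this] obtain u v where
        "w = u @ v" "ncoeff (nshift x f) u \<noteq> 0" "ncoeff g v \<noteq> 0" by blast
      then show ?thesis by (intro exI[of _ "x # u"] exI[of _ v]) simp
    next
      case False
      then show ?thesis by (intro exI[of _ "[]"] exI[of _ "x # w"]) simp
    qed
  qed simp
  then show thesis using that by blast
qed

definition ord_ge :: "nat \<Rightarrow> 'a ncps \<Rightarrow> bool" where
  "ord_ge n f \<longleftrightarrow> (\<forall>w. length w < n \<longrightarrow> ncoeff f w = 0)"

definition homog :: "nat \<Rightarrow> 'a ncps \<Rightarrow> bool" where
  "homog d f \<longleftrightarrow> (\<forall>w. length w \<noteq> d \<longrightarrow> ncoeff f w = 0)"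

lemma ord_ge_0 [simp]: "ord_ge 0 f"
  and ord_ge_zero [simp]: "ord_ge n 0"
  and ord_ge_mono: "ord_ge n f \<Longrightarrow> m \<le> n \<Longrightarrow> ord_ge m f"
  and ord_ge_add: "ord_ge n f \<Longrightarrow> ord_ge n g \<Longrightarrow> ord_ge n (f + g)"
  and ord_ge_diff: "ord_ge n f \<Longrightarrow> ord_ge n g \<Longrightarrow> ord_ge n (f - g)"
  and ord_ge_uminus: "ord_ge n f \<Longrightarrow> ord_ge n (- f)"
  by (auto simp: ord_ge_def)

lemma ord_ge_times:
  assumes "ord_ge m f" "ord_ge n g" shows "ord_ge (m + n) (f * g)"
  unfolding ord_ge_def
proof (intro allI impI)
  fix w :: "'a list" assume w: "length w < m + n"
  show "ncoeff (f * g) w = 0"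
  proof (rule ccontr)
    assume "ncoeff (f * g) w \<noteq> 0"
    then obtain u v where uv: "w = u @ v" "ncoeff f u \<noteq> 0" "ncoeff g v \<noteq> 0"
      by (rule ncoeff_times_nonzeroD)
    with assms have "m \<le> length u" "n \<le> length v" by (auto simp: ord_ge_def not_less[symmetric])
    with w uv show False by simp
  qed
qed

lemma ord_ge_times_left: "ord_ge n g \<Longrightarrow> ord_ge n (f * g)"
  and ord_ge_times_right: "ord_ge n f \<Longrightarrow> ord_ge n (f * g)"
  using ord_ge_times[of 0 f n g] ord_ge_times[of n f 0 g] by auto

lemma homog_ord_ge: "homog d f \<Longrightarrow> ord_ge d f"
  by (auto simp: homog_def ord_ge_def)

lemma homog_zero [simp]: "homog d 0"
  and homog_add: "homog d f \<Longrightarrow> homog d g \<Longrightarrow> homog d (f + g)"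
  and homog_diff: "homog d f \<Longrightarrow> homog d g \<Longrightarrow> homog d (f - g)"
  by (auto simp: homog_def)

lemma homog_times:
  assumes "homog m f" "homog n g" shows "homog (m + n) (f * g)"
  unfolding homog_def
proof (intro allI impI)
  fix w :: "'a list" assume w: "length w \<noteq> m + n"
  show "ncoeff (f * g) w = 0"
  proof (rule ccontr)
    assume "ncoeff (f * g) w \<noteq> 0"
    then obtain u v where uv: "w = u @ v" "ncoeff f u \<noteq> 0" "ncoeff g v \<noteq> 0"
      by (rule ncoeff_times_nonzeroD)
    with assms have "m = length u" "n = length v" by (auto simp: homog_def)
    with w uv show False by simp
  qed
qed

lemma homog_zeroI: "homog d f \<Longrightarrow> ord_ge (Suc d) f \<Longrightarrow> f = 0"
  by (rule ncps_eqI) (metis homog_def lessI ncoeff_simps(1) ord_ge_def)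

lemma homog_sum: "(\<And>i. i \<in> I \<Longrightarrow> homog d (f i)) \<Longrightarrow> homog d (\<Sum>i\<in>I. f i)"
  by (induction I rule: infinite_finite_induct) (auto intro: homog_add)

lemma ncoeff_of_int: "ncoeff (of_int c) w = (if w = [] then c else 0)"
  by (induction c rule: int_induct[where k = 0]) (auto simp: ncoeff_one)

lemma homog_of_int: "homog 0 (of_int c)"
  by (auto simp: homog_def ncoeff_of_int)

lift_definition nvar :: "'a \<Rightarrow> 'a ncps" is "\<lambda>x w. if w = [x] then 1 else 0" .

lemma ncoeff_nvar: "ncoeff (nvar x) w = (if w = [x] then 1 else 0)"
  by transfer simp

lemma homog_nvar: "homog 1 (nvar x)"
  by (auto simp: homog_def ncoeff_nvar)

lemma nshift_nvar: "nshift y (nvar x) = (if x = y then 1 else 0)"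
  by (rule ncps_eqI) (auto simp: ncoeff_nvar ncoeff_one)

lemma ncoeff_nvar_times:
  "ncoeff (nvar x * f) w = (case w of [] \<Rightarrow> 0 | y # v \<Rightarrow> if x = y then ncoeff f v else 0)"
  by (cases w) (auto simp: ncoeff_times_Cons ncoeff_nvar nshift_nvar)

lemma ncoeff_times_nvar_snoc:
  "ncoeff (f * nvar x) (w @ [y]) = (if x = y then ncoeff f w else 0)"
  by (induction w arbitrary: f) (auto simp: ncoeff_times_Cons ncoeff_nvar)

lemma nshift_times:
  "nshift x (f * g) = of_int (ncoeff f []) * nshift x g + nshift x f * g"
proof (rule ncps_eqI)
  have *: "ncoeff (of_int c * h) w = c * ncoeff h w" for c and h :: "'a ncps" and w
  proof -
    have "nshift y (of_int c) = 0" for y :: 'a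
      by (rule ncps_eqI) (simp add: ncoeff_of_int)
    then show ?thesis by (cases w) (simp_all add: ncoeff_times_Cons ncoeff_of_int)
  qed
  show "ncoeff (nshift x (f * g)) w = ncoeff (of_int (ncoeff f []) * nshift x g + nshift x f * g) w" for w
    by (simp add: ncoeff_times_Cons *)
qed

text \<open>Sets all variables other than \<open>x\<close> to 0.\<close>

definition restrict_var :: "'a \<Rightarrow> 'a ncps \<Rightarrow> int fps" where
  "restrict_var x f = Abs_fps (\<lambda>k. ncoeff f (replicate k x))"

lemma restrict_var_one [simp]: "restrict_var x 1 = 1"
  by (rule fps_ext) (auto simp: restrict_var_def ncoeff_one)

lemma restrict_var_add: "restrict_var x (f + g) = restrict_var x f + restrict_var x g"
  by (rule fps_ext) (auto simp: restrict_var_def)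

lemma restrict_var_nvar: "restrict_var x (nvar y) = (if x = y then fps_X else 0)"
proof (rule fps_ext)
  have "(replicate k x = [y]) = (k = 1 \<and> x = y)" for k
    by (cases k) auto
  then show "fps_nth (restrict_var x (nvar y)) k = fps_nth (if x = y then fps_X else 0) k" for k
    by (simp add: restrict_var_def ncoeff_nvar)
qed

lemma restrict_var_times: "restrict_var x (f * g) = restrict_var x f * restrict_var x g"
proof (rule fps_ext)
  have "ncoeff (f * g) (replicate k x) =
      (\<Sum>i=0..k. ncoeff f (replicate i x) * ncoeff g (replicate (k - i) x))" for k
  proof (induction k arbitrary: f)
    case (Suc k)
    show ?case
      by (subst sum.atLeast0_atMost_Suc_shift) (simp add: ncoeff_times_Cons Suc)
  qed simp
  then show "fps_nth (restrict_var x (f * g)) k = fps_nth (restrict_var x f * restrict_var x g) k" for k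
    by (simp add: restrict_var_def fps_mult_nth)
qed

section \<open>Right independence\<close>

text \<open>The family is a basis of the right ideal that it generates. The coefficients run over
  the whole ring, which is what makes the property stable under elimination.\<close>

definition right_indep :: "'i set \<Rightarrow> ('i \<Rightarrow> 'a::ring_1) \<Rightarrow> bool" where
  "right_indep I l \<longleftrightarrow> (\<forall>a. (\<Sum>i\<in>I. l i * a i) = 0 \<longrightarrow> (\<forall>i\<in>I. a i = 0))"

lemma right_indepD: "right_indep I l \<Longrightarrow> (\<Sum>i\<in>I. l i * a i) = 0 \<Longrightarrow> i \<in> I \<Longrightarrow> a i = 0"
  by (auto simp: right_indep_def)

lemma right_indep_reindex:
  assumes "inj_on h I" "right_indep I (\<lambda>i. l (h i))" shows "right_indep (h ` I) l"
  unfolding right_indep_def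
proof (intro allI impI)
  fix a assume "(\<Sum>i\<in>h ` I. l i * a i) = 0"
  then have "(\<Sum>i\<in>I. l (h i) * a (h i)) = 0" using assms(1) by (simp add: sum.reindex)
  from right_indepD[OF assms(2) this] show "\<forall>i\<in>h ` I. a i = 0" by auto
qed

text \<open>Every nonempty word has exactly one first letter, so the coefficient of the sum at
  \<open>j # w\<close> is that of \<open>a j\<close> at \<open>w\<close>.\<close>

lemma right_indep_nvar:
  assumes "finite J" shows "right_indep J nvar"
  unfolding right_indep_def
proof (intro allI impI ballI)
  fix a :: "'a \<Rightarrow> 'a ncps" and j assume sum: "(\<Sum>i\<in>J. nvar i * a i) = 0" and j: "j \<in> J"
  show "a j = 0"
  proof (rule ncps_eqI)
    fix w
    have "ncoeff (\<Sum>i\<in>I. nvar i * a i) (j # w) = (\<Sum>i\<in>I. if i = j then ncoeff (a j) w else 0)"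
      for I :: "'a set"
      by (induction I rule: infinite_finite_induct) (auto simp: ncoeff_nvar_times)
    from this[of J] have "ncoeff 0 (j # w) = ncoeff (a j) w"
      using j assms unfolding sum by simp
    then show "ncoeff (a j) w = ncoeff 0 w" by simp
  qed
qed

text \<open>The order of the two products is that of the group commutator: if \<open>u\<close> and
  \<open>y\<close> are leading terms of g and x, then \<open>ad y u\<close> is the expected leading
  term of \<open>commu G g x\<close>.\<close>

definition ad :: "'a::ring_1 \<Rightarrow> 'a \<Rightarrow> 'a" where
  "ad y u = u * y - y * u"

text \<open>\<open>ad y\<close> is right multiplication minus left multiplication by
  \<open>y\<close>. These two operators commute, so this is the binomial theorem for their
  difference.\<close>

lemma ad_funpow_binomial:
  fixes y u :: "'a::ring_1"
  shows "(ad y ^^ k) u = (\<Sum>j\<le>k. of_int ((-1) ^ j * int (k choose j)) * (y ^ j * (u * y ^ (k - j))))"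
proof (induction k)
  case (Suc k)
  define c :: "nat \<Rightarrow> nat \<Rightarrow> 'a" where "c k j = of_int ((-1) ^ j * int (k choose j))" for k j
  have comm: "y * (c k j * v) = c k j * (y * v)" for k j v
    unfolding c_def by (metis mult.assoc mult_of_int_commute)
  have c: "c (Suc k) (Suc j) = c k (Suc j) - c k j" for j
    unfolding c_def by (simp add: algebra_simps)
  have 1: "(\<Sum>j\<le>k. c k j * (y ^ j * (u * y ^ (k - j)))) * y = 
      (\<Sum>j\<le>Suc k. c k j * (y ^ j * (u * y ^ (Suc k - j))))"
    by (simp add: c_def binomial_eq_0 sum_distrib_right mult.assoc Suc_diff_le power_Suc2 del: power_Suc)
  have "(ad y ^^ Suc k) u = ad y (\<Sum>j\<le>k. c k j * (y ^ j * (u * y ^ (k - j))))"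
    using Suc by (simp add: c_def)
  also have "\<dots> = (\<Sum>j\<le>Suc k. c k j * (y ^ j * (u * y ^ (Suc k - j))))
      - (\<Sum>j\<le>k. c k j * (y ^ Suc j * (u * y ^ (k - j))))"
    unfolding ad_def 1 by (simp add: sum_distrib_left comm mult.assoc)
  also have "\<dots> = (\<Sum>j\<le>Suc k. c (Suc k) j * (y ^ j * (u * y ^ (Suc k - j))))"
    by (subst (1 2) sum.atMost_Suc_shift)
      (simp add: c left_diff_distrib sum_subtractf, simp add: c_def binomial_eq_0)
  finally show ?case by (simp add: c_def)
qed simp

text \<open>The summand j = 0 starts with some \<open>l z\<close>, z different from
  \<open>x\<close>, and all others start with \<open>l x\<close>. Right independence kills the first
  and allows one factor \<open>l x\<close> to be stripped from the rest. Hence the products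
  \<open>l x ^ j * l z\<close> are again right independent.\<close>

lemma peel_powers:
  assumes ind: "right_indep I l" and x: "x \<in> I" "finite I"
    and "(\<Sum>j<N. l x ^ j * (\<Sum>z\<in>I - {x}. l z * e j z)) = 0" "j < N" "z \<in> I - {x}"
  shows "e j z = 0"
  using assms(4-)
proof (induction N arbitrary: e j)
  case (Suc N)
  let ?r = "\<Sum>j<N. l x ^ j * (\<Sum>z\<in>I - {x}. l z * e (Suc j) z)"
  let ?a = "\<lambda>i. if i = x then ?r else e 0 i"
  have "0 = (\<Sum>z\<in>I - {x}. l z * e 0 z) + l x * ?r"
    using Suc.prems(1) unfolding sum.lessThan_Suc_shift
    by (simp add: sum_distrib_left mult.assoc)
  also have "\<dots> = (\<Sum>i\<in>I. l i * ?a i)"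
    using x by (simp add: sum.remove[of I x])
  finally have a: "?a i = 0" if "i \<in> I" for i
    using right_indepD[OF ind, of ?a i] that by simp
  show ?case
  proof (cases j)
    case 0
    then show ?thesis using a[of z] Suc.prems(3) by auto
  next
    case (Suc j')
    have "?r = 0" using a[of x] x by simp
    then have "e (Suc j') z = 0" using Suc.prems Suc by (intro Suc.IH[of "\<lambda>j. e (Suc j)"]) auto
    then show ?thesis using Suc by simp
  qed
qed simp

text \<open>The binomial coefficient vanishes for k < j and is 1 for k = j, so the system is
  triangular with diagonal entries of absolute value 1 and is solved from the largest index
  downwards. The truncated subtraction \<open>k - j\<close> matters only where the coefficient is
  zero.\<close>

lemma binomial_triangular:
  fixes y :: "'a::ring_1"
  assumes "\<And>j. j < n \<Longrightarrow> (\<Sum>k<n. of_int ((-1) ^ j * int (k choose j)) * (y ^ (k - j) * a k)) = 0"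
    and "k < n"
  shows "a k = 0"
  using assms(2)
proof (induction "n - k" arbitrary: k rule: less_induct)
  case less
  have "a k' = 0" if "k < k'" "k' < n" for k'
    using less.hyps[of k'] that less.prems by auto
  then have "of_int ((-1) ^ k * int (k' choose k)) * (y ^ (k' - k) * a k') = 0" if "k' < n" "k' \<noteq> k" for k'
    using that by (cases "k' < k") (simp_all add: binomial_eq_0)
  then have "(\<Sum>k'<n. of_int ((-1) ^ k * int (k' choose k)) * (y ^ (k' - k) * a k')) =
      (\<Sum>k'\<in>{k}. of_int ((-1) ^ k * int (k' choose k)) * (y ^ (k' - k) * a k'))"
    using less.prems by (intro sum.mono_neutral_right) auto
  with assms(1)[OF less.prems] have "(-1) ^ k * a k = 0" by simp
  then have "(-1) ^ k * ((-1) ^ k * a k) = 0" by simp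
  then show ?case by (simp flip: mult.assoc power_add)
qed

text \<open>Lazard elimination for leading terms. The binomial formula expresses the new family by
  the products \<open>l x ^ j * l z\<close>, which are independent by \<open>peel_powers\<close>;
  the change of coefficients is the triangular system of \<open>binomial_triangular\<close>.\<close>

lemma right_indep_eliminate:
  fixes l :: "'i \<Rightarrow> 'a::ring_1"
  assumes ind: "right_indep I l" and x: "x \<in> I" "finite I"
  shows "right_indep ((I - {x}) \<times> {..<n}) (\<lambda>(z, k). (ad (l x) ^^ k) (l z))"
  unfolding right_indep_def
proof (intro allI impI ballI)
  fix a i assume sum0: "(\<Sum>i\<in>(I - {x}) \<times> {..<n}. (case i of (z, k) \<Rightarrow> (ad (l x) ^^ k) (l z)) * a i) = 0"
    and i: "i \<in> (I - {x}) \<times> {..<n}"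
  define c :: "nat \<Rightarrow> nat \<Rightarrow> 'a" where "c k j = of_int ((-1) ^ j * int (k choose j))" for k j
  have comm: "c k j * v = v * c k j" for k j v
    unfolding c_def by (rule mult_of_int_commute)
  \<comment> \<open>The total coefficient to the right of \<open>l x ^ j * l z\<close> after the
    expansion.\<close>
  define e where "e j z = (\<Sum>k<n. c k j * (l x ^ (k - j) * a (z, k)))" for j z
  have ad: "(ad (l x) ^^ k) u * v = (\<Sum>j<n. l x ^ j * (u * (c k j * (l x ^ (k - j) * v))))"
    if "k < n" for k u v
  proof -
    have "(ad (l x) ^^ k) u = (\<Sum>j\<le>k. c k j * (l x ^ j * (u * l x ^ (k - j))))"
      unfolding c_def by (rule ad_funpow_binomial)
    also have "\<dots> = (\<Sum>j<n. c k j * (l x ^ j * (u * l x ^ (k - j))))"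
      using that by (intro sum.mono_neutral_left) (auto simp: c_def binomial_eq_0)
    finally show ?thesis
      by (simp add: sum_distrib_right mult.assoc comm)
  qed
  have "(\<Sum>i\<in>(I - {x}) \<times> {..<n}. (case i of (z, k) \<Rightarrow> (ad (l x) ^^ k) (l z)) * a i) =
      (\<Sum>z\<in>I - {x}. \<Sum>k<n. \<Sum>j<n. l x ^ j * (l z * (c k j * (l x ^ (k - j) * a (z, k)))))"
    by (simp add: sum.cartesian_product' ad)
  also have "\<dots> = (\<Sum>z\<in>I - {x}. \<Sum>j<n. l x ^ j * (l z * e j z))"
    by (subst sum.swap) (simp add: e_def sum_distrib_left)
  also have "\<dots> = (\<Sum>j<n. l x ^ j * (\<Sum>z\<in>I - {x}. l z * e j z))"
    by (subst sum.swap) (simp add: sum_distrib_left)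
  finally have e: "e j z = 0" if "j < n" "z \<in> I - {x}" for j z
    using that sum0 by (intro peel_powers[OF ind x, where e = e and j = j and z = z]) simp_all
  obtain z k where zk: "i = (z, k)" "z \<in> I - {x}" "k < n" using i by auto
  have "a (z, k) = 0"
    using e[OF _ zk(2)] zk(3)
    by (intro binomial_triangular[of n "l x" "\<lambda>k. a (z, k)"]) (auto simp: e_def c_def)
  then show "a i = 0" using zk by simp
qed

lemma homog_ad_funpow:
  assumes "homog d y" "homog e u" shows "homog (e + k * d) ((ad y ^^ k) u)"
proof (induction k)
  case (Suc k)
  have "homog (e + k * d + d) (ad y ((ad y ^^ k) u))"
    unfolding ad_def[of y "(ad y ^^ k) u"] using homog_times[OF Suc assms(1)] homog_times[OF assms(1) Suc]
    by (intro homog_diff) (simp_all add: add.commute)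
  then show ?case by (simp add: algebra_simps)
qed (use assms in simp)

section \<open>Commutators and the lower central series\<close>

abbreviation commu :: "('a, 'b) monoid_scheme \<Rightarrow> 'a \<Rightarrow> 'a \<Rightarrow> 'a" where
  "commu G x y \<equiv> inv\<^bsub>G\<^esub> x \<otimes>\<^bsub>G\<^esub> inv\<^bsub>G\<^esub> y \<otimes>\<^bsub>G\<^esub> x \<otimes>\<^bsub>G\<^esub> y"

context group
begin

lemma inv_mult_cancel: "x \<in> carrier G \<Longrightarrow> y \<in> carrier G \<Longrightarrow> inv x \<otimes> (x \<otimes> y) = y"
  and mult_inv_cancel: "x \<in> carrier G \<Longrightarrow> y \<in> carrier G \<Longrightarrow> x \<otimes> (inv x \<otimes> y) = y"
  by (simp_all flip: m_assoc)

lemmas group_normalize = m_assoc inv_mult_group inv_mult_cancel mult_inv_cancel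

lemma inv_commu: "x \<in> carrier G \<Longrightarrow> y \<in> carrier G \<Longrightarrow> inv (commu G x y) = commu G y x"
  by (simp add: group_normalize)

lemma commu_eq_one_iff:
  assumes "x \<in> carrier G" "y \<in> carrier G"
  shows "commu G x y = \<one> \<longleftrightarrow> x \<otimes> y = y \<otimes> x"
proof -
  have "x \<otimes> y = y \<otimes> x \<otimes> commu G x y" using assms by (simp add: group_normalize)
  with assms show ?thesis
    by (metis inv_closed l_cancel_one m_closed)
qed

text \<open>A form of the three subgroups lemma: applied in the quotient by \<open>\<Gamma>\<^sub>a\<^sub>+\<^sub>b\<^sub>+\<^sub>1\<close>, where \<open>[h, x]\<close> is central.\<close>

lemma commute_commu:
  assumes [simp]: "x \<in> carrier G" "h \<in> carrier G" "k \<in> carrier G"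
    and hc: "\<And>g. g \<in> carrier G \<Longrightarrow> commu G h x \<otimes> g = g \<otimes> commu G h x"
    and kd: "commu G (inv k) x \<otimes> h = h \<otimes> commu G (inv k) x"
  shows "x \<otimes> commu G h k = commu G h k \<otimes> x"
proof -
  \<comment> \<open>Conjugation by \<open>x\<close> turns \<open>h\<close> into \<open>h c\<close>
    and \<open>k\<close> into \<open>d k\<close>. Since \<open>c\<close> is central and
    \<open>d\<close> commutes with \<open>h\<close>, it turns \<open>h k\<close> into
    \<open>d h k c\<close> and \<open>k h\<close> into \<open>d k h c\<close>; the extra factors
    cancel in [h, k] = (k h)^{-1} (h k).\<close>
  define c where "c = commu G h x"
  define d where "d = commu G x (inv k)"
  have [simp]: "c \<in> carrier G" "d \<in> carrier G" by (auto simp: c_def d_def)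
  have h: "h \<otimes> x = x \<otimes> (h \<otimes> c)" by (simp add: c_def group_normalize)
  have k: "k \<otimes> x = x \<otimes> (d \<otimes> k)" by (simp add: d_def group_normalize)
  have dh: "h \<otimes> d = d \<otimes> h"
  proof -
    have "d = inv (commu G (inv k) x)" unfolding d_def by (simp add: group_normalize)
    moreover have "inv u \<otimes> h = h \<otimes> inv u" if "u \<in> carrier G" "u \<otimes> h = h \<otimes> u" for u
      using that by (metis assms(2) inv_closed inv_solve_left m_assoc m_closed r_inv r_one)
    ultimately show ?thesis using kd by simp
  qed
  have cg: "c \<otimes> g = g \<otimes> c" if "g \<in> carrier G" for g using hc that by (simp add: c_def)
  have "h \<otimes> k \<otimes> x = x \<otimes> (h \<otimes> d \<otimes> k \<otimes> c)"
    using h k cg by (smt (verit) \<open>c \<in> carrier G\<close> \<open>d \<in> carrier G\<close> assms(1-3) m_assoc m_closed)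
  also have "\<dots> = x \<otimes> (d \<otimes> h \<otimes> k \<otimes> c)" using dh by simp
  finally have 1: "h \<otimes> k \<otimes> x = x \<otimes> (d \<otimes> h \<otimes> k \<otimes> c)" .
  have 2: "k \<otimes> h \<otimes> x = x \<otimes> (d \<otimes> k \<otimes> h \<otimes> c)"
    using h k by (smt (verit) \<open>c \<in> carrier G\<close> \<open>d \<in> carrier G\<close> assms(1-3) m_assoc m_closed)
  have "inv (d \<otimes> k \<otimes> h \<otimes> c) \<otimes> (d \<otimes> h \<otimes> k \<otimes> c) = inv c \<otimes> (commu G h k \<otimes> c)"
    by (simp add: group_normalize)
  also have "\<dots> = inv c \<otimes> (c \<otimes> commu G h k)" using cg by simp
  also have "\<dots> = commu G h k" by (simp add: inv_mult_cancel)
  finally have 3: "inv (d \<otimes> k \<otimes> h \<otimes> c) \<otimes> (d \<otimes> h \<otimes> k \<otimes> c) = commu G h k" .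
  have "inv x \<otimes> (commu G h k \<otimes> x) = inv (k \<otimes> h \<otimes> x) \<otimes> (h \<otimes> k \<otimes> x)"
    by (simp add: group_normalize)
  also have "\<dots> = commu G h k"
    unfolding 1 2 using 3 by (simp add: inv_mult_group m_assoc inv_mult_cancel)
  finally show ?thesis by (metis assms(1-3) inv_closed inv_solve_left m_closed)
qed

lemma lower_central_Suc:
  "n \<ge> 1 \<Longrightarrow> lower_central G (Suc n) =
    generate G {commu G h k | h k. h \<in> lower_central G n \<and> k \<in> carrier G}"
  by (cases n) (auto simp: commutator_subgroup_def)

lemma lower_central_subset: "lower_central G n \<subseteq> carrier G"
proof (induction n)
  case (Suc n)
  show ?case
  proof (cases "n = 0")
    case False
    then have "lower_central G (Suc n) =
        generate G {commu G h k | h k. h \<in> lower_central G n \<and> k \<in> carrier G}"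
      by (intro lower_central_Suc) simp
    with Suc show ?thesis by (auto intro!: generate_incl)
  qed simp
qed simp

lemma lower_central_closed: "x \<in> lower_central G n \<Longrightarrow> x \<in> carrier G"
  using lower_central_subset by blast

lemma lower_central_subgroup: "subgroup (lower_central G n) G"
proof (cases "n \<le> 1")
  case True
  then have "n = 0 \<or> n = 1" by auto
  then show ?thesis by (auto simp: subgroup_self)
next
  case False
  then obtain k where "n = Suc k" "k \<ge> 1" by (cases n) auto
  then show ?thesis
    using lower_central_Suc[of k] lower_central_closed
    by (auto intro!: generate_is_subgroup m_closed)
qed

lemma commu_lower_central:
  assumes "n \<ge> 1" "x \<in> lower_central G n" "y \<in> carrier G"
  shows "commu G x y \<in> lower_central G (Suc n)"
  unfolding lower_central_Suc[OF assms(1)] using assms by (auto intro: generate.incl)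

text \<open>The inclusion comes first, by comparing generators. It yields invariance because the
  conjugate of x by y is x [x, y], and [x, y] lies in the next term, hence in the present
  one.\<close>

lemma lower_central_antimono: "n \<ge> 1 \<Longrightarrow> lower_central G (Suc n) \<subseteq> lower_central G n"
  and lower_central_conj: "n \<ge> 1 \<Longrightarrow> x \<in> lower_central G n \<Longrightarrow> y \<in> carrier G \<Longrightarrow>
    inv y \<otimes> x \<otimes> y \<in> lower_central G n"
proof (induction n arbitrary: x y)
  case (Suc n)
  have mono: "lower_central G (Suc (Suc n)) \<subseteq> lower_central G (Suc n)"
  proof (cases "n = 0")
    case True
    then show ?thesis using lower_central_subset[of "Suc (Suc n)"] by simp
  next
    case False
    then have sub: "lower_central G (Suc n) \<subseteq> lower_central G n" using Suc.IH by simp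
    show ?thesis
      using False sub by (subst lower_central_Suc, simp)
        (rule generate_subgroup_incl, auto intro!: lower_central_subgroup commu_lower_central)
  qed
  {
    case 1 show ?case by (rule mono)
  next
    case 2
    have x: "x \<in> carrier G" using 2 lower_central_closed by blast
    have "commu G x y \<in> lower_central G (Suc n)"
      using mono commu_lower_central[OF _ 2(2,3)] by auto
    then have "x \<otimes> commu G x y \<in> lower_central G (Suc n)"
      by (rule subgroup.m_closed[OF lower_central_subgroup 2(2)])
    then show ?case using x 2(3) by (simp add: group_normalize)
  }
qed auto

lemma lower_central_mono: 
  assumes "m \<le> n" "1 \<le> m" shows "lower_central G n \<subseteq> lower_central G m"
  using assms  
proof (induction rule: dec_induct)
  case (step n)
  then show ?case using lower_central_antimono[of n] by auto
qed simp

lemma lower_central_normal: "n \<ge> 1 \<Longrightarrow> lower_central G n \<lhd> G"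
proof (subst normal_inv_iff, intro conjI ballI)
  fix x h assume "n \<ge> 1" "x \<in> carrier G" "h \<in> lower_central G n"
  then show "x \<otimes> h \<otimes> inv x \<in> lower_central G n"
    using lower_central_conj[of n h "inv x"] by simp
qed (rule lower_central_subgroup)

text \<open>Replaces cosets by a surjection with kernel \<open>N\<close>, so that membership of a
  commutator in \<open>N\<close> becomes commutation of two images.\<close>

lemma normal_quotient:
  assumes "N \<lhd> G"
  obtains Q :: "'a set monoid" and p where "group_hom G Q p" "p ` carrier G = carrier Q"
    "\<And>g. g \<in> carrier G \<Longrightarrow> p g = \<one>\<^bsub>Q\<^esub> \<longleftrightarrow> g \<in> N"
proof
  interpret normal N G by fact
  show "group_hom G (G Mod N) (\<lambda>g. N #> g)"
    using factorgroup_is_group r_coset_hom_Mod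
    by (simp add: group_hom_def group_hom_axioms_def is_group)
  show "(\<lambda>g. N #> g) ` carrier G = carrier (G Mod N)"
    by (auto simp: FactGroup_def RCOSETS_def)
  fix g assume g: "g \<in> carrier G"
  have "\<one>\<^bsub>G Mod N\<^esub> = N" by (simp add: FactGroup_def)
  moreover have "N #> g = N \<longleftrightarrow> g \<in> N"
    using coset_join1[OF _ g subgroup_axioms] coset_join2[OF g subgroup_axioms] by auto
  ultimately show "(N #> g) = \<one>\<^bsub>G Mod N\<^esub> \<longleftrightarrow> g \<in> N" by simp
qed

text \<open>In the quotient by \<open>\<Gamma>\<^sub>a\<^sub>+\<^sub>b\<^sub>+\<^sub>1\<close> the elements commuting with \<open>x\<close> form a subgroup,
  so only the generators of \<open>\<Gamma>\<^sub>b\<^sub>+\<^sub>1\<close> matter.\<close>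

lemma commu_lower_central_add:
  assumes "a \<ge> 1" "b \<ge> 1" "x \<in> lower_central G a" "y \<in> lower_central G b"
  shows "commu G x y \<in> lower_central G (a + b)"
  using assms(2,1,3,4)
proof (induction b arbitrary: a x y rule: dec_induct)
  case base
  then show ?case using commu_lower_central[of a x y] by simp
next
  case (step b)
  define N where "N = lower_central G (a + Suc b)"
  have "N \<lhd> G" unfolding N_def by (rule lower_central_normal) simp
  then obtain Q :: "'a set monoid" and p where "group_hom G Q p" and surj: "p ` carrier G = carrier Q"
    and ker: "\<And>g. g \<in> carrier G \<Longrightarrow> p g = \<one>\<^bsub>Q\<^esub> \<longleftrightarrow> g \<in> N"
    by (rule normal_quotient) blast
  interpret P: group_hom G Q p by fact
  have pcomm: "p g \<otimes>\<^bsub>Q\<^esub> p h = p h \<otimes>\<^bsub>Q\<^esub> p g \<longleftrightarrow> commu G g h \<in> N"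
    if "g \<in> carrier G" "h \<in> carrier G" for g h
    using that ker[of "commu G g h"] P.H.commu_eq_one_iff[of "p g" "p h"] by simp
  have x: "x \<in> carrier G" using step.prems lower_central_closed by blast
  have key: "p x \<otimes>\<^bsub>Q\<^esub> p (commu G h k) = p (commu G h k) \<otimes>\<^bsub>Q\<^esub> p x"
    if h: "h \<in> lower_central G b" and k: "k \<in> carrier G" for h k
  proof -
    have hc: "h \<in> carrier G" using h lower_central_closed by blast
    have "commu Q (p h) (p x) \<otimes>\<^bsub>Q\<^esub> C = C \<otimes>\<^bsub>Q\<^esub> commu Q (p h) (p x)"
      if "C \<in> carrier Q" for C
    proof -
      have "C \<in> p ` carrier G" using that surj by simp
      then obtain g where g: "g \<in> carrier G" "C = p g" by auto
      have "commu G x h \<in> lower_central G (a + b)" using step.IH[of a x h] step.prems h by simp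
      then have "inv (commu G x h) \<in> lower_central G (a + b)"
        by (rule subgroup.m_inv_closed[OF lower_central_subgroup])
      then have "commu G h x \<in> lower_central G (a + b)" using inv_commu[OF x hc] by simp
      then have "commu G (commu G h x) g \<in> N"
        unfolding N_def using commu_lower_central[of "a + b" "commu G h x" g] g step by simp
      then show ?thesis using x hc g using pcomm[of "commu G h x" g] by simp
    qed
    moreover have "commu Q (inv\<^bsub>Q\<^esub> (p k)) (p x) \<otimes>\<^bsub>Q\<^esub> p h =
        p h \<otimes>\<^bsub>Q\<^esub> commu Q (inv\<^bsub>Q\<^esub> (p k)) (p x)"
    proof -
      have "commu G x (inv k) \<in> lower_central G (Suc a)"
        using commu_lower_central[of a x "inv k"] step.prems k by simp
      then have "inv (commu G x (inv k)) \<in> lower_central G (Suc a)"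
        by (rule subgroup.m_inv_closed[OF lower_central_subgroup])
      then have "commu G (inv k) x \<in> lower_central G (Suc a)" using inv_commu[OF x, of "inv k"] k by simp
      \<comment> \<open>The induction hypothesis is applied with first weight \<open>Suc a\<close>,
        since [k^{-1}, x] has gained one; this is why \<open>a\<close> is generalized in the
        induction.\<close>
      then have "commu G (commu G (inv k) x) h \<in> N"
        unfolding N_def using step.IH[of "Suc a" "commu G (inv k) x" h] h by simp
      then show ?thesis using x hc k pcomm[of "commu G (inv k) x" h] by simp
    qed
    ultimately have "p x \<otimes>\<^bsub>Q\<^esub> commu Q (p h) (p k) = commu Q (p h) (p k) \<otimes>\<^bsub>Q\<^esub> p x"
      by (intro P.H.commute_commu) (use x hc k in auto)
    then show ?thesis using hc k by simp
  qed
  have "p x \<otimes>\<^bsub>Q\<^esub> p y = p y \<otimes>\<^bsub>Q\<^esub> p x \<and> y \<in> carrier G"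
    if "y \<in> generate G {commu G h k | h k. h \<in> lower_central G b \<and> k \<in> carrier G}" for y
    using that
  proof induction
    case one
    then show ?case using x by simp
  next
    case (incl g)
    then show ?case using key lower_central_closed by auto
  next
    case (inv g)
    then obtain h k where g: "g = commu G h k" and "h \<in> lower_central G b" "k \<in> carrier G" by auto
    then have "p x \<otimes>\<^bsub>Q\<^esub> p g = p g \<otimes>\<^bsub>Q\<^esub> p x" and gc: "g \<in> carrier G"
      using key lower_central_closed by auto
    then have "p x \<otimes>\<^bsub>Q\<^esub> inv\<^bsub>Q\<^esub> p g = inv\<^bsub>Q\<^esub> p g \<otimes>\<^bsub>Q\<^esub> p x"
      using x by (metis P.H.inv_closed P.H.inv_solve_left P.H.m_assoc P.H.m_closed P.H.r_inv P.H.r_one P.hom_closed)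
    then show ?case using gc by simp
  next
    case (eng g h)
    then show ?case using x
      by (smt (verit) P.H.m_assoc P.hom_closed P.hom_mult m_closed)
  qed
  from this[of y] step.prems show ?case
    using pcomm[OF x, of y] lower_central_Suc[OF step.hyps(1)] unfolding N_def by blast
qed

end

section \<open>Elimination of a generator from a generated subgroup\<close>

context group
begin

lemma generate_conj_closed:
  assumes y: "y \<in> carrier G" and S: "S \<subseteq> carrier G"
    and conj: "\<And>s. s \<in> S \<Longrightarrow> y \<otimes> s \<otimes> inv y \<in> generate G S" and u: "u \<in> generate G S"
  shows "y \<otimes> u \<otimes> inv y \<in> generate G S"
  using u
proof induction
  case one
  then show ?case using y by (simp add: generate.one)
next
  case (incl s)
  then show ?case by (rule conj)
next
  case (inv s)
  then have "y \<otimes> inv s \<otimes> inv y = inv (y \<otimes> s \<otimes> inv y)"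
    using y S by (auto simp: group_normalize)
  then show ?case
    using subgroup.m_inv_closed[OF generate_is_subgroup[OF S] conj[OF inv]] by simp
next
  case (eng s t)
  then have "s \<in> carrier G" "t \<in> carrier G" using generate_in_carrier[OF S] by auto
  then have "y \<otimes> (s \<otimes> t) \<otimes> inv y = (y \<otimes> s \<otimes> inv y) \<otimes> (y \<otimes> t \<otimes> inv y)"
    using y by (simp add: group_normalize)
  then show ?case using eng.IH by (simp add: generate.eng)
qed

text \<open>As \<open>x\<close> normalizes \<open>H\<close>, the products of a power of
  \<open>x\<close> with an element of \<open>H\<close> form a subgroup, and it contains all
  generators. Both directions of conjugation are assumed, since an inclusion of a conjugate of
  \<open>H\<close> in \<open>H\<close> need not be an equality.\<close>

lemma generate_cyclic_times:
  assumes x: "x \<in> carrier G" and H: "subgroup H G" and S: "S \<subseteq> H"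
    and conj: "\<And>u. u \<in> H \<Longrightarrow> x \<otimes> u \<otimes> inv x \<in> H" "\<And>u. u \<in> H \<Longrightarrow> inv x \<otimes> u \<otimes> x \<in> H"
    and h: "h \<in> generate G (insert x S)"
  obtains a :: int and h' where "h' \<in> H" "h = x [^] a \<otimes> h'"
proof -
  let ?X = "generate G {x}"
  have X: "subgroup ?X G" using x by (intro generate_is_subgroup) simp
  have tc: "t \<in> carrier G" if "t \<in> ?X" for t using that subgroup.mem_carrier[OF X] by blast
  have uc: "u \<in> carrier G" if "u \<in> H" for u using that subgroup.mem_carrier[OF H] by blast
  have conjX: "t \<otimes> u \<otimes> inv t \<in> H" if "t \<in> ?X" "u \<in> H" for t u
    using that
  proof (induction arbitrary: u)
    case one
    then show ?case using uc by simp
  next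
    case (incl s)
    then show ?case using conj by simp
  next
    case (inv s)
    then show ?case using conj x by simp
  next
    case (eng s t)
    have "s \<otimes> t \<otimes> u \<otimes> inv (s \<otimes> t) = s \<otimes> (t \<otimes> u \<otimes> inv t) \<otimes> inv s"
      using tc[OF eng.hyps(1)] tc[OF eng.hyps(2)] uc[OF eng.prems] by (simp add: group_normalize)
    then show ?case using eng.IH eng.prems by simp
  qed
  let ?P = "{t \<otimes> u | t u. t \<in> ?X \<and> u \<in> H}"
  have "subgroup ?P G"
  proof (rule subgroupI)
    show "?P \<subseteq> carrier G" using tc uc by auto
    show "?P \<noteq> {}" using subgroup.one_closed[OF H] subgroup.one_closed[OF X] by blast
    fix p assume "p \<in> ?P"
    then obtain t u where p: "p = t \<otimes> u" "t \<in> ?X" "u \<in> H" by auto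
    have "inv p = inv t \<otimes> (t \<otimes> inv u \<otimes> inv t)"
      using p tc uc by (simp add: group_normalize)
    moreover have "t \<otimes> inv u \<otimes> inv t \<in> H" "inv t \<in> ?X"
      using p conjX subgroup.m_inv_closed[OF H] subgroup.m_inv_closed[OF X] by auto
    ultimately show "inv p \<in> ?P" by blast
    fix p' assume "p' \<in> ?P"
    then obtain t' u' where p': "p' = t' \<otimes> u'" "t' \<in> ?X" "u' \<in> H" by auto
    have "p \<otimes> p' = (t \<otimes> t') \<otimes> ((inv t' \<otimes> u \<otimes> inv (inv t')) \<otimes> u')"
      using p p' tc uc by (simp add: group_normalize)
    moreover have "inv t' \<otimes> u \<otimes> inv (inv t') \<otimes> u' \<in> H"
      using p p' by (intro subgroup.m_closed[OF H] conjX subgroup.m_inv_closed[OF X])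
    moreover have "t \<otimes> t' \<in> ?X" using p p' subgroup.m_closed[OF X] by blast
    ultimately show "p \<otimes> p' \<in> ?P" by blast
  qed
  moreover have "insert x S \<subseteq> ?P"
  proof
    fix s assume s: "s \<in> insert x S"
    have "x = x \<otimes> \<one>" using x by simp
    moreover have "s = \<one> \<otimes> s" if "s \<in> S" using that S uc by auto
    moreover have "x \<in> ?X" by (rule generate.incl) simp
    ultimately show "s \<in> ?P"
      using s S subgroup.one_closed[OF H] subgroup.one_closed[OF X] by blast
  qed
  ultimately have "h \<in> ?P" using h generate_subgroup_incl by blast
  then obtain t u where tu: "h = t \<otimes> u" "t \<in> ?X" "u \<in> H" by auto
  then obtain a :: int where "t = x [^] a" using generate_pow[OF x] by auto
  with tu show thesis by (intro that) auto
qed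

text \<open>The left-normed commutator [z, x, ..., x], the group counterpart of the iterates of
  \<open>ad\<close>.\<close>

definition icommu :: "'a \<Rightarrow> nat \<Rightarrow> 'a \<Rightarrow> 'a" where
  "icommu x k z = ((\<lambda>u. commu G u x) ^^ k) z"

lemma icommu_0 [simp]: "icommu x 0 z = z"
  and icommu_Suc: "icommu x (Suc k) z = commu G (icommu x k z) x"
  by (simp_all add: icommu_def)

lemma icommu_closed [simp]: "x \<in> carrier G \<Longrightarrow> z \<in> carrier G \<Longrightarrow> icommu x k z \<in> carrier G"
  by (induction k) (auto simp: icommu_Suc)

lemma icommu_lower_central:
  assumes "d \<ge> 1" "e \<ge> 1" "x \<in> lower_central G d" "z \<in> lower_central G e"
  shows "icommu x k z \<in> lower_central G (e + k * d)"
proof (induction k)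
  case (Suc k)
  then show ?case
    using commu_lower_central_add[of "e + k * d" d "icommu x k z" x] assms
    by (simp add: icommu_Suc algebra_simps)
qed (use assms in simp)

text \<open>Conjugation by \<open>x\<^sup>-\<^sup>1\<close> is handled by downward induction on \<open>k\<close>, starting from \<open>k = n\<close>, where the iterated
  commutator lies in \<open>N\<close>.\<close>

lemma eliminate_generator:
  assumes x: "x \<in> carrier G" and Z: "Z \<subseteq> carrier G" and N: "N \<lhd> G"
    and n: "\<And>z. z \<in> Z \<Longrightarrow> icommu x n z \<in> N" "n \<ge> 1"
    and h: "h \<in> generate G (insert x Z \<union> N)"
  obtains a :: int and h'
  where "h' \<in> generate G ({icommu x k z | k z. k < n \<and> z \<in> Z} \<union> N)" "h = x [^] a \<otimes> h'"
proof -
  let ?S = "{icommu x k z | k z. k < n \<and> z \<in> Z} \<union> N"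
  let ?H = "generate G ?S"
  interpret N: normal N G by (rule N)
  have S: "?S \<subseteq> carrier G" using x Z N.subset by auto
  have H: "subgroup ?H G" by (rule generate_is_subgroup[OF S])
  have ic: "icommu x k z \<in> carrier G" if "z \<in> Z" for k z
    using that x Z by auto
  have mem: "icommu x k z \<in> ?H" if "k \<le> n" "z \<in> Z" for k z
  proof (rule generate.incl)
    show "icommu x k z \<in> ?S" using that n(1) by (cases "k = n") (auto simp: le_less)
  qed
  have up: "inv x \<otimes> s \<otimes> inv (inv x) \<in> ?H" if "s \<in> ?S" for s
    using that
  proof
    assume "s \<in> {icommu x k z | k z. k < n \<and> z \<in> Z}"
    then obtain k z where kz: "s = icommu x k z" "k < n" "z \<in> Z" by auto
    then have "inv x \<otimes> s \<otimes> inv (inv x) = s \<otimes> icommu x (Suc k) z"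
      using x ic by (simp add: icommu_Suc group_normalize)
    then show ?thesis using kz mem[of k z] mem[of "Suc k" z] by (simp add: generate.eng)
  next
    assume "s \<in> N"
    then show ?thesis using x by (intro generate.incl) (auto intro: N.inv_op_closed1)
  qed
  have down: "x \<otimes> s \<otimes> inv x \<in> ?H" if "s \<in> ?S" for s
    using that
  proof
    assume "s \<in> {icommu x k z | k z. k < n \<and> z \<in> Z}"
    then obtain k z where kz: "s = icommu x k z" "k \<le> n" "z \<in> Z" by auto
    have "x \<otimes> icommu x k z \<otimes> inv x \<in> ?H"
      using kz(2)
    proof (induction k rule: inc_induct)
      case base
      then show ?case using x n kz by (intro generate.incl) (auto intro: N.inv_op_closed2)
    next
      case (step k)
      \<comment> \<open>With s = \<open>icommu x k z\<close> one has x^{-1} s x = s [s, x]; solving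
        for x s x^{-1} leaves only the same conjugate of the next commutator [s, x].\<close>
      have "x \<otimes> icommu x k z \<otimes> inv x = icommu x k z \<otimes> inv (x \<otimes> icommu x (Suc k) z \<otimes> inv x)"
        using x ic[OF kz(3)] by (simp add: icommu_Suc group_normalize)
      then show ?case
        using mem[of k z] kz(3) step subgroup.m_inv_closed[OF H step.IH] by (simp add: generate.eng)
    qed
    then show ?thesis using kz by simp
  next
    assume "s \<in> N"
    then show ?thesis using x by (intro generate.incl) (auto intro: N.inv_op_closed2)
  qed
  have sub: "Z \<union> N \<subseteq> ?H"
    using mem[of 0] n(2) by (auto intro: generate.incl)
  show thesis
  proof (rule generate_cyclic_times[OF x H sub])
    show "x \<otimes> u \<otimes> inv x \<in> ?H" if "u \<in> ?H" for u
      by (rule generate_conj_closed[OF x S down that])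
    show "inv x \<otimes> u \<otimes> x \<in> ?H" if "u \<in> ?H" for u
      using generate_conj_closed[OF _ S up that] x by simp
    show "h \<in> generate G (insert x (Z \<union> N))" using h by simp
  qed (rule that)
qed

end

section \<open>The kernel of the Magnus expansion\<close>

text \<open>All that the kernel computation uses of the expansion itself. The generators and their
  leading terms enter only as hypotheses of \<open>magnus_kernel\<close>.\<close>

locale magnus_rep = group G for G (structure) +
  fixes M :: "'a \<Rightarrow> 'l ncps"
  assumes M_mult: "x \<in> carrier G \<Longrightarrow> y \<in> carrier G \<Longrightarrow> M (x \<otimes> y) = M x * M y"
    and M_one: "M \<one> = 1"
    and M_unip: "x \<in> carrier G \<Longrightarrow> ord_ge 1 (M x - 1)"
begin

lemma M_inv_mult: "x \<in> carrier G \<Longrightarrow> M (inv x) * M x = 1"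
  and M_mult_inv: "x \<in> carrier G \<Longrightarrow> M x * M (inv x) = 1"
  using M_mult[of "inv x" x] M_mult[of x "inv x"] M_one by auto

text \<open>M(xy) - 1 is the sum of M(x) - 1, M(y) - 1 and their product. The product has order at
  least 2d, hence at least d + 1, so leading terms add.\<close>

lemma leading_mult:
  assumes xy: "x \<in> carrier G" "y \<in> carrier G" and d: "d \<ge> 1"
    and "ord_ge d v" "ord_ge d v'" "ord_ge (Suc d) (M x - 1 - v)" "ord_ge (Suc d) (M y - 1 - v')"
  shows "ord_ge (Suc d) (M (x \<otimes> y) - 1 - (v + v'))"
proof -
  have "ord_ge d (M x - 1 - v)" "ord_ge d (M y - 1 - v')"
    using assms by (auto intro: ord_ge_mono[of "Suc d"])
  with assms have "ord_ge d (M x - 1)" "ord_ge d (M y - 1)"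
    using ord_ge_add[of d "M x - 1 - v" v] ord_ge_add[of d "M y - 1 - v'" v'] by auto
  then have "ord_ge (Suc d) ((M x - 1) * (M y - 1))"
    using ord_ge_times ord_ge_mono d by (metis Suc_eq_plus1 add_le_cancel_left)
  then have "ord_ge (Suc d) ((M x - 1) * (M y - 1) + ((M x - 1 - v) + (M y - 1 - v')))"
    using assms by (intro ord_ge_add)
  moreover have "(M x - 1) * (M y - 1) + ((M x - 1 - v) + (M y - 1 - v')) = M (x \<otimes> y) - 1 - (v + v')"
    using xy by (simp add: M_mult algebra_simps)
  ultimately show ?thesis by simp
qed

text \<open>M(x^{-1}) - 1 equals -(M(x) - 1) minus the product of M(x^{-1}) - 1 and M(x) - 1, and
  this product has order at least d + 1.\<close>

lemma leading_inv:
  assumes x: "x \<in> carrier G" and d: "d \<ge> 1" and v: "ord_ge d v" "ord_ge (Suc d) (M x - 1 - v)"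
  shows "ord_ge (Suc d) (M (inv x) - 1 - (- v))"
proof -
  have "ord_ge d (M x - 1 - v)"
    using v by (auto intro: ord_ge_mono[of "Suc d"])
  with v have "ord_ge d (M x - 1)" using ord_ge_add[of d "M x - 1 - v" v] by auto
  then have "ord_ge (Suc d) ((M (inv x) - 1) * (M x - 1))"
    using ord_ge_times[of 1 "M (inv x) - 1" d "M x - 1"] M_unip[of "inv x"] x by simp
  then have "ord_ge (Suc d) (- ((M (inv x) - 1) * (M x - 1)) - (M x - 1 - v))"
    using v(2) ord_ge_diff ord_ge_uminus by blast
  moreover have "- ((M (inv x) - 1) * (M x - 1)) - (M x - 1 - v) = M (inv x) - 1 - (- v)"
    using x by (simp add: M_inv_mult algebra_simps)
  ultimately show ?thesis by simp
qed

text \<open>\<open>V\<close> is an additive group of admissible leading terms. The choice {0} gives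
  the order filtration; the integral span of the leading terms of weight d is used in the collection
  process.\<close>

lemma leading_subgroup:
  assumes d: "d \<ge> 1" and V: "0 \<in> V" "\<And>v w. v \<in> V \<Longrightarrow> w \<in> V \<Longrightarrow> v + w \<in> V"
    "\<And>v. v \<in> V \<Longrightarrow> - v \<in> V" "\<And>v. v \<in> V \<Longrightarrow> ord_ge d v"
  shows "subgroup {x \<in> carrier G. \<exists>v\<in>V. ord_ge (Suc d) (M x - 1 - v)} G" (is "subgroup ?S G")
proof (rule subgroupI)
  have "\<one> \<in> ?S" using V(1) by (auto simp: M_one intro!: bexI[of _ 0])
  then show "?S \<noteq> {}" by blast
  fix x assume x: "x \<in> ?S"
  then obtain v where v: "v \<in> V" "ord_ge (Suc d) (M x - 1 - v)" by blast
  then show "inv x \<in> ?S" using x V leading_inv[OF _ d, of x v] by blast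
  fix y assume y: "y \<in> ?S"
  then obtain w where w: "w \<in> V" "ord_ge (Suc d) (M y - 1 - w)" by blast
  then show "x \<otimes> y \<in> ?S" using x y v V leading_mult[OF _ _ d, of x y v w] by blast
qed auto

lemma order_subgroup: "subgroup {x \<in> carrier G. ord_ge n (M x - 1)} G"
proof -
  consider "n = 0" | "n = 1" | d where "n = Suc d" "d \<ge> 1"
    by (metis One_nat_def Suc_le_eq bot_nat_0.not_eq_extremum not0_implies_Suc)
  then show ?thesis
  proof cases
    case 1
    then show ?thesis by (simp add: subgroup_self)
  next
    case 2
    then have "{x \<in> carrier G. ord_ge n (M x - 1)} = carrier G" using M_unip by auto
    then show ?thesis by (simp add: subgroup_self)
  next
    case 3
    then show ?thesis using leading_subgroup[of d "{0}"] by simp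
  qed
qed

text \<open>Since [x, y] = (yx)^{-1} (xy), M[x, y] - 1 is M((yx)^{-1}) times M(xy) - M(yx), and that
  difference is the ring commutator of M(x) - 1 and M(y) - 1, of order at least a + b. Replacing the
  unit in front by 1 costs an error of one order more.\<close>

lemma leading_commu:
  assumes "x \<in> carrier G" "y \<in> carrier G" "ord_ge a (M x - 1)" "ord_ge b (M y - 1)"
  shows "ord_ge (Suc (a + b)) (M (commu G x y) - 1 - ((M x - 1) * (M y - 1) - (M y - 1) * (M x - 1)))"
proof -
  let ?c = "(M x - 1) * (M y - 1) - (M y - 1) * (M x - 1)"
  have c: "?c = M (x \<otimes> y) - M (y \<otimes> x)" using assms by (simp add: M_mult algebra_simps)
  have "commu G x y = inv (y \<otimes> x) \<otimes> (x \<otimes> y)" using assms by (simp add: group_normalize)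
  then have "M (commu G x y) = M (inv (y \<otimes> x)) * M (x \<otimes> y)"
    using assms by (simp only: M_mult m_closed inv_closed)
  then have "M (commu G x y) - 1 - ?c = (M (inv (y \<otimes> x)) - 1) * ?c"
    using M_inv_mult[of "y \<otimes> x"] assms unfolding c by (simp add: algebra_simps)
  moreover have "ord_ge (1 + (a + b)) ((M (inv (y \<otimes> x)) - 1) * ?c)"
  proof (rule ord_ge_times)
    show "ord_ge 1 (M (inv (y \<otimes> x)) - 1)" using assms by (intro M_unip) simp
    show "ord_ge (a + b) ?c"
      using ord_ge_times[OF assms(3,4)] ord_ge_times[OF assms(4,3)]
      by (intro ord_ge_diff) (simp_all add: add.commute)
  qed
  ultimately show ?thesis by simp
qed

lemma leading_commu_homog:
  assumes xy: "x \<in> carrier G" "y \<in> carrier G" and l: "homog a l" "homog b k"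
    and lead: "ord_ge (Suc a) (M x - 1 - l)" "ord_ge (Suc b) (M y - 1 - k)"
  shows "ord_ge (Suc (a + b)) (M (commu G x y) - 1 - ad k l)"
proof -
  let ?X = "M x - 1" and ?Y = "M y - 1"
  have X: "ord_ge a ?X" and Y: "ord_ge b ?Y"
    using ord_ge_add[OF ord_ge_mono[OF lead(1)] homog_ord_ge[OF l(1)]]
      ord_ge_add[OF ord_ge_mono[OF lead(2)] homog_ord_ge[OF l(2)]] by auto
  \<comment> \<open>Both products are compared with those of the leading terms by changing one
    factor at a time.\<close>
  have "ord_ge (Suc (a + b)) ((?X - l) * ?Y + l * (?Y - k) - ((?Y - k) * ?X + k * (?X - l)))"
    using ord_ge_times[OF lead(1) Y] ord_ge_times[OF homog_ord_ge[OF l(1)] lead(2)]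
      ord_ge_times[OF lead(2) X] ord_ge_times[OF homog_ord_ge[OF l(2)] lead(1)]
    by (intro ord_ge_diff ord_ge_add) (simp_all add: add.commute)
  also have "(?X - l) * ?Y + l * (?Y - k) - ((?Y - k) * ?X + k * (?X - l)) = (?X * ?Y - ?Y * ?X) - ad k l"
    by (simp add: ad_def algebra_simps)
  finally show ?thesis
    using ord_ge_add[OF leading_commu[OF xy X Y]] by fastforce
qed

lemma leading_icommu:
  assumes "x \<in> carrier G" "z \<in> carrier G" "homog d y" "homog e l"
    and "ord_ge (Suc d) (M x - 1 - y)" "ord_ge (Suc e) (M z - 1 - l)"
  shows "ord_ge (Suc (e + k * d)) (M (icommu x k z) - 1 - (ad y ^^ k) l)"
proof (induction k)
  case (Suc k)
  then show ?case
    using leading_commu_homog[of "icommu x k z" x "e + k * d" "(ad y ^^ k) l" d y]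
      homog_ad_funpow[of d y e l k] assms
    by (simp add: icommu_Suc algebra_simps)
qed (use assms in simp)

text \<open>The easy half of Magnus' theorem: a ring commutator of a series of order n with one of
  order 1 has order at least n + 1.\<close>

lemma lower_central_ord_ge:
  "x \<in> lower_central G n \<Longrightarrow> ord_ge n (M x - 1)"
proof (induction n arbitrary: x)
  case (Suc n)
  show ?case
  proof (cases "n = 0")
    case True
    then show ?thesis using Suc.prems M_unip by simp
  next
    case False
    have "generate G {commu G h k | h k. h \<in> lower_central G n \<and> k \<in> carrier G}
        \<subseteq> {x \<in> carrier G. ord_ge (Suc n) (M x - 1)}"
    proof (rule generate_subgroup_incl[OF _ order_subgroup], safe)
      fix h k assume h: "h \<in> lower_central G n" and k: "k \<in> carrier G"
      have hc: "h \<in> carrier G" using h by (rule lower_central_closed)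
      show "commu G h k \<in> carrier G" using hc k by simp
      let ?c = "(M h - 1) * (M k - 1) - (M k - 1) * (M h - 1)"
      have "ord_ge (Suc n) ?c"
        using ord_ge_times[OF Suc.IH[OF h] M_unip[OF k]] ord_ge_times[OF M_unip[OF k] Suc.IH[OF h]]
        by (auto intro: ord_ge_diff)
      moreover have "ord_ge (Suc n) (M (commu G h k) - 1 - ?c)"
        using ord_ge_mono[OF leading_commu[OF hc k Suc.IH[OF h] M_unip[OF k]]] by simp
      ultimately show "ord_ge (Suc n) (M (commu G h k) - 1)"
        using ord_ge_add by fastforce
    qed
    then show ?thesis using Suc.prems lower_central_Suc[of n] False by auto
  qed
qed simp

lemma leading_int_pow:
  assumes x: "x \<in> carrier G" and d: "d \<ge> 1" and v: "ord_ge d v" "ord_ge (Suc d) (M x - 1 - v)"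
  shows "ord_ge (Suc d) (M (x [^] (a::int)) - 1 - v * of_int a)"
proof -
  have vc: "ord_ge d (v * of_int c)" for c using v(1) by (rule ord_ge_times_right)
  have nat: "ord_ge (Suc d) (M (x [^] k) - 1 - v * of_int (int k))" for k
  proof (induction k)
    case (Suc k)
    then show ?case
      using leading_mult[OF _ x d vc v(1) Suc v(2)] x by (simp add: algebra_simps)
  qed (simp add: M_one)
  show ?thesis
  proof (cases a rule: int_cases2)
    case (nonneg k)
    then show ?thesis using nat[of k] by (simp add: int_pow_int)
  next
    case (nonpos k)
    then show ?thesis
      using leading_inv[OF _ d vc nat[of k]] x by (simp add: int_pow_neg_int)
  qed
qed

text \<open>Hall's collection process. The members \<open>g i\<close> of the family have weights \<open>w i \<ge> d\<close> and leading terms \<open>l i\<close>;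
  one of weight \<open>d\<close> is removed and the others are replaced by their iterated commutators with it. Its exponent
  in \<open>h\<close> vanishes because the leading terms of weight \<open>d\<close> are linearly independent.\<close>

lemma collection:
  fixes g :: "nat \<Rightarrow> 'a" and l :: "nat \<Rightarrow> 'l ncps" and w :: "nat \<Rightarrow> nat"
  assumes "finite I" "d \<ge> 1" "n \<ge> 1" "right_indep I l"
    and "\<And>i. i \<in> I \<Longrightarrow> w i \<ge> d" "\<And>i. i \<in> I \<Longrightarrow> g i \<in> lower_central G (w i)"
    and "\<And>i. i \<in> I \<Longrightarrow> homog (w i) (l i)" "\<And>i. i \<in> I \<Longrightarrow> ord_ge (Suc (w i)) (M (g i) - 1 - l i)"
    and "h \<in> generate G (g ` I \<union> lower_central G n)" "ord_ge n (M h - 1)"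
  shows "h \<in> lower_central G n"
  using assms
\<comment> \<open>Either a member of weight \<open>d\<close> is eliminated, which lowers the count
  because a proper commutator has weight above \<open>d\<close>, or none is left and
  \<open>d\<close> is raised.\<close>
proof (induction "(n - d, card {i \<in> I. w i = d})" arbitrary: d I g l w h
    rule: wf_induct_rule[OF wf_lex_prod[OF wf_less_than wf_less_than]])
  case (1 d I w g l h)
  note [simp] = \<open>finite I\<close> and d = \<open>d \<ge> 1\<close> and n = \<open>n \<ge> 1\<close> and ind = \<open>right_indep I l\<close>
  note w = 1(6) and g = 1(7) and hom = 1(8) and lead = 1(9) and h = 1(10) and ordh = 1(11)
  have gc: "g i \<in> carrier G" if "i \<in> I" for i using g[OF that] by (rule lower_central_closed)
  consider "d \<ge> n" | "d < n" "{i \<in> I. w i = d} = {}" | x where "d < n" "x \<in> I" "w x = d"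
    by fastforce
  then show ?case
  proof cases
    case 1
    have "g ` I \<subseteq> lower_central G n"
    proof (rule image_subsetI)
      fix i assume "i \<in> I"
      then show "g i \<in> lower_central G n"
        using g[of i] w[of i] lower_central_mono[of n "w i"] 1 n by auto
    qed
    then have "generate G (g ` I \<union> lower_central G n) \<subseteq> lower_central G n"
      using lower_central_subgroup by (intro generate_subgroup_incl) auto
    then show ?thesis using h by blast
  next
    case 2
    show ?thesis
    proof (rule "1.hyps"(1)[of "Suc d" I w])
      show "Suc d \<le> w i" if "i \<in> I" for i using w[OF that] 2(2) that by (auto simp: le_less)
    qed (use 2 n ind g hom lead h ordh in auto)
  next
    case 3
    define J where "J = {i \<in> I. w i = d} - {x}"
    define N where "N = lower_central G n"
    \<comment> \<open>The new family is naturally indexed by pairs (z, k). Encoding the pairs as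
      numbers keeps the index type fixed throughout the induction.\<close>
    define w' where "w' i = (case prod_decode i of (z, k) \<Rightarrow> w z + k * d)" for i
    define l' where "l' i = (case prod_decode i of (z, k) \<Rightarrow> (ad (l x) ^^ k) (l z))" for i
    define g' where "g' i = (case prod_decode i of (z, k) \<Rightarrow> icommu (g x) k (g z))" for i
    define I' where "I' = prod_encode ` ((I - {x}) \<times> {..<n})"
    have x: "g x \<in> carrier G" using gc 3 by simp
    have N: "N \<lhd> G" unfolding N_def using n by (rule lower_central_normal)
    have Nc: "N \<subseteq> carrier G" unfolding N_def by (rule lower_central_subset)
    have in_gamma: "icommu (g x) k (g z) \<in> lower_central G (w z + k * d)" if "z \<in> I" for k z
      using icommu_lower_central[of d "w z" "g x" "g z" k] that d w[OF that] g 3 by force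
    have leadc: "ord_ge (Suc (w z + k * d)) (M (icommu (g x) k (g z)) - 1 - (ad (l x) ^^ k) (l z))"
      and homc: "homog (w z + k * d) ((ad (l x) ^^ k) (l z))" if "z \<in> I" for k z
      using leading_icommu[OF x gc[OF that], of d "l x" "w z" "l z" k] that hom[of x] hom[of z]
        homog_ad_funpow[of d "l x" "w z" "l z" k] lead[of x] lead[of z] 3 by auto
    have "insert (g x) (g ` (I - {x})) = g ` I" using 3 by auto
    then have "h \<in> generate G (insert (g x) (g ` (I - {x})) \<union> N)" using h by (simp add: N_def)
    moreover have "icommu (g x) n z \<in> N" if z: "z \<in> g ` (I - {x})" for z
    proof -
      obtain i where i: "i \<in> I" "z = g i" using z by auto
      have "n \<le> w i + n * d" using d by (intro trans_le_add2) simp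
      then show ?thesis
        using in_gamma[OF i(1), of n] lower_central_mono[OF _ n] unfolding N_def i(2) by blast
    qed
    ultimately obtain a h' where
      "h' \<in> generate G ({icommu (g x) k z | k z. k < n \<and> z \<in> g ` (I - {x})} \<union> N)"
      and hx: "h = g x [^] (a::int) \<otimes> h'"
      using eliminate_generator[OF x _ N _ n, of "g ` (I - {x})" h] gc by blast
    moreover have "{icommu (g x) k z | k z. k < n \<and> z \<in> g ` (I - {x})} = g' ` I'"
      unfolding I'_def g'_def by (force simp: image_iff)
    ultimately have h': "h' \<in> generate G (g' ` I' \<union> N)" by simp
    \<comment> \<open>The degree d part of \<open>h'\<close> is an integral combination of the
      \<open>l i\<close> with i in \<open>J\<close>, while \<open>h\<close> has no part of degree d
      because d < n. So \<open>a\<close> times \<open>l x\<close> plus such a combination is zero,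
      and right independence applies.\<close>
    have "a = 0"
    proof -
      let ?V = "{\<Sum>i\<in>J. l i * of_int (b i) | b. True}"
      let ?S = "{u \<in> carrier G. \<exists>v\<in>?V. ord_ge (Suc d) (M u - 1 - v)}"
      have V0: "0 \<in> ?V" by (auto intro!: exI[of _ "\<lambda>_. 0"])
      have homJ: "homog d (\<Sum>i\<in>J. l i * of_int (b i))" for b
      proof (rule homog_sum)
        fix i assume "i \<in> J"
        then show "homog d (l i * of_int (b i))"
          using homog_times[OF hom[of i] homog_of_int] by (simp add: J_def)
      qed
      have S: "subgroup ?S G"
      proof (rule leading_subgroup[OF d V0])
        fix v v' assume "v \<in> ?V" "v' \<in> ?V"
        then obtain b b' where b: "v = (\<Sum>i\<in>J. l i * of_int (b i))" "v' = (\<Sum>i\<in>J. l i * of_int (b' i))"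
          by auto
        then show "v + v' \<in> ?V"
          by (auto intro!: exI[of _ "\<lambda>i. b i + b' i"] simp: sum.distrib algebra_simps)
        show "- v \<in> ?V" using b by (auto intro!: exI[of _ "\<lambda>i. - b i"] simp: sum_negf)
        show "ord_ge d v"
          unfolding b by (rule homog_ord_ge[OF homJ])
      qed
      have "g' ` I' \<union> N \<subseteq> ?S"
      proof
        fix u assume "u \<in> g' ` I' \<union> N"
        then consider "u \<in> N" | z k where "z \<in> I - {x}" "u = icommu (g x) k (g z)"
          unfolding I'_def g'_def by auto blast
        then show "u \<in> ?S"
        proof cases
          case 1
          then have "ord_ge (Suc d) (M u - 1 - 0)"
            using lower_central_ord_ge[of u n] ord_ge_mono[of n "M u - 1" "Suc d"] 3 by (simp add: N_def)
          then show ?thesis using V0 1 Nc by blast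
        next
          case (2 z k)
          then have u: "u \<in> carrier G" using x gc by auto
          show ?thesis
          \<comment> \<open>Only an unchanged member of weight \<open>d\<close> can contribute in
            degree d; every other generator lies in Gamma_{d+1}.\<close>
          proof (cases "k = 0 \<and> w z = d")
            case True
            then have "l z = (\<Sum>i\<in>J. l i * of_int (if i = z then 1 else 0))"
              using 2 by (simp add: J_def if_distrib cong: if_cong)
            then have "l z \<in> ?V" by (intro CollectI exI[of _ "\<lambda>i. if i = z then 1 else 0"]) simp
            moreover have "ord_ge (Suc d) (M u - 1 - l z)" using leadc[of z k] 2 True by auto
            ultimately show ?thesis using u by blast
          next
            case False
            have "w z + k * d \<ge> Suc d"
            proof (cases "k = 0")
              case True
              then show ?thesis using False w[of z] 2 by auto
            next
              case False
              then have "0 < k * d" using d by simp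
              moreover have "d \<le> w z" using w[of z] 2 by simp
              ultimately show ?thesis by linarith
            qed
            then have "ord_ge (Suc d) (M u - 1 - 0)"
              using lower_central_ord_ge[of u "w z + k * d"] in_gamma[of z k] 2
                ord_ge_mono[of "w z + k * d" "M u - 1" "Suc d"] by simp
            then show ?thesis using V0 u by blast
          qed
        qed
      qed
      then have "h' \<in> ?S" using h' generate_subgroup_incl[OF _ S] by blast
      then obtain b where h'c: "h' \<in> carrier G" and
        b: "ord_ge (Suc d) (M h' - 1 - (\<Sum>i\<in>J. l i * of_int (b i)))" (is "ord_ge _ (_ - ?v)") by auto
      have hx0: "homog d (l x)" using hom[of x] 3 by simp
      have homv: "homog d ?v" by (rule homJ)
      have homa: "homog d (l x * of_int a)" using homog_times[OF hx0 homog_of_int] by simp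
      have "ord_ge (Suc d) (M (g x [^] a) - 1 - l x * of_int a)"
        using lead[of x] 3 by (intro leading_int_pow x d homog_ord_ge[OF hx0]) auto
      then have "ord_ge (Suc d) (M h - 1 - (l x * of_int a + ?v))"
        unfolding hx using x h'c b d by (intro leading_mult homog_ord_ge[OF homv] homog_ord_ge[OF homa]) auto
      moreover have "ord_ge (Suc d) (M h - 1)" using ordh 3 by (auto intro: ord_ge_mono)
      ultimately have "ord_ge (Suc d) (M h - 1 - (M h - 1 - (l x * of_int a + ?v)))"
        by (rule ord_ge_diff[rotated])
      then have "l x * of_int a + ?v = 0"
        using homog_zeroI[OF homog_add[OF homa homv]] by (simp add: add.commute)
      let ?c = "\<lambda>i. if i = x then of_int a else if i \<in> J then of_int (b i) else (0 :: 'l ncps)"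
      have "(\<Sum>i\<in>I. l i * ?c i) = (\<Sum>i\<in>insert x J. l i * ?c i)"
        using 3 by (intro sum.mono_neutral_right) (auto simp: J_def)
      also have "\<dots> = l x * of_int a + (\<Sum>i\<in>J. l i * ?c i)"
        by (subst sum.insert) (auto simp: J_def)
      also have "(\<Sum>i\<in>J. l i * ?c i) = ?v"
        by (intro sum.cong) (auto simp: J_def)
      also have "l x * of_int a + ?v = 0" by fact
      finally have "?c x = 0" using right_indepD[OF ind, of ?c x] 3 by simp
      \<comment> \<open>An integer is recovered from its image in the series ring as the constant
        coefficient.\<close>
      then have "ncoeff (of_int a :: 'l ncps) [] = 0" by simp
      then show "a = 0" by (simp add: ncoeff_of_int)
    qed
    moreover have "h' \<in> carrier G"
    proof (rule generate_in_carrier[OF _ h'])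
      show "g' ` I' \<union> N \<subseteq> carrier G" using Nc x gc by (auto simp: I'_def g'_def)
    qed
    ultimately have hh': "h = h'" using hx by simp
    show ?thesis
    proof (rule "1.hyps"(1)[of d I' w' l' g' h])
      have "{i \<in> I'. w' i = d} \<subseteq> (\<lambda>z. prod_encode (z, 0)) ` J"
      proof
        fix i assume "i \<in> {i \<in> I'. w' i = d}"
        then obtain z k where zk: "i = prod_encode (z, k)" "z \<in> I - {x}" "w z + k * d = d"
          unfolding I'_def w'_def by auto blast
        moreover have "d \<le> w z" using zk(2) w by simp
        ultimately have "k * d = 0" by linarith
        then have "k = 0" using d by simp
        with zk show "i \<in> (\<lambda>z. prod_encode (z, 0)) ` J" by (auto simp: J_def)
      qed
      then have "card {i \<in> I'. w' i = d} \<le> card J"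
        by (rule surj_card_le[rotated]) (simp add: J_def)
      also have "\<dots> < card {i \<in> I. w i = d}"
        unfolding J_def using 3 by (intro card_Diff1_less) auto
      finally show "((n - d, card {i \<in> I'. w' i = d}), n - d, card {i \<in> I. w i = d})
          \<in> less_than <*lex*> less_than" by simp
      show "finite I'" by (simp add: I'_def)
      show "right_indep I' l'"
        unfolding I'_def
      proof (rule right_indep_reindex)
        show "inj_on prod_encode ((I - {x}) \<times> {..<n})" by (rule inj_prod_encode)
        have "(\<lambda>i. l' (prod_encode i)) = (\<lambda>(z, k). (ad (l x) ^^ k) (l z))"
          by (auto simp: l'_def)
        then show "right_indep ((I - {x}) \<times> {..<n}) (\<lambda>i. l' (prod_encode i))"
          using right_indep_eliminate[OF ind _ , of x n] 3 by simp
      qed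
      fix i assume "i \<in> I'"
      then obtain z k where zk: "i = prod_encode (z, k)" "z \<in> I" by (auto simp: I'_def)
      show "d \<le> w' i" using w[of z] zk by (simp add: w'_def)
      show "g' i \<in> lower_central G (w' i)" using in_gamma zk by (simp add: g'_def w'_def)
      show "homog (w' i) (l' i)" using homc zk by (simp add: l'_def w'_def)
      show "ord_ge (Suc (w' i)) (M (g' i) - 1 - l' i)" using leadc zk by (simp add: g'_def l'_def w'_def)
    qed (use d n ordh h' hh' in \<open>simp_all add: N_def\<close>)
  qed
qed

text \<open>The collection process is started with the generators themselves, all of weight
  1.\<close>

theorem magnus_kernel:
  fixes J :: "nat set" and g :: "nat \<Rightarrow> 'a" and l :: "nat \<Rightarrow> 'l ncps"
  assumes "finite J" "g ` J \<subseteq> carrier G" "carrier G = generate G (g ` J)"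
    and "right_indep J l" "\<And>j. j \<in> J \<Longrightarrow> homog 1 (l j)" "\<And>j. j \<in> J \<Longrightarrow> ord_ge 2 (M (g j) - 1 - l j)"
    and "n \<ge> 1" "x \<in> carrier G"
  shows "x \<in> lower_central G n \<longleftrightarrow> ord_ge n (M x - 1)"
proof
  assume "ord_ge n (M x - 1)"
  moreover have "x \<in> generate G (g ` J \<union> lower_central G n)"
    using assms(3,8) mono_generate[of "g ` J" "g ` J \<union> lower_central G n"] by auto
  ultimately show "x \<in> lower_central G n"
    using assms by (intro collection[of J 1 n l "\<lambda>_. 1" g x]) (auto simp: numeral_2_eq_2)
qed (rule lower_central_ord_ge)

end

section \<open>Homomorphisms from presented groups\<close>

lemma word_eval_Nil [simp]: "word_eval G g [] = \<one>\<^bsub>G\<^esub>"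
  and word_eval_Cons: "word_eval G g ((a, b) # w) =
    (if b then g a else inv\<^bsub>G\<^esub> (g a)) \<otimes>\<^bsub>G\<^esub> word_eval G g w"
  by (simp_all add: word_eval_def)

lemma words_induct [consumes 1, case_names Nil Cons]:
  assumes "w \<in> words S" "P []" "\<And>a b w. a \<in> S \<Longrightarrow> w \<in> words S \<Longrightarrow> P w \<Longrightarrow> P ((a, b) # w)"
  shows "P w"
  using assms(1) by (induction w) (use assms(2,3) in auto)

context group
begin

lemma word_eval_closed:
  assumes "w \<in> words S" "g ` S \<subseteq> carrier G" shows "word_eval G g w \<in> carrier G"
  using assms(1)
proof (induction rule: words_induct)
  case (Cons a b w)
  then have "g a \<in> carrier G" using assms(2) by blast
  with Cons show ?case by (simp add: word_eval_Cons)
qed simp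

lemma word_eval_append:
  assumes "u \<in> words S" "v \<in> words S" "g ` S \<subseteq> carrier G"
  shows "word_eval G g (u @ v) = word_eval G g u \<otimes> word_eval G g v"
  using assms(1)
proof (induction rule: words_induct)
  case (Cons a b u)
  then have "g a \<in> carrier G" using assms(3) by blast
  with Cons show ?case
    using word_eval_closed[OF Cons(2) assms(3)] word_eval_closed[OF assms(2,3)]
    by (simp add: word_eval_Cons m_assoc)
qed (use word_eval_closed[OF assms(2,3)] in simp)

lemma word_eval_pres_eq:
  assumes "pres_eq S R u v" and g: "g ` S \<subseteq> carrier G"
    and R: "\<And>r s. (r, s) \<in> R \<Longrightarrow> word_eval G g r = word_eval G g s"
  shows "word_eval G g u = word_eval G g v"
  using assms(1)
proof induction
  case (cancel u v a b)
  then have "g a \<in> carrier G" using g by blast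
  moreover have "[(a, b), (a, \<not> b)] @ v \<in> words S" using cancel by simp
  ultimately show ?case
    using cancel word_eval_closed[OF _ g]
    by (simp add: word_eval_append[OF _ _ g] word_eval_Cons inv_mult_cancel mult_inv_cancel)
next
  case (rel u v r s)
  then show ?case using R[of r s] by (simp add: word_eval_append[OF _ _ g])
qed auto

text \<open>The representative chosen in \<open>pres_lift\<close> is harmless, because the value of
  a word is constant on its class.\<close>

lemma pres_lift_class:
  assumes "w \<in> words S" and g: "g ` S \<subseteq> carrier G"
    and R: "\<And>r s. (r, s) \<in> R \<Longrightarrow> word_eval G g r = word_eval G g s"
  shows "pres_lift G g (pres_class S R w) = word_eval G g w"
proof -
  have "pres_eq S R w (SOME w'. w' \<in> pres_class S R w)"
    using pres_eq.refl[OF assms(1), of R] someI[of "\<lambda>w'. w' \<in> pres_class S R w" w]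
    by (auto simp: pres_class_def)
  from word_eval_pres_eq[OF this g R] show ?thesis by (simp add: pres_lift_def)
qed

lemma pres_lift_hom:
  assumes g: "g ` S \<subseteq> carrier G"
    and R: "\<And>r s. (r, s) \<in> R \<Longrightarrow> word_eval G g r = word_eval G g s"
  shows "pres_lift G g \<in> hom (presented_group S R) G"
proof (rule homI)
  have car: "carrier (presented_group S R) = pres_class S R ` words S"
    by (simp add: presented_group_def)
  fix x assume "x \<in> carrier (presented_group S R)"
  then obtain u where u: "u \<in> words S" "x = pres_class S R u" by (auto simp: car)
  show "pres_lift G g x \<in> carrier G"
    using u by (simp add: pres_lift_class[OF _ g R] word_eval_closed[OF _ g])
  fix y assume "y \<in> carrier (presented_group S R)"
  then obtain v where v: "v \<in> words S" "y = pres_class S R v" by (auto simp: car)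
  show "pres_lift G g (x \<otimes>\<^bsub>presented_group S R\<^esub> y) = pres_lift G g x \<otimes> pres_lift G g y"
    using u v by (simp add: presented_group_mult pres_lift_class[OF _ g R] word_eval_append[OF _ _ g])
qed

end

lemma (in group_hom) word_eval_hom:
  assumes "w \<in> words S" "g ` S \<subseteq> carrier G"
  shows "h (word_eval G g w) = word_eval H (\<lambda>a. h (g a)) w"
  using assms(1)
proof (induction rule: words_induct)
  case (Cons a b w)
  then have "g a \<in> carrier G" using assms(2) by blast
  with Cons show ?case using G.word_eval_closed[OF Cons(2) assms(2)] by (simp add: word_eval_Cons)
qed simp

lemma pres_class_inv:
  assumes "a \<in> S"
  shows "inv\<^bsub>presented_group S R\<^esub> (pres_class S R [(a, True)]) = pres_class S R [(a, False)]"
proof (rule group.inv_equality[OF group_presented_group])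
  have "pres_eq S R [(a, False), (a, True)] []"
    using pres_eq.cancel[of "[]" S "[]" a R False] assms by simp
  then show "pres_class S R [(a, False)] \<otimes>\<^bsub>presented_group S R\<^esub> pres_class S R [(a, True)] =
      \<one>\<^bsub>presented_group S R\<^esub>"
    using assms pres_class_eq_iff[of "[(a, False), (a, True)]" S R "[]"]
    by (simp add: presented_group_mult) (simp add: presented_group_def)
qed (use assms in \<open>auto simp: presented_group_def\<close>)

lemma pres_class_closed: "w \<in> words S \<Longrightarrow> pres_class S R w \<in> carrier (presented_group S R)"
  by (simp add: presented_group_def)

lemma pres_class_word_eval:
  assumes "w \<in> words S"
  shows "pres_class S R w = word_eval (presented_group S R) (\<lambda>a. pres_class S R [(a, True)]) w"
  using assms
proof (induction rule: words_induct)
  case Nil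
  then show ?case by (simp add: presented_group_def)
next
  case (Cons a b w)
  have "pres_class S R ([(a, b)] @ w) = pres_class S R [(a, b)] \<otimes>\<^bsub>presented_group S R\<^esub> pres_class S R w"
    using Cons by (subst presented_group_mult) auto
  then show ?case using Cons by (cases b) (simp_all add: word_eval_Cons pres_class_inv)
qed

lemma presented_group_generate:
  "carrier (presented_group S R) =
    generate (presented_group S R) ((\<lambda>a. pres_class S R [(a, True)]) ` S)"
proof -
  interpret group "presented_group S R" by (rule group_presented_group)
  let ?g = "\<lambda>a. pres_class S R [(a, True)]"
  have g: "?g ` S \<subseteq> carrier (presented_group S R)" by (auto intro: pres_class_closed)
  have "word_eval (presented_group S R) ?g w \<in> generate (presented_group S R) (?g ` S)"
    if "w \<in> words S" for w
    using that
    by (induction rule: words_induct)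
      (auto simp: word_eval_Cons intro: generate.intros)
  then show ?thesis
    using pres_class_word_eval generate_incl[OF g] by (fastforce simp: presented_group_def)
qed

section \<open>The Magnus expansion\<close>

definition ncps_units :: "'a ncps monoid" where
  "ncps_units = units_of \<lparr>carrier = UNIV, monoid.mult = (*), one = 1\<rparr>"

lemma monoid_ncps: "monoid \<lparr>carrier = UNIV :: 'a ncps set, monoid.mult = (*), one = 1\<rparr>"
  by unfold_locales (auto simp: mult.assoc)

lemma group_ncps_units: "group ncps_units"
  unfolding ncps_units_def by (rule monoid.units_group[OF monoid_ncps])

lemma ncps_units_simps [simp]:
  "carrier ncps_units = {f. \<exists>g. g * f = 1 \<and> f * g = 1}"
  "x \<otimes>\<^bsub>ncps_units\<^esub> y = x * y" "\<one>\<^bsub>ncps_units\<^esub> = 1"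
  by (auto simp: ncps_units_def units_of_def Units_def)

text \<open>The geometric series of -X_x, the inverse of 1 + X_x.\<close>

lift_definition nvar_inverse :: "'a \<Rightarrow> 'a ncps" is
  "\<lambda>x w. if \<forall>y\<in>set w. y = x then (-1) ^ length w else 0" .

lemma nvar_inverse_left: "nvar_inverse x * (1 + nvar x) = 1"
proof (rule ncps_eqI)
  have *: "ncoeff (nvar_inverse x) w = (if \<forall>y\<in>set w. y = x then (-1) ^ length w else 0)" for w
    by transfer simp
  show "ncoeff (nvar_inverse x * (1 + nvar x)) w = ncoeff 1 w" for w
    by (cases w rule: rev_cases)
      (auto simp: distrib_left ncoeff_times_nvar_snoc * ncoeff_one ncoeff_nvar)
qed

lemma nvar_inverse_right: "(1 + nvar x) * nvar_inverse x = 1"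
proof (rule ncps_eqI)
  have *: "ncoeff (nvar_inverse x) w = (if \<forall>y\<in>set w. y = x then (-1) ^ length w else 0)" for w
    by transfer simp
  show "ncoeff ((1 + nvar x) * nvar_inverse x) w = ncoeff 1 w" for w
    by (cases w) (auto simp: distrib_right ncoeff_nvar_times * ncoeff_one ncoeff_nvar)
qed

text \<open>The definition does not mention the rank: every natural number is a letter.
  \<open>Magnus_support\<close> recovers the bound on the letters.\<close>

definition Magnus :: "nat word set \<Rightarrow> nat ncps" where
  "Magnus = pres_lift ncps_units (\<lambda>j. 1 + nvar j)"

lemma magnus_units: "(\<lambda>j. 1 + nvar j) ` S \<subseteq> carrier ncps_units"
proof (rule image_subsetI)
  show "1 + nvar j \<in> carrier ncps_units" for j :: 'a
    using nvar_inverse_left[of j] nvar_inverse_right[of j] by auto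
qed

lemma ncps_units_inv:
  assumes "f * g = 1" "g * f = 1" shows "inv\<^bsub>ncps_units\<^esub> f = g"
  using assms by (intro group.inv_equality[OF group_ncps_units]) auto

lemma inv_one_plus_nvar: "inv\<^bsub>ncps_units\<^esub> (1 + nvar j) = nvar_inverse j"
  using nvar_inverse_left nvar_inverse_right by (intro ncps_units_inv)

lemma group_free_group: "group (free_group q)"
  by (simp add: free_group_def group_presented_group)

lemma free_gen_closed: "j \<in> {1..q} \<Longrightarrow> free_gen q j \<in> carrier (free_group q)"
  by (simp add: free_gen_def free_group_def pres_class_closed)

lemma Magnus_class:
  "w \<in> words {1..q} \<Longrightarrow> Magnus (pres_class {1..q} {} w) = word_eval ncps_units (\<lambda>j. 1 + nvar j) w"
  unfolding Magnus_def
  by (rule group.pres_lift_class[OF group_ncps_units _ magnus_units]) simp_all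

lemma free_group_class:
  assumes "x \<in> carrier (free_group q)"
  obtains w where "w \<in> words {1..q}" "x = pres_class {1..q} {} w"
  using assms by (auto simp: free_group_def presented_group_def)

lemma Magnus_hom: "Magnus \<in> hom (free_group q) ncps_units"
  unfolding Magnus_def free_group_def
  by (rule group.pres_lift_hom[OF group_ncps_units magnus_units]) simp

text \<open>An induction on the letters of a representing word, phrased for the expansion so that
  later proofs only handle series.\<close>

lemma Magnus_induct [consumes 1, case_names one var inv]:
  assumes "x \<in> carrier (free_group q)" and "P 1"
    and "\<And>j f. j \<in> {1..q} \<Longrightarrow> P f \<Longrightarrow> P ((1 + nvar j) * f)"
    and "\<And>j f. j \<in> {1..q} \<Longrightarrow> P f \<Longrightarrow> P (nvar_inverse j * f)"
  shows "P (Magnus x)"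
proof -
  obtain w where w: "w \<in> words {1..q}" "x = pres_class {1..q} {} w"
    using assms(1) by (rule free_group_class)
  from w(1) have "P (word_eval ncps_units (\<lambda>j. 1 + nvar j) w)"
    by (induction rule: words_induct) (auto simp: word_eval_Cons inv_one_plus_nvar assms(2-))
  then show ?thesis unfolding w(2) Magnus_class[OF w(1)] .
qed

lemma Magnus_free_gen: "j \<in> {1..q} \<Longrightarrow> Magnus (free_gen q j) = 1 + nvar j"
  unfolding free_gen_def by (subst Magnus_class) (auto simp: word_eval_Cons)

lemma Magnus_ncoeff_Nil:
  assumes "x \<in> carrier (free_group q)" shows "ncoeff (Magnus x) [] = 1"
  using assms
proof (induction rule: Magnus_induct)
  case (inv j f)
  then show ?case by (simp add: nvar_inverse.rep_eq)
qed (auto simp: ncoeff_one ncoeff_nvar)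

lemma nshift_simps [simp]:
  "nshift x (f + g) = nshift x f + nshift x g" "nshift x 1 = 0"
  by (auto intro!: ncps_eqI simp: ncoeff_one)

text \<open>Needed because the matrices for rank \<open>q\<close> see only the letters 1 to q;
  coefficients at all other words must agree for another reason.\<close>

lemma Magnus_support:
  assumes "x \<in> carrier (free_group q)" "ncoeff (Magnus x) w \<noteq> 0" shows "set w \<subseteq> {1..q}"
proof -
  have times: "set w \<subseteq> {1..q}"
    if "\<And>w. ncoeff f w \<noteq> 0 \<Longrightarrow> set w \<subseteq> {1..q}" "\<And>w. ncoeff g w \<noteq> 0 \<Longrightarrow> set w \<subseteq> {1..q}"
      "ncoeff (f * g) w \<noteq> 0" for f g :: "nat ncps" and w
    using ncoeff_times_nonzeroD[OF that(3)] that(1,2) by (metis le_sup_iff set_append)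
  from assms(1) have "\<forall>w. ncoeff (Magnus x) w \<noteq> 0 \<longrightarrow> set w \<subseteq> {1..q}"
  proof (induction rule: Magnus_induct)
    case (var j f)
    have "set w \<subseteq> {1..q}" if "ncoeff (1 + nvar j) w \<noteq> 0" for w
      using that var(1) by (auto simp: ncoeff_one ncoeff_nvar split: if_splits)
    then show ?case using var times by blast
  next
    case (inv j f)
    have "set w \<subseteq> {1..q}" if "ncoeff (nvar_inverse j) w \<noteq> 0" for w
      using that inv(1) by (auto simp: nvar_inverse.rep_eq split: if_splits)
    then show ?case using inv times by blast
  qed (simp add: ncoeff_one)
  then show ?thesis using assms(2) by blast
qed


interpretation free_magnus: magnus_rep "free_group q" Magnus for q
proof -
  interpret group_hom "free_group q" ncps_units Magnus
    by (intro group_hom.intro group_hom_axioms.intro group_free_group group_ncps_units Magnus_hom)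
  show "magnus_rep (free_group q) Magnus"
  proof
    fix x y assume "x \<in> carrier (free_group q)"
    then show "ord_ge 1 (Magnus x - 1)"
      by (auto simp: ord_ge_def Magnus_ncoeff_Nil ncoeff_one)
    assume "y \<in> carrier (free_group q)"
    with \<open>x \<in> carrier (free_group q)\<close> show "Magnus (x \<otimes>\<^bsub>free_group q\<^esub> y) = Magnus x * Magnus y"
      using hom_mult by simp
  next
    show "Magnus \<one>\<^bsub>free_group q\<^esub> = 1" using hom_one by simp
  qed
qed

lemma Gam_iff:
  assumes "n \<ge> 1" "x \<in> carrier (free_group q)"
  shows "x \<in> Gam q n \<longleftrightarrow> ord_ge n (Magnus x - 1)"
proof (rule free_magnus.magnus_kernel[of "{1..q}" "free_gen q" q nvar, OF _ _ _ _ _ _ assms])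
  show "carrier (free_group q) = generate (free_group q) (free_gen q ` {1..q})"
    using presented_group_generate[of "{1..q}" "{}"] unfolding free_group_def free_gen_def .
qed (use free_gen_closed Magnus_free_gen homog_nvar in \<open>auto intro: right_indep_nvar\<close>)

text \<open>The powers of \<open>X\<^sub>j\<close> in the expansion of \<open>x\<close> are those of \<open>(1 + X\<^sub>j)\<^sup>e\<close>, where \<open>e\<close> is the exponent sum of
  \<open>x\<^sub>j\<close> in \<open>x\<close>. The equation is multiplied out because \<open>e\<close> may be negative.\<close>

lemma Magnus_restrict_var:
  assumes "x \<in> carrier (free_group q)"
  obtains a b :: nat where "restrict_var j (Magnus x) * (1 + fps_X) ^ a = (1 + fps_X) ^ b"
    "ncoeff (Magnus x) [j] = int b - int a"
proof -
  \<comment> \<open>The constant term is included because the coefficient of a product at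
    \<open>[j]\<close> involves it.\<close>
  let ?P = "\<lambda>f. ncoeff f [] = 1 \<and> (\<exists>a b :: nat. restrict_var j f * (1 + fps_X) ^ a = (1 + fps_X) ^ b \<and>
    ncoeff f [j] = int b - int a)"
  have "?P (Magnus x)"
    using assms
  proof (induction rule: Magnus_induct)
    case one
    then show ?case by (auto simp: ncoeff_one intro!: exI[of _ 0])
  next
    case (var i f)
    then obtain a b where f: "ncoeff f [] = 1"
      and ab: "restrict_var j f * (1 + fps_X) ^ a = (1 + fps_X) ^ b" "ncoeff f [j] = int b - int a"
      by auto
    have c: "ncoeff ((1 + nvar i) * f) [] = 1" "ncoeff ((1 + nvar i) * f) [j] = ncoeff f [j] + (if i = j then 1 else 0)"
      using f by (auto simp: distrib_right ncoeff_nvar_times ncoeff_nvar)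
    show ?case
    proof (cases "i = j")
      case True
      then have "restrict_var j ((1 + nvar i) * f) * (1 + fps_X) ^ a = (1 + fps_X) ^ Suc b"
        using ab by (simp add: restrict_var_times restrict_var_add restrict_var_nvar mult.assoc)
      moreover have "ncoeff ((1 + nvar i) * f) [j] = int (Suc b) - int a"
        using c ab True by simp
      ultimately show ?thesis using c(1) by blast
    next
      case False
      then have "restrict_var j ((1 + nvar i) * f) * (1 + fps_X) ^ a = (1 + fps_X) ^ b"
        using ab by (simp add: restrict_var_times restrict_var_add restrict_var_nvar)
      moreover have "ncoeff ((1 + nvar i) * f) [j] = int b - int a"
        using c ab False by simp
      ultimately show ?thesis using c(1) by blast
    qed
  next
    case (inv i f)
    then obtain a b where f: "ncoeff f [] = 1"
      and ab: "restrict_var j f * (1 + fps_X) ^ a = (1 + fps_X) ^ b" "ncoeff f [j] = int b - int a"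
      by auto
    have "nshift j (nvar_inverse i) = (if i = j then - nvar_inverse i else 0)"
      by (rule ncps_eqI) (auto simp: nvar_inverse.rep_eq)
    then have c: "ncoeff (nvar_inverse i * f) [] = 1"
      "ncoeff (nvar_inverse i * f) [j] = ncoeff f [j] - (if i = j then 1 else 0)"
      using f by (auto simp: ncoeff_times_Cons nvar_inverse.rep_eq)
    have r: "restrict_var j (nvar_inverse i) * (1 + (if i = j then fps_X else 0)) = 1"
      using arg_cong[OF nvar_inverse_left[of i], of "restrict_var j"]
      by (simp add: restrict_var_times restrict_var_add restrict_var_nvar split: if_splits)
    show ?case
    proof (cases "i = j")
      case True
      have "restrict_var j (nvar_inverse i * f) * (1 + fps_X) ^ Suc a =
          (restrict_var j (nvar_inverse i) * (1 + fps_X)) * (restrict_var j f * (1 + fps_X) ^ a)"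
        unfolding restrict_var_times power_Suc by (simp only: ac_simps)
      also have "\<dots> = (1 + fps_X) ^ b"
        using r ab True by simp
      finally have "restrict_var j (nvar_inverse i * f) * (1 + fps_X) ^ Suc a = (1 + fps_X) ^ b" .
      moreover have "ncoeff (nvar_inverse i * f) [j] = int b - int (Suc a)"
        using c ab True by simp
      ultimately show ?thesis using c(1) by blast
    next
      case False
      then have "restrict_var j (nvar_inverse i * f) * (1 + fps_X) ^ a = (1 + fps_X) ^ b"
        using ab r by (simp add: restrict_var_times)
      moreover have "ncoeff (nvar_inverse i * f) [j] = int b - int a"
        using c ab False by simp
      ultimately show ?thesis using c(1) by blast
    qed
  qed
  then show thesis using that by blast
qed

text \<open>Exponent sum zero means a = b in \<open>Magnus_restrict_var\<close>. The nonzero power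
  of 1 + X cancels, and the restricted series is 1.\<close>

lemma Magnus_power_coeff_zero:
  assumes "x \<in> carrier (free_group q)" "ncoeff (Magnus x) [j] = 0" "k \<ge> 1"
  shows "ncoeff (Magnus x) (replicate k j) = 0"
proof -
  obtain a b :: nat where ab: "restrict_var j (Magnus x) * (1 + fps_X) ^ a = (1 + fps_X) ^ b"
    "ncoeff (Magnus x) [j] = int b - int a"
    using Magnus_restrict_var[OF assms(1)] by blast
  have "fps_nth (1 + fps_X :: int fps) 0 \<noteq> 0" by simp
  then have "(1 + fps_X :: int fps) \<noteq> 0" by (metis fps_zero_nth)
  then have "restrict_var j (Magnus x) = 1" using ab assms(2) by simp
  then have "fps_nth (restrict_var j (Magnus x)) k = fps_nth 1 k" by simp
  then show ?thesis using assms(3) by (simp add: restrict_var_def)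
qed

text \<open>A series commuting with \<open>X\<^sub>j\<close> involves only powers of \<open>X\<^sub>j\<close>: a letter different from \<open>j\<close> can be moved
  to the front, where it is impossible.\<close>

lemma commute_nvar_coeff:
  assumes "ord_ge n (nvar j * f - f * nvar j)" "length w + 1 < n" "w \<noteq> replicate (length w) j"
  shows "ncoeff f w = 0"
proof -
  have eq: "ncoeff (nvar j * f) (v @ [j]) = ncoeff f v" if "length v + 1 < n" for v
    using assms(1) that by (auto simp: ord_ge_def ncoeff_times_nvar_snoc)
  have "ncoeff f (replicate k j @ y # v) = 0" if "y \<noteq> j" "k + length v + 2 < n" for k y v
    using that
  proof (induction k arbitrary: v)
    case 0
    then show ?case using eq[of "y # v"] by (simp add: ncoeff_nvar_times)
  next
    case (Suc k)
    \<comment> \<open>One letter \<open>j\<close> moves from the front to the end, so the length,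
      and with it the degree bound, is preserved.\<close>
    have "ncoeff f (replicate (Suc k) j @ y # v) = ncoeff f (replicate k j @ y # (v @ [j]))"
      using eq[of "replicate (Suc k) j @ y # v"] Suc.prems by (simp add: ncoeff_nvar_times)
    then show ?case using Suc.IH[of "v @ [j]"] Suc.prems by simp
  qed
  moreover have "\<exists>k y v. w = replicate k j @ y # v \<and> y \<noteq> j"
    using assms(3)
  proof (induction w)
    case (Cons z w)
    show ?case
    proof (cases "z = j")
      case True
      with Cons obtain k y v where "w = replicate k j @ y # v" "y \<noteq> j" by auto
      then show ?thesis using True by (intro exI[of _ "Suc k"] exI[of _ y] exI[of _ v]) simp
    next
      case False
      then show ?thesis by (intro exI[of _ 0] exI[of _ z] exI[of _ w]) simp
    qed
  qed simp
  ultimately show ?thesis using assms(2) by auto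
qed

section \<open>The unipotent representation\<close>

text \<open>The entry in row \<open>a\<close> and column a + k: each word of length k contributes
  its coefficient times the product of the indeterminates of its letters, with first indices a + 1,
  ..., a + k. Rows count from 0, hence the shift by one.\<close>

fun magnus_entry :: "nat \<Rightarrow> nat \<Rightarrow> nat \<Rightarrow> nat ncps \<Rightarrow> magnus_ring" where
  "magnus_entry q a 0 f = of_int (ncoeff f [])"
| "magnus_entry q a (Suc k) f = (\<Sum>j\<in>{1..q}. lam (a + 1) j * magnus_entry q (a + 1) k (nshift j f))"

text \<open>Substitutes for X_j the superdiagonal matrix with entries lambda_i^(j). It is
  multiplicative on all series, and \<open>Upsilon n\<close> is its composite with
  \<open>Magnus\<close>.\<close>

definition magnus_mat :: "nat \<Rightarrow> nat \<Rightarrow> nat ncps \<Rightarrow> magnus_ring mat" where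
  "magnus_mat q n f = mat n n (\<lambda>(a, b). if a \<le> b then magnus_entry q a (b - a) f else 0)"

lemma nshift_of_int_times: "nshift x (of_int c * f) = of_int c * nshift x f"
proof -
  have "nshift x (of_int c) = 0"
    by (rule ncps_eqI) (simp add: ncoeff_of_int)
  then show ?thesis
    by (simp add: nshift_times ncoeff_of_int)
qed

lemma magnus_entry_add: "magnus_entry q a k (f + g) = magnus_entry q a k f + magnus_entry q a k g"
  by (induction k arbitrary: a f g) (simp_all add: distrib_left sum.distrib)

lemma magnus_entry_scale: "magnus_entry q a k (of_int c * f) = of_int c * magnus_entry q a k f"
  by (induction k arbitrary: a f)
    (simp_all add: nshift_of_int_times ncoeff_of_int sum_distrib_left mult.left_commute)

text \<open>Splitting a word after i letters makes the prefix end, and the suffix start, at row a +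
  i. This is the intermediate index of matrix multiplication.\<close>

lemma magnus_entry_times:
  "magnus_entry q a k (f * g) = (\<Sum>i\<le>k. magnus_entry q a i f * magnus_entry q (a + i) (k - i) g)"
proof (induction k arbitrary: a f)
  case (Suc k)
  have "magnus_entry q a (Suc k) (f * g) =
      of_int (ncoeff f []) * magnus_entry q a (Suc k) g +
      (\<Sum>j\<in>{1..q}. lam (a + 1) j * (\<Sum>i\<le>k. magnus_entry q (a + 1) i (nshift j f) *
        magnus_entry q (a + 1 + i) (k - i) g))"
    by (simp add: nshift_times magnus_entry_add magnus_entry_scale distrib_left sum.distrib
        sum_distrib_left mult.left_commute Suc.IH)
  also have "(\<Sum>j\<in>{1..q}. lam (a + 1) j * (\<Sum>i\<le>k. magnus_entry q (a + 1) i (nshift j f) *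
        magnus_entry q (a + 1 + i) (k - i) g)) =
      (\<Sum>i\<le>k. magnus_entry q a (Suc i) f * magnus_entry q (a + Suc i) (k - i) g)"
    unfolding sum_distrib_left by (subst sum.swap) (simp add: sum_distrib_right mult.assoc)
  finally show ?case by (subst sum.atMost_Suc_shift) simp
qed simp

lemma magnus_mat_times: "magnus_mat q n (f * g) = magnus_mat q n f * magnus_mat q n g"
proof (rule eq_matI)
  fix a b assume "a < dim_row (magnus_mat q n f * magnus_mat q n g)"
    "b < dim_col (magnus_mat q n f * magnus_mat q n g)"
  then have ab: "a < n" "b < n" by (auto simp: magnus_mat_def)
  let ?t = "\<lambda>c. (if a \<le> c then magnus_entry q a (c - a) f else 0) *
      (if c \<le> b then magnus_entry q c (b - c) g else 0)"
  have "(magnus_mat q n f * magnus_mat q n g) $$ (a, b) = (\<Sum>c = 0..<n. ?t c)"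
    using ab by (simp add: magnus_mat_def times_mat_def scalar_prod_def)
  also have "\<dots> = (\<Sum>c\<in>{a..b}. ?t c)"
    using ab by (intro sum.mono_neutral_right) auto
  also have "\<dots> = (if a \<le> b then magnus_entry q a (b - a) (f * g) else 0)"
  proof (cases "a \<le> b")
    case True
    then have "(\<Sum>c\<in>{a..b}. ?t c) = (\<Sum>i\<le>b - a. ?t (a + i))"
      by (intro sum.reindex_bij_witness[of _ "\<lambda>i. a + i" "\<lambda>c. c - a"]) auto
    also have "\<dots> = (\<Sum>i\<le>b - a. magnus_entry q a i f * magnus_entry q (a + i) (b - a - i) g)"
      using True by (intro sum.cong) auto
    finally show ?thesis using True by (simp add: magnus_entry_times)
  qed simp
  finally show "magnus_mat q n (f * g) $$ (a, b) = (magnus_mat q n f * magnus_mat q n g) $$ (a, b)"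
    using ab by (simp add: magnus_mat_def)
qed (auto simp: magnus_mat_def)

lemma magnus_entry_zero: "magnus_entry q a k 0 = 0"
  using magnus_entry_scale[of q a k 0 0] by simp

lemma magnus_entry_one: "magnus_entry q a k 1 = (if k = 0 then 1 else 0)"
  by (cases k) (simp_all add: ncoeff_one magnus_entry_zero)

lemma magnus_mat_one: "magnus_mat q n 1 = 1\<^sub>m n"
  by (rule eq_matI) (auto simp: magnus_mat_def magnus_entry_one)

lemma magnus_entry_nvar:
  assumes "j \<in> {1..q}"
  shows "magnus_entry q a k (nvar j) = (if k = 1 then lam (a + 1) j else 0)"
proof (cases k)
  case (Suc k')
  have "magnus_entry q (a + 1) k' (nshift i (nvar j)) = (if i = j then magnus_entry q (a + 1) k' 1 else 0)" for i
    by (simp add: nshift_nvar magnus_entry_zero)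
  then have "magnus_entry q a k (nvar j) =
      (\<Sum>i\<in>{1..q}. if i = j then lam (a + 1) i * magnus_entry q (a + 1) k' 1 else 0)"
    unfolding Suc magnus_entry.simps by (intro sum.cong) (auto simp del: magnus_entry.simps)
  then show ?thesis using assms Suc by (simp add: magnus_entry_one)
qed (simp add: ncoeff_nvar)

lemma magnus_mat_gen:
  assumes "j \<in> {1..q}" shows "magnus_mat q n (1 + nvar j) = magnus_gen n j"
proof (rule eq_matI)
  fix a b assume "a < dim_row (magnus_gen n j)" "b < dim_col (magnus_gen n j)"
  then have ab: "a < n" "b < n" by (auto simp: magnus_gen_def)
  show "magnus_mat q n (1 + nvar j) $$ (a, b) = magnus_gen n j $$ (a, b)"
  proof (cases "a \<le> b")
    case True
    then have "a = b \<or> b = Suc a \<or> b - a \<ge> 2" "b - a = 1 \<longleftrightarrow> b = Suc a" by auto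
    then show ?thesis
      using ab assms True
      by (auto simp: magnus_mat_def magnus_gen_def magnus_entry_add magnus_entry_one magnus_entry_nvar)
  next
    case False
    then show ?thesis using ab by (auto simp: magnus_mat_def magnus_gen_def)
  qed
qed (auto simp: magnus_mat_def magnus_gen_def)

lemma group_GL: "group (GL n)"
proof -
  interpret ring "ring_mat TYPE(magnus_ring) n ()" by (rule ring_mat)
  show ?thesis unfolding GL_def by (rule units_group)
qed

lemma GL_simps [simp]:
  "carrier (GL n) = {A \<in> carrier_mat n n. \<exists>B\<in>carrier_mat n n. B * A = 1\<^sub>m n \<and> A * B = 1\<^sub>m n}"
  "A \<otimes>\<^bsub>GL n\<^esub> B = A * B" "\<one>\<^bsub>GL n\<^esub> = 1\<^sub>m n"
  by (auto simp: GL_def units_of_def Units_def ring_mat_simps)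

lemma magnus_mat_carrier [simp]: "magnus_mat q n f \<in> carrier_mat n n"
  by (simp add: magnus_mat_def)

lemma magnus_mat_hom: "group_hom ncps_units (GL n) (magnus_mat q n)"
proof (intro group_hom.intro group_hom_axioms.intro group_ncps_units group_GL homI)
  fix f :: "nat ncps" assume "f \<in> carrier ncps_units"
  then obtain g where "g * f = 1" "f * g = 1" by auto
  then have "magnus_mat q n g * magnus_mat q n f = 1\<^sub>m n" "magnus_mat q n f * magnus_mat q n g = 1\<^sub>m n"
    by (metis magnus_mat_times magnus_mat_one)+
  then show "magnus_mat q n f \<in> carrier (GL n)" by auto
qed (simp add: magnus_mat_times)

text \<open>Both sides evaluate a representing word in \<open>GL n\<close>, and they agree on
  generators by \<open>magnus_mat_gen\<close>.\<close>

lemma Upsilon_eq: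
  assumes "x \<in> carrier (free_group q)"
  shows "Upsilon n x = magnus_mat q n (Magnus x)"
proof -
  interpret group_hom ncps_units "GL n" "magnus_mat q n" by (rule magnus_mat_hom)
  obtain w where w: "w \<in> words {1..q}" "x = pres_class {1..q} {} w"
    using assms by (rule free_group_class)
  have g: "magnus_gen n ` {1..q} \<subseteq> carrier (GL n)"
  proof (rule image_subsetI)
    fix j assume "j \<in> {1..q}"
    then show "magnus_gen n j \<in> carrier (GL n)"
      using hom_closed[of "1 + nvar j"] magnus_units[of "{j}"] magnus_mat_gen by fastforce
  qed
  have "magnus_mat q n (Magnus x) = word_eval (GL n) (\<lambda>j. magnus_mat q n (1 + nvar j)) w"
    unfolding w(2) Magnus_class[OF w(1)] by (rule word_eval_hom[OF w(1) magnus_units])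
  also have "\<dots> = word_eval (GL n) (magnus_gen n) w"
    using w(1) by (induction rule: words_induct) (auto simp: word_eval_Cons magnus_mat_gen simp del: GL_simps)
  also have "\<dots> = Upsilon n x"
    unfolding w(2) Upsilon_def
    by (rule group.pres_lift_class[OF group_GL w(1) g, symmetric]) simp
  finally show ?thesis by simp
qed

lemma Upsilon_hom: "group_hom (free_group q) (GL n) (Upsilon n)"
proof (intro group_hom.intro group_hom_axioms.intro group_free_group group_GL homI)
  interpret group_hom ncps_units "GL n" "magnus_mat q n" by (rule magnus_mat_hom)
  fix x assume x: "x \<in> carrier (free_group q)"
  then have "Magnus x \<in> carrier ncps_units" using Magnus_hom hom_in_carrier by metis
  then show "Upsilon n x \<in> carrier (GL n)" unfolding Upsilon_eq[OF x] by (rule hom_closed)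
  fix y assume y: "y \<in> carrier (free_group q)"
  show "Upsilon n (x \<otimes>\<^bsub>free_group q\<^esub> y) = Upsilon n x \<otimes>\<^bsub>GL n\<^esub> Upsilon n y"
    using x y Upsilon_eq[of _ q n]
    by (simp add: free_magnus.M_mult magnus_mat_times)
qed

text \<open>The first index of \<open>\<lambda>\<^sub>i\<^sup>(\<^sup>j\<^sup>)\<close> records the position of the letter \<open>j\<close>, so the commutative monomial determines
  the word.\<close>

fun word_monomial :: "nat \<Rightarrow> nat list \<Rightarrow> (nat \<times> nat) \<Rightarrow>\<^sub>0 nat" where
  "word_monomial a [] = 0"
| "word_monomial a (j # w) = Poly_Mapping.single (a + 1, j) 1 + word_monomial (a + 1) w"

lemma lookup_word_monomial_low: "i \<le> a \<Longrightarrow> Poly_Mapping.lookup (word_monomial a w) (i, j) = 0"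
  by (induction w arbitrary: a) (auto simp: lookup_add lookup_single)

lemma word_monomial_inj:
  "word_monomial a v = word_monomial a w \<Longrightarrow> length v = length w \<Longrightarrow> v = w"
proof (induction v arbitrary: a w)
  case (Cons i v)
  then obtain j u where w: "w = j # u" by (cases w) auto
  have "Poly_Mapping.lookup (word_monomial a (i # v)) (a + 1, i) = 1"
    by (simp add: lookup_add lookup_single lookup_word_monomial_low)
  then have "Poly_Mapping.lookup (word_monomial a (j # u)) (a + 1, i) = 1"
    using Cons.prems w by simp
  then have "i = j"
    by (simp add: lookup_add lookup_single lookup_word_monomial_low when_def split: if_splits)
  with Cons.prems w have "word_monomial (a + 1) v = word_monomial (a + 1) u" by simp
  with Cons \<open>i = j\<close> w show ?case by simp
qed simp

lemma magnus_entry_sum: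
  "magnus_entry q a k f =
    (\<Sum>w | set w \<subseteq> {1..q} \<and> length w = k. Poly_Mapping.single (word_monomial a w) (ncoeff f w))"
proof (induction k arbitrary: a f)
  case 0
  have "{w. set w \<subseteq> {1..q} \<and> length w = 0} = {[]}" by auto
  moreover have "of_int c = (Poly_Mapping.single 0 c :: magnus_ring)" for c
    using single_of_int[of c, where 'b = int] by (metis of_int_eq_id id_apply)
  ultimately show ?case by simp
next
  case (Suc k)
  let ?W = "{w. set w \<subseteq> {1..q} \<and> length w = k}"
  have W: "{w. set w \<subseteq> {1..q} \<and> length w = Suc k} = (\<lambda>(j, w). j # w) ` ({1..q} \<times> ?W)"
    by (auto simp: length_Suc_conv image_iff)
  have "magnus_entry q a (Suc k) f =
      (\<Sum>j\<in>{1..q}. \<Sum>w\<in>?W. Poly_Mapping.single (word_monomial a (j # w)) (ncoeff f (j # w)))"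
    by (simp add: Suc.IH sum_distrib_left lam_def mult_single)
  also have "\<dots> = (\<Sum>w | set w \<subseteq> {1..q} \<and> length w = Suc k.
      Poly_Mapping.single (word_monomial a w) (ncoeff f w))"
    unfolding W by (subst sum.reindex) (auto simp: inj_on_def sum.cartesian_product split_def)
  finally show ?case .
qed

lemma lookup_magnus_entry:
  assumes "set w \<subseteq> {1..q}"
  shows "Poly_Mapping.lookup (magnus_entry q a (length w) f) (word_monomial a w) = ncoeff f w"
proof -
  let ?W = "{v. set v \<subseteq> {1..q} \<and> length v = length w}"
  have fin: "finite ?W" by (rule finite_lists_length_eq) simp
  have "Poly_Mapping.lookup (magnus_entry q a (length w) f) (word_monomial a w) =
      (\<Sum>v\<in>?W. if v = w then ncoeff f v else 0)"
    unfolding magnus_entry_sum lookup_sum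
    by (intro sum.cong refl) (auto simp: lookup_single when_def dest: word_monomial_inj)
  also have "\<dots> = ncoeff f w" using fin assms by simp
  finally show ?thesis .
qed

text \<open>The top row suffices: its entry in column k determines the coefficients at all words of
  length k in the letters 1 to q, and the other words are excluded by \<open>Magnus_support\<close>.
  Conversely no entry uses words of length n or more.\<close>

lemma Upsilon_eq_iff:
  assumes x: "x \<in> carrier (free_group q)" and y: "y \<in> carrier (free_group q)"
  shows "Upsilon n x = Upsilon n y \<longleftrightarrow> ord_ge n (Magnus x - Magnus y)"
proof
  assume eq: "Upsilon n x = Upsilon n y"
  show "ord_ge n (Magnus x - Magnus y)"
    unfolding ord_ge_def
  proof (intro allI impI)
    fix w :: "nat list" assume w: "length w < n"
    show "ncoeff (Magnus x - Magnus y) w = 0"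
    proof (cases "set w \<subseteq> {1..q}")
      case True
      have "magnus_mat q n (Magnus x) $$ (0, length w) = magnus_mat q n (Magnus y) $$ (0, length w)"
        using eq Upsilon_eq[OF x] Upsilon_eq[OF y] by simp
      then have "magnus_entry q 0 (length w) (Magnus x) = magnus_entry q 0 (length w) (Magnus y)"
        using w by (simp add: magnus_mat_def)
      then show ?thesis using lookup_magnus_entry[OF True, of 0] by (metis ncoeff_simps(3) diff_self)
    next
      case False
      then show ?thesis
        using Magnus_support[OF x, of w] Magnus_support[OF y, of w]
        by (cases "ncoeff (Magnus x) w = 0"; cases "ncoeff (Magnus y) w = 0") simp_all
    qed
  qed
next
  assume ord: "ord_ge n (Magnus x - Magnus y)"
  have "magnus_entry q a k (Magnus x) = magnus_entry q a k (Magnus y)" if "k < n" for a k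
    unfolding magnus_entry_sum using ord that by (intro sum.cong) (auto simp: ord_ge_def)
  then show "Upsilon n x = Upsilon n y"
    unfolding Upsilon_eq[OF x] Upsilon_eq[OF y] magnus_mat_def
    by (intro cong_mat refl) auto
qed

section \<open>The quotients of the free group\<close>

lemma Gam_normal: "n \<ge> 1 \<Longrightarrow> Gam q n \<lhd> free_group q"
  by (rule free_magnus.lower_central_normal)

lemma nil_quot_hom:
  assumes "n \<ge> 1"
  shows "group_hom (free_group q) (nil_quot q n) (\<lambda>x. Gam q n #>\<^bsub>free_group q\<^esub> x)"
proof -
  interpret normal "Gam q n" "free_group q" by (rule Gam_normal[OF assms])
  show ?thesis
    unfolding nil_quot_def using factorgroup_is_group r_coset_hom_Mod
    by (intro group_hom.intro group_hom_axioms.intro group_free_group)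
qed

lemma nil_quot_carrierE:
  assumes "C \<in> carrier (nil_quot q n)"
  obtains x where "x \<in> carrier (free_group q)" "C = Gam q n #>\<^bsub>free_group q\<^esub> x"
  using assms by (auto simp: nil_quot_def FactGroup_def RCOSETS_def)

lemma coset_element:
  assumes "n \<ge> 1" "x \<in> carrier (free_group q)" "y \<in> Gam q n #>\<^bsub>free_group q\<^esub> x"
  shows "y \<in> carrier (free_group q)" "ord_ge n (Magnus y - Magnus x)"
proof -
  obtain h where h: "h \<in> Gam q n" "y = h \<otimes>\<^bsub>free_group q\<^esub> x"
    using assms(3) by (auto simp: r_coset_def)
  have hc: "h \<in> carrier (free_group q)" using h(1) by (rule free_magnus.lower_central_closed)
  then show "y \<in> carrier (free_group q)" using h assms by simp
  have "Magnus y - Magnus x = (Magnus h - 1) * Magnus x"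
    using h hc assms by (simp add: free_magnus.M_mult algebra_simps)
  then show "ord_ge n (Magnus y - Magnus x)"
    using ord_ge_times_right[of n "Magnus h - 1" "Magnus x"] Gam_iff[OF assms(1) hc] h(1) by simp
qed

text \<open>Multiplying the difference of the expansions by the unit M(y^{-1}) gives M(x y^{-1}) -
  1, to which Magnus' theorem applies. Computations in the quotient thus become congruences of
  series.\<close>

lemma coset_eq_iff:
  assumes n: "n \<ge> 1" and x: "x \<in> carrier (free_group q)" and y: "y \<in> carrier (free_group q)"
  shows "Gam q n #>\<^bsub>free_group q\<^esub> x = Gam q n #>\<^bsub>free_group q\<^esub> y \<longleftrightarrow>
    ord_ge n (Magnus x - Magnus y)"
proof
  interpret normal "Gam q n" "free_group q" by (rule Gam_normal[OF n])
  assume "Gam q n #>\<^bsub>free_group q\<^esub> x = Gam q n #>\<^bsub>free_group q\<^esub> y"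
  then have "x \<in> Gam q n #>\<^bsub>free_group q\<^esub> y"
    using free_magnus.rcos_self[OF x subgroup_axioms] by simp
  then show "ord_ge n (Magnus x - Magnus y)" using coset_element(2)[OF n y] by blast
next
  interpret normal "Gam q n" "free_group q" by (rule Gam_normal[OF n])
  assume "ord_ge n (Magnus x - Magnus y)"
  then have "ord_ge n ((Magnus x - Magnus y) * Magnus (inv\<^bsub>free_group q\<^esub> y))"
    by (rule ord_ge_times_right)
  then have "ord_ge n (Magnus (x \<otimes>\<^bsub>free_group q\<^esub> inv\<^bsub>free_group q\<^esub> y) - 1)"
    using x y by (simp add: free_magnus.M_mult free_magnus.M_mult_inv left_diff_distrib)
  then have "x \<otimes>\<^bsub>free_group q\<^esub> inv\<^bsub>free_group q\<^esub> y \<in> Gam q n" using Gam_iff[OF n] x y by simp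
  then have "x \<in> Gam q n #>\<^bsub>free_group q\<^esub> y"
    using x y by (auto simp: r_coset_def free_magnus.m_assoc intro!: bexI[of _ "x \<otimes>\<^bsub>free_group q\<^esub> inv\<^bsub>free_group q\<^esub> y"])
  then show "Gam q n #>\<^bsub>free_group q\<^esub> x = Gam q n #>\<^bsub>free_group q\<^esub> y"
    using free_magnus.repr_independence[OF _ y subgroup_axioms] by simp
qed

lemma Upsilon_quot_coset:
  assumes "n \<ge> 1" "x \<in> carrier (free_group q)"
  shows "Upsilon_quot n (Gam q n #>\<^bsub>free_group q\<^esub> x) = Upsilon n x"
proof -
  interpret normal "Gam q n" "free_group q" by (rule Gam_normal[OF assms(1)])
  have "Upsilon n ` (Gam q n #>\<^bsub>free_group q\<^esub> x) = {Upsilon n x}"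
  proof
    show "Upsilon n ` (Gam q n #>\<^bsub>free_group q\<^esub> x) \<subseteq> {Upsilon n x}"
      using coset_element[OF assms] Upsilon_eq_iff assms by blast
    show "{Upsilon n x} \<subseteq> Upsilon n ` (Gam q n #>\<^bsub>free_group q\<^esub> x)"
      using free_magnus.rcos_self[OF assms(2) subgroup_axioms] by blast
  qed
  then show ?thesis by (simp add: Upsilon_quot_def)
qed

lemma nil_proj_coset:
  assumes "n \<ge> 1" "x \<in> carrier (free_group q)"
  shows "nil_proj q n (Gam q (n + 1) #>\<^bsub>free_group q\<^esub> x) = Gam q n #>\<^bsub>free_group q\<^esub> x"
proof -
  interpret normal "Gam q (n + 1)" "free_group q" by (rule Gam_normal) simp
  have "(\<lambda>y. Gam q n #>\<^bsub>free_group q\<^esub> y) ` (Gam q (n + 1) #>\<^bsub>free_group q\<^esub> x) =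
      {Gam q n #>\<^bsub>free_group q\<^esub> x}"
  proof
    show "(\<lambda>y. Gam q n #>\<^bsub>free_group q\<^esub> y) ` (Gam q (n + 1) #>\<^bsub>free_group q\<^esub> x) \<subseteq>
        {Gam q n #>\<^bsub>free_group q\<^esub> x}"
    proof (rule image_subsetI)
      fix y assume "y \<in> Gam q (n + 1) #>\<^bsub>free_group q\<^esub> x"
      then have "y \<in> carrier (free_group q)" "ord_ge (n + 1) (Magnus y - Magnus x)"
        using coset_element[of "n + 1" x q y] assms by auto
      then show "Gam q n #>\<^bsub>free_group q\<^esub> y \<in> {Gam q n #>\<^bsub>free_group q\<^esub> x}"
        using coset_eq_iff[OF assms(1) _ assms(2)] ord_ge_mono[of "n + 1" _ n] by simp
    qed
    show "{Gam q n #>\<^bsub>free_group q\<^esub> x} \<subseteq>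
        (\<lambda>y. Gam q n #>\<^bsub>free_group q\<^esub> y) ` (Gam q (n + 1) #>\<^bsub>free_group q\<^esub> x)"
      using free_magnus.rcos_self[OF assms(2) subgroup_axioms] by blast
  qed
  then show ?thesis by (simp add: nil_proj_def)
qed

text \<open>The preimage taken in \<open>Im_proj\<close> need not be known: its expansion agrees
  with that of \<open>x\<close> below degree n + 1, hence below degree n.\<close>

lemma Im_proj_Upsilon:
  assumes "n \<ge> 1" "x \<in> carrier (free_group q)"
  shows "Im_proj q n (Upsilon (n + 1) x) = Upsilon n x"
proof -
  let ?C = "inv_into (carrier (nil_quot q (n + 1))) (Upsilon_quot (n + 1)) (Upsilon (n + 1) x)"
  have "Gam q (n + 1) #>\<^bsub>free_group q\<^esub> x \<in> carrier (nil_quot q (n + 1))"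
    using nil_quot_hom[of "n + 1" q] assms(2) by (simp add: group_hom.hom_closed)
  then have mem: "Upsilon (n + 1) x \<in> Upsilon_quot (n + 1) ` carrier (nil_quot q (n + 1))"
    using Upsilon_quot_coset[of "n + 1" x q] assms(2) by (intro image_eqI) auto
  have C: "?C \<in> carrier (nil_quot q (n + 1))" "Upsilon_quot (n + 1) ?C = Upsilon (n + 1) x"
    using inv_into_into[OF mem] f_inv_into_f[OF mem] by auto
  then obtain y where y: "y \<in> carrier (free_group q)" "?C = Gam q (n + 1) #>\<^bsub>free_group q\<^esub> y"
    using nil_quot_carrierE by blast
  then have "Upsilon (n + 1) y = Upsilon (n + 1) x"
    using C(2) Upsilon_quot_coset[of "n + 1" y q] by simp
  then have "Upsilon n y = Upsilon n x"
    using y(1) assms(2) Upsilon_eq_iff ord_ge_mono[of "n + 1" _ n] by auto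
  then show ?thesis
    unfolding Im_proj_def y(2) using y(1) assms by (simp add: nil_proj_coset[simplified] Upsilon_quot_coset)
qed

lemma Upsilon_quot_hom:
  assumes "n \<ge> 1" shows "group_hom (nil_quot q n) (GL n) (Upsilon_quot n)"
proof (intro group_hom.intro group_hom_axioms.intro group_GL homI)
  interpret P: group_hom "free_group q" "nil_quot q n" "\<lambda>x. Gam q n #>\<^bsub>free_group q\<^esub> x"
    by (rule nil_quot_hom[OF assms])
  interpret U: group_hom "free_group q" "GL n" "Upsilon n" by (rule Upsilon_hom)
  show "group (nil_quot q n)" by (rule P.H.is_group)
  fix C assume "C \<in> carrier (nil_quot q n)"
  then obtain x where x: "x \<in> carrier (free_group q)" "C = Gam q n #>\<^bsub>free_group q\<^esub> x"
    by (rule nil_quot_carrierE)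
  then show "Upsilon_quot n C \<in> carrier (GL n)"
    using U.hom_closed by (simp add: Upsilon_quot_coset[OF assms] del: GL_simps)
  fix C' assume "C' \<in> carrier (nil_quot q n)"
  then obtain y where y: "y \<in> carrier (free_group q)" "C' = Gam q n #>\<^bsub>free_group q\<^esub> y"
    by (rule nil_quot_carrierE)
  show "Upsilon_quot n (C \<otimes>\<^bsub>nil_quot q n\<^esub> C') = Upsilon_quot n C \<otimes>\<^bsub>GL n\<^esub> Upsilon_quot n C'"
    using x(1) y(1) unfolding x(2) y(2) P.hom_mult[OF x(1) y(1), symmetric]
    by (simp only: Upsilon_quot_coset[OF assms] U.hom_mult free_magnus.m_closed)
qed

section \<open>The map \<open>\<I>\<^sub>j\<close>\<close>

text \<open>The orders 1 of M(x_j) - 1 and m - 1 of M(y) - 1 add up to m, and the error in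
  \<open>leading_commu\<close> has one order more. This is the source of the bound m + 1.\<close>

lemma Magnus_commu_free_gen:
  assumes j: "j \<in> {1..q}" and m: "m \<ge> 2" and y: "y \<in> Gam q (m - 1)"
  shows "commu (free_group q) (free_gen q j) y \<in> Gam q m"
    and "ord_ge (m + 1) (Magnus (commu (free_group q) (free_gen q j) y) - 1
      - (nvar j * (Magnus y - 1) - (Magnus y - 1) * nvar j))"
    and "ord_ge m (nvar j * (Magnus y - 1) - (Magnus y - 1) * nvar j)"
proof -
  have x: "free_gen q j \<in> carrier (free_group q)" by (rule free_gen_closed[OF j])
  have yc: "y \<in> carrier (free_group q)" using y by (rule free_magnus.lower_central_closed)
  have oy: "ord_ge (m - 1) (Magnus y - 1)" using y by (rule free_magnus.lower_central_ord_ge)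
  have ox: "ord_ge 1 (nvar j)" by (rule homog_ord_ge[OF homog_nvar])
  have "commu (free_group q) y (free_gen q j) \<in> Gam q m"
    using free_magnus.commu_lower_central[OF _ y x] m by simp
  then have "inv\<^bsub>free_group q\<^esub> (commu (free_group q) y (free_gen q j)) \<in> Gam q m"
    by (rule subgroup.m_inv_closed[OF free_magnus.lower_central_subgroup])
  then show "commu (free_group q) (free_gen q j) y \<in> Gam q m"
    using free_magnus.inv_commu[OF yc x] by simp
  show "ord_ge (m + 1) (Magnus (commu (free_group q) (free_gen q j) y) - 1
      - (nvar j * (Magnus y - 1) - (Magnus y - 1) * nvar j))"
    using free_magnus.leading_commu[OF x yc _ oy, of 1] ox m
    by (simp add: Magnus_free_gen[OF j] numeral_2_eq_2)
  show "ord_ge m (nvar j * (Magnus y - 1) - (Magnus y - 1) * nvar j)"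
    using ord_ge_times[OF ox oy] ord_ge_times[OF oy ox] m by (intro ord_ge_diff) simp_all
qed

text \<open>Independence of the chosen \<open>y\<close>: two choices have expansions agreeing below
  degree m, and the commutator with X_j raises the order of their difference to m + 1.\<close>

lemma I_map_Upsilon:
  assumes j: "j \<in> {1..q}" and m: "m \<ge> 2" and y: "y \<in> Gam q (m - 1)"
  shows "I_map q m j (Upsilon m y) = Upsilon (m + 1) (commu (free_group q) (free_gen q j) y)"
proof -
  let ?x = "free_gen q j" and ?F = "free_group q"
  define z where "z = (SOME z. z \<in> Gam q (m - 1) \<and> Upsilon m z = Upsilon m y)"
  have "z \<in> Gam q (m - 1) \<and> Upsilon m z = Upsilon m y"
    unfolding z_def by (rule someI[of _ y]) (use y in simp)
  then have z: "z \<in> Gam q (m - 1)" and eq: "Upsilon m z = Upsilon m y" by auto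
  have x: "?x \<in> carrier ?F" by (rule free_gen_closed[OF j])
  have yc: "y \<in> carrier ?F" and zc: "z \<in> carrier ?F"
    using y z free_magnus.lower_central_closed by blast+
  have "ord_ge m (Magnus z - Magnus y)" using eq Upsilon_eq_iff[OF zc yc] by simp
  then have "ord_ge (m + 1) (nvar j * (Magnus z - Magnus y) - (Magnus z - Magnus y) * nvar j)"
    using ord_ge_times[OF homog_ord_ge[OF homog_nvar[of j]]] ord_ge_times[OF _ homog_ord_ge[OF homog_nvar[of j]]]
    by (intro ord_ge_diff) (simp_all add: add.commute)
  moreover have "nvar j * (Magnus z - Magnus y) - (Magnus z - Magnus y) * nvar j =
      (nvar j * (Magnus z - 1) - (Magnus z - 1) * nvar j) - (nvar j * (Magnus y - 1) - (Magnus y - 1) * nvar j)"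
    by (simp add: algebra_simps)
  ultimately have "ord_ge (m + 1) (((Magnus (commu ?F ?x z) - 1
      - (nvar j * (Magnus z - 1) - (Magnus z - 1) * nvar j))
      - (Magnus (commu ?F ?x y) - 1 - (nvar j * (Magnus y - 1) - (Magnus y - 1) * nvar j)))
      + ((nvar j * (Magnus z - 1) - (Magnus z - 1) * nvar j) - (nvar j * (Magnus y - 1) - (Magnus y - 1) * nvar j)))"
    using Magnus_commu_free_gen(2)[OF j m y] Magnus_commu_free_gen(2)[OF j m z]
    by (intro ord_ge_add[OF ord_ge_diff]) simp_all
  then have "ord_ge (m + 1) (Magnus (commu ?F ?x z) - Magnus (commu ?F ?x y))" by simp
  then have "Upsilon (m + 1) (commu ?F ?x z) = Upsilon (m + 1) (commu ?F ?x y)"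
    using x yc zc by (subst Upsilon_eq_iff[where q = q]) auto
  then show ?thesis by (simp add: I_map_def Let_def z_def)
qed

text \<open>The expansion of a product deviates from additivity by (M(y) - 1)(M(z) - 1), of order at
  least 2(m - 1), hence at least m. Its commutator with X_j has order at least m + 1 and is
  invisible to \<open>Upsilon (m + 1)\<close>.\<close>

lemma I_map_hom:
  assumes j: "j \<in> {1..q}" and m: "m \<ge> 2"
  shows "I_map q m j \<in> hom (Upsilon_Q q m) (Upsilon_Q q (m + 1))"
proof (rule homI)
  let ?x = "free_gen q j" and ?F = "free_group q"
  interpret U: group_hom ?F "GL m" "Upsilon m" by (rule Upsilon_hom)
  interpret U': group_hom ?F "GL (m + 1)" "Upsilon (m + 1)" by (rule Upsilon_hom)
  have x: "?x \<in> carrier ?F" by (rule free_gen_closed[OF j])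
  fix A assume "A \<in> carrier (Upsilon_Q q m)"
  then obtain y where y: "y \<in> Gam q (m - 1)" "A = Upsilon m y" by (auto simp: Upsilon_Q_def)
  then show "I_map q m j A \<in> carrier (Upsilon_Q q (m + 1))"
    using Magnus_commu_free_gen(1)[OF j m y(1)] by (auto simp: Upsilon_Q_def I_map_Upsilon[OF j m])
  fix B assume "B \<in> carrier (Upsilon_Q q m)"
  then obtain z where z: "z \<in> Gam q (m - 1)" "B = Upsilon m z" by (auto simp: Upsilon_Q_def)
  have yc: "y \<in> carrier ?F" and zc: "z \<in> carrier ?F"
    using y z free_magnus.lower_central_closed by blast+
  have yz: "y \<otimes>\<^bsub>?F\<^esub> z \<in> Gam q (m - 1)"
    using subgroup.m_closed[OF free_magnus.lower_central_subgroup y(1) z(1)] .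
  let ?d = "\<lambda>u. nvar j * (Magnus u - 1) - (Magnus u - 1) * nvar j"
  let ?p = "(Magnus y - 1) * (Magnus z - 1)"
  have "ord_ge ((m - 1) + (m - 1)) ?p"
    using y(1) z(1) free_magnus.lower_central_ord_ge by (intro ord_ge_times)
  then have p: "ord_ge m ?p" using m by (auto intro: ord_ge_mono)
  have "ord_ge (m + 1) (nvar j * ?p - ?p * nvar j)"
    using ord_ge_times[OF homog_ord_ge[OF homog_nvar[of j]] p] ord_ge_times[OF p homog_ord_ge[OF homog_nvar[of j]]]
    by (intro ord_ge_diff) (simp_all add: add.commute)
  also have "nvar j * ?p - ?p * nvar j = ?d (y \<otimes>\<^bsub>?F\<^esub> z) - (?d y + ?d z)"
    using yc zc by (simp add: free_magnus.M_mult algebra_simps)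
  finally have d: "ord_ge (m + 1) (?d (y \<otimes>\<^bsub>?F\<^esub> z) - (?d y + ?d z))" .
  have 1: "ord_ge (m + 1) (Magnus (commu ?F ?x (y \<otimes>\<^bsub>?F\<^esub> z)) - 1 - ?d (y \<otimes>\<^bsub>?F\<^esub> z))"
    by (rule Magnus_commu_free_gen(2)[OF j m yz])
  have 2: "ord_ge (m + 1) (Magnus (commu ?F ?x y \<otimes>\<^bsub>?F\<^esub> commu ?F ?x z) - 1 - (?d y + ?d z))"
    using free_magnus.leading_mult[of "commu ?F ?x y" q "commu ?F ?x z" m "?d y" "?d z"] x yc zc m
      Magnus_commu_free_gen(2,3)[OF j m y(1)] Magnus_commu_free_gen(2,3)[OF j m z(1)]
    by simp
  have "ord_ge (m + 1) (((Magnus (commu ?F ?x (y \<otimes>\<^bsub>?F\<^esub> z)) - 1 - ?d (y \<otimes>\<^bsub>?F\<^esub> z))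
      - (Magnus (commu ?F ?x y \<otimes>\<^bsub>?F\<^esub> commu ?F ?x z) - 1 - (?d y + ?d z)))
      + (?d (y \<otimes>\<^bsub>?F\<^esub> z) - (?d y + ?d z)))"
    by (rule ord_ge_add[OF ord_ge_diff[OF 1 2] d])
  then have "ord_ge (m + 1) (Magnus (commu ?F ?x (y \<otimes>\<^bsub>?F\<^esub> z)) - Magnus (commu ?F ?x y \<otimes>\<^bsub>?F\<^esub> commu ?F ?x z))"
    by simp
  then have "Upsilon (m + 1) (commu ?F ?x (y \<otimes>\<^bsub>?F\<^esub> z)) =
      Upsilon (m + 1) (commu ?F ?x y \<otimes>\<^bsub>?F\<^esub> commu ?F ?x z)"
    using x yc zc by (subst Upsilon_eq_iff[where q = q]) auto
  also have "\<dots> = Upsilon (m + 1) (commu ?F ?x y) \<otimes>\<^bsub>GL (m + 1)\<^esub> Upsilon (m + 1) (commu ?F ?x z)"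
    using x yc zc by (intro U'.hom_mult) auto
  finally show "I_map q m j (A \<otimes>\<^bsub>Upsilon_Q q m\<^esub> B) =
      I_map q m j A \<otimes>\<^bsub>Upsilon_Q q (m + 1)\<^esub> I_map q m j B"
    using y z I_map_Upsilon[OF j m yz] U.hom_mult[OF yc zc]
    by (simp add: Upsilon_Q_def I_map_Upsilon[OF j m] del: GL_simps)
qed

text \<open>Equal images force M(y) - M(z) to commute with X_j through degree m, so below degree m
  it can only involve powers of X_j. As m - 1 is at least 2, \<open>y\<close> and \<open>z\<close>
  have exponent sum zero and these coefficients vanish. For m = 2 the conclusion fails:
  \<open>x_j\<close> is sent to the identity although \<open>Upsilon 2\<close> is nontrivial on
  it.\<close>

lemma I_map_inj:
  assumes j: "j \<in> {1..q}" and m: "m \<ge> 3"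
  shows "inj_on (I_map q m j) (carrier (Upsilon_Q q m))"
proof (rule inj_onI)
  let ?x = "free_gen q j" and ?F = "free_group q"
  have m2: "m \<ge> 2" using m by simp
  have x: "?x \<in> carrier ?F" by (rule free_gen_closed[OF j])
  fix A B assume "A \<in> carrier (Upsilon_Q q m)" "B \<in> carrier (Upsilon_Q q m)"
    and eq: "I_map q m j A = I_map q m j B"
  then obtain y z where y: "y \<in> Gam q (m - 1)" "A = Upsilon m y"
    and z: "z \<in> Gam q (m - 1)" "B = Upsilon m z" by (auto simp: Upsilon_Q_def)
  have yc: "y \<in> carrier ?F" and zc: "z \<in> carrier ?F"
    using y z free_magnus.lower_central_closed by blast+
  let ?d = "\<lambda>u. nvar j * (Magnus u - 1) - (Magnus u - 1) * nvar j"
  have "Upsilon (m + 1) (commu ?F ?x y) = Upsilon (m + 1) (commu ?F ?x z)"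
    using eq y z I_map_Upsilon[OF j m2] by simp
  then have "ord_ge (m + 1) (Magnus (commu ?F ?x y) - Magnus (commu ?F ?x z))"
    using x yc zc by (subst (asm) Upsilon_eq_iff[where q = q]) auto
  then have "ord_ge (m + 1) (Magnus (commu ?F ?x y) - Magnus (commu ?F ?x z)
      - ((Magnus (commu ?F ?x y) - 1 - ?d y) - (Magnus (commu ?F ?x z) - 1 - ?d z)))"
    by (rule ord_ge_diff[OF _ ord_ge_diff[OF Magnus_commu_free_gen(2)[OF j m2 y(1)]
          Magnus_commu_free_gen(2)[OF j m2 z(1)]]])
  also have "Magnus (commu ?F ?x y) - Magnus (commu ?F ?x z)
      - ((Magnus (commu ?F ?x y) - 1 - ?d y) - (Magnus (commu ?F ?x z) - 1 - ?d z)) =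
      nvar j * (Magnus y - Magnus z) - (Magnus y - Magnus z) * nvar j"
    by (simp add: algebra_simps)
  finally have comm: "ord_ge (m + 1) (nvar j * (Magnus y - Magnus z) - (Magnus y - Magnus z) * nvar j)" .
  have pow: "ncoeff (Magnus u) (replicate k j) = 0"
    if u: "u \<in> Gam q (m - 1)" and k: "k \<ge> 1" for u k
  proof -
    have uc: "u \<in> carrier ?F" using u by (rule free_magnus.lower_central_closed)
    have "ord_ge (m - 1) (Magnus u - 1)" using u by (rule free_magnus.lower_central_ord_ge)
    then have "ncoeff (Magnus u - 1) [j] = 0" unfolding ord_ge_def using m by auto
    then have "ncoeff (Magnus u) [j] = 0" by (simp add: ncoeff_one)
    from Magnus_power_coeff_zero[OF uc this k] show ?thesis .
  qed
  have "ord_ge m (Magnus y - Magnus z)"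
    unfolding ord_ge_def
  proof (intro allI impI)
    fix w :: "nat list" assume w: "length w < m"
    show "ncoeff (Magnus y - Magnus z) w = 0"
    proof (cases "w = replicate (length w) j")
      case False
      with comm w show ?thesis by (intro commute_nvar_coeff[of "m + 1" j]) auto
    next
      case True
      show ?thesis
      proof (cases "w = []")
        case True
        then show ?thesis using Magnus_ncoeff_Nil[OF yc] Magnus_ncoeff_Nil[OF zc] by simp
      next
        case False
        then have "length w \<ge> 1" by (simp add: Suc_leI)
        then have "ncoeff (Magnus y) w = 0" "ncoeff (Magnus z) w = 0"
          using pow[OF y(1)] pow[OF z(1)] True by metis+
        then show ?thesis by simp
      qed
    qed
  qed
  then show "A = B" using Upsilon_eq_iff[OF yc zc] y z by simp
qed

section \<open>Longitudes\<close>

text \<open>The same nesting as in \<open>framed_longitude\<close>; \<open>prodl_Suc\<close>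
  supplies the recursion at the right end that iterated conjugation follows.\<close>

definition prodl :: "('a, 'b) monoid_scheme \<Rightarrow> (nat \<Rightarrow> 'a) \<Rightarrow> nat \<Rightarrow> 'a" where
  "prodl G b n = foldr (\<lambda>k y. b k \<otimes>\<^bsub>G\<^esub> y) [1..<Suc n] \<one>\<^bsub>G\<^esub>"

context group
begin

lemma foldr_mult_closed:
  assumes "\<And>k. k \<in> set ks \<Longrightarrow> b k \<in> carrier G" "z \<in> carrier G"
  shows "foldr (\<lambda>k y. b k \<otimes> y) ks z \<in> carrier G"
    and "foldr (\<lambda>k y. b k \<otimes> y) ks z = foldr (\<lambda>k y. b k \<otimes> y) ks \<one> \<otimes> z"
proof -
  have "foldr (\<lambda>k y. b k \<otimes> y) ks z \<in> carrier G \<and>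
      foldr (\<lambda>k y. b k \<otimes> y) ks \<one> \<in> carrier G \<and>
      foldr (\<lambda>k y. b k \<otimes> y) ks z = foldr (\<lambda>k y. b k \<otimes> y) ks \<one> \<otimes> z"
    using assms by (induction ks) (auto simp: m_assoc)
  then show "foldr (\<lambda>k y. b k \<otimes> y) ks z \<in> carrier G"
    "foldr (\<lambda>k y. b k \<otimes> y) ks z = foldr (\<lambda>k y. b k \<otimes> y) ks \<one> \<otimes> z" by auto
qed

lemma prodl_closed: "(\<And>k. k \<in> {1..n} \<Longrightarrow> b k \<in> carrier G) \<Longrightarrow> prodl G b n \<in> carrier G"
  unfolding prodl_def by (intro foldr_mult_closed(1)) auto

lemma prodl_Suc:
  assumes "\<And>k. k \<in> {1..Suc n} \<Longrightarrow> b k \<in> carrier G"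
  shows "prodl G b (Suc n) = prodl G b n \<otimes> b (Suc n)"
proof -
  have "prodl G b (Suc n) = foldr (\<lambda>k y. b k \<otimes> y) [1..<Suc n] (b (Suc n) \<otimes> \<one>)"
    unfolding prodl_def by simp
  also have "\<dots> = prodl G b n \<otimes> (b (Suc n) \<otimes> \<one>)"
    unfolding prodl_def using assms by (intro foldr_mult_closed(2)) auto
  finally show ?thesis using assms by simp
qed

text \<open>Used twice: in the link group, for the arcs met along a component, and in the matrix
  group, for the assignment \<open>C_assign\<close>.\<close>

lemma conj_chain:
  assumes "a 1 \<in> carrier G" "\<And>k. k \<in> {1..n} \<Longrightarrow> b k \<in> carrier G"
    and "\<And>k. k \<in> {1..n} \<Longrightarrow> a (Suc k) = inv (b k) \<otimes> a k \<otimes> b k"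
  shows "a (Suc n) = inv (prodl G b n) \<otimes> a 1 \<otimes> prodl G b n"
  using assms
proof (induction n)
  case 0
  then show ?case by (simp add: prodl_def)
next
  case (Suc n)
  have "a (Suc (Suc n)) = inv (b (Suc n)) \<otimes> (inv (prodl G b n) \<otimes> a 1 \<otimes> prodl G b n) \<otimes> b (Suc n)"
    using Suc by simp
  moreover have "prodl G b (Suc n) = prodl G b n \<otimes> b (Suc n)"
    by (rule prodl_Suc) (rule Suc.prems(2))
  moreover have "prodl G b n \<in> carrier G" "b (Suc n) \<in> carrier G"
    using Suc.prems(2) by (auto intro: prodl_closed)
  ultimately show ?case
    using Suc.prems(1) by (simp add: inv_mult_group m_assoc)
qed

end

lemma (in group_hom) hom_prodl:
  assumes "\<And>k. k \<in> {1..n} \<Longrightarrow> b k \<in> carrier G"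
  shows "h (prodl G b n) = prodl H (\<lambda>k. h (b k)) n"
  using assms
proof (induction n)
  case (Suc n)
  have "prodl G b (Suc n) = prodl G b n \<otimes> b (Suc n)"
    by (rule G.prodl_Suc) (rule Suc.prems)
  moreover have "prodl H (\<lambda>k. h (b k)) (Suc n) = prodl H (\<lambda>k. h (b k)) n \<otimes>\<^bsub>H\<^esub> h (b (Suc n))"
    by (rule H.prodl_Suc) (rule hom_closed[OF Suc.prems])
  moreover have "prodl G b n \<in> carrier G" "b (Suc n) \<in> carrier G"
    using Suc.prems by (auto intro: G.prodl_closed)
  ultimately show ?case using Suc by simp
qed (simp add: prodl_def)

lemma prodl_cong: "(\<And>k. k \<in> {1..n} \<Longrightarrow> b k = c k) \<Longrightarrow> prodl G b n = prodl G c n"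
  unfolding prodl_def by (intro foldr_cong) auto

section \<open>The link group: Wirtinger relations, meridians and longitudes\<close>

lemma group_link_group: "group (link_group D)"
  by (simp add: link_group_def group_presented_group)

lemma arc_gen_closed: "a \<in> arcs D \<Longrightarrow> arc_gen D a \<in> carrier (link_group D)"
  by (simp add: arc_gen_def link_group_def pres_class_closed)

lemma over_arc_arcs:
  assumes "link_diagram D" "c \<in> arcs D" shows "over_arc D c \<in> arcs D"
proof -
  have "\<exists>!a. a \<in> arcs D \<and> c \<in> set (overs D a)" using assms by (simp add: link_diagram_def)
  from theI'[OF this] show ?thesis by (simp add: over_arc_def)
qed

lemma next_arc_arcs: "c \<in> arcs D \<Longrightarrow> next_arc D c \<in> arcs D"
  by (auto simp: arcs_def next_arc_def split: if_splits)

lemma wirtinger_relation: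
  assumes D: "link_diagram D" and c: "c \<in> arcs D"
  defines "G \<equiv> link_group D" and "b \<equiv> arc_gen D (over_arc D c)"
  shows "arc_gen D (next_arc D c) = inv\<^bsub>G\<^esub> (b [^]\<^bsub>G\<^esub> csign D c) \<otimes>\<^bsub>G\<^esub> arc_gen D c \<otimes>\<^bsub>G\<^esub> b [^]\<^bsub>G\<^esub> csign D c"
proof -
  interpret group "link_group D" by (rule group_link_group)
  let ?o = "over_arc D c" and ?e = "csign D c"
  let ?cl = "pres_class (arcs D) (wirtinger_rels D)"
  have o: "?o \<in> arcs D" by (rule over_arc_arcs[OF D c])
  have e: "?e = 1 \<or> ?e = -1" using D c by (auto simp: link_diagram_def)
  have bc: "b \<in> carrier G" "arc_gen D c \<in> carrier G"
    using o c by (simp_all add: G_def b_def arc_gen_closed)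
  have inv: "inv\<^bsub>G\<^esub> b = ?cl [(?o, False)]"
    unfolding b_def G_def arc_gen_def link_group_def by (rule pres_class_inv[OF o])
  have b: "b = ?cl [(?o, True)]" by (simp add: b_def arc_gen_def)
  have p: "b [^]\<^bsub>G\<^esub> ?e = ?cl [(?o, ?e = 1)]" "inv\<^bsub>G\<^esub> (b [^]\<^bsub>G\<^esub> ?e) = ?cl [(?o, ?e \<noteq> 1)]"
    using e bc inv b by (auto simp: G_def int_pow_neg)
  have "([(next_arc D c, True)], [(?o, ?e \<noteq> 1), (c, True), (?o, ?e = 1)]) \<in> wirtinger_rels D"
    using c unfolding wirtinger_rels_def by blast
  then have "pres_eq (arcs D) (wirtinger_rels D) ([] @ [(next_arc D c, True)] @ [])
      ([] @ [(?o, ?e \<noteq> 1), (c, True), (?o, ?e = 1)] @ [])"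
    using c o next_arc_arcs[OF c] by (intro pres_eq.rel) auto
  then have "arc_gen D (next_arc D c) = ?cl [(?o, ?e \<noteq> 1), (c, True), (?o, ?e = 1)]"
    using next_arc_arcs[OF c] by (simp add: arc_gen_def pres_class_eq_iff)
  also have "\<dots> = ?cl [(?o, ?e \<noteq> 1)] \<otimes>\<^bsub>G\<^esub> ?cl [(c, True)] \<otimes>\<^bsub>G\<^esub> ?cl [(?o, ?e = 1)]"
    using c o by (simp add: G_def link_group_def presented_group_mult)
  finally show ?thesis using p by (simp add: arc_gen_def)
qed

text \<open>The longitude with the blackboard framing.\<close>

definition blackboard :: "diagram \<Rightarrow> nat \<Rightarrow> arc word set" where
  "blackboard D j = prodl (link_group D)
    (\<lambda>k. arc_gen D (over_arc D (j, k)) [^]\<^bsub>link_group D\<^esub> csign D (j, k)) (narcs D j)"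

lemma framed_longitude_eq:
  "framed_longitude D j w =
    arc_gen D (j, 1) [^]\<^bsub>link_group D\<^esub> (- w) \<otimes>\<^bsub>link_group D\<^esub> blackboard D j"
  by (simp add: framed_longitude_def Let_def blackboard_def prodl_def)

lemma over_arc_closed:
  assumes "link_diagram D" "j \<in> {1..ncomp D}" "k \<in> {1..narcs D j}"
  shows "arc_gen D (over_arc D (j, k)) \<in> carrier (link_group D)"
  using assms by (intro arc_gen_closed over_arc_arcs) (auto simp: arcs_def)

lemma blackboard_closed:
  assumes "link_diagram D" "j \<in> {1..ncomp D}"
  shows "blackboard D j \<in> carrier (link_group D)"
proof -
  interpret group "link_group D" by (rule group_link_group)
  show ?thesis
    unfolding blackboard_def using over_arc_closed[OF assms] by (intro prodl_closed) auto
qed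

lemma meridian_closed:
  assumes "link_diagram D" "j \<in> {1..ncomp D}"
  shows "meridian D j \<in> carrier (link_group D)"
  using assms unfolding meridian_def by (intro arc_gen_closed) (auto simp: arcs_def link_diagram_def)

text \<open>Following the Wirtinger relations once around the component conjugates the meridian by
  the blackboard longitude and returns to the same arc. Powers of the meridian do not disturb
  this.\<close>

lemma framed_longitude_commute:
  assumes D: "link_diagram D" and j: "j \<in> {1..ncomp D}"
  defines "G \<equiv> link_group D"
  shows "framed_longitude D j w \<in> carrier G"
    and "meridian D j \<otimes>\<^bsub>G\<^esub> framed_longitude D j w = framed_longitude D j w \<otimes>\<^bsub>G\<^esub> meridian D j"
proof -
  interpret group G unfolding G_def by (rule group_link_group)
  let ?x = "meridian D j" and ?P = "blackboard D j" and ?N = "narcs D j"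
  have x: "?x \<in> carrier G" and P: "?P \<in> carrier G"
    using meridian_closed[OF D j] blackboard_closed[OF D j] by (simp_all add: G_def)
  have N: "?N \<ge> 1" using D j by (auto simp: link_diagram_def)
  \<comment> \<open>Position N + 1 is the first arc again, which closes the chain.\<close>
  define a where "a k = arc_gen D (if k = Suc ?N then (j, 1) else (j, k))" for k
  have "a (Suc ?N) = inv\<^bsub>G\<^esub> ?P \<otimes>\<^bsub>G\<^esub> a 1 \<otimes>\<^bsub>G\<^esub> ?P"
    unfolding blackboard_def G_def[symmetric]
  proof (rule conj_chain)
    show "a 1 \<in> carrier G" using x N by (simp add: a_def meridian_def)
    fix k assume k: "k \<in> {1..?N}"
    then have jk: "(j, k) \<in> arcs D" using j by (simp add: arcs_def)
    show "arc_gen D (over_arc D (j, k)) [^]\<^bsub>G\<^esub> csign D (j, k) \<in> carrier G"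
      using over_arc_closed[OF D j k] by (simp add: G_def[symmetric])
    have "next_arc D (j, k) = (if Suc k = Suc ?N then (j, 1) else (j, Suc k))" by (simp add: next_arc_def)
    then have "a (Suc k) = arc_gen D (next_arc D (j, k))" by (simp add: a_def)
    moreover have "a k = arc_gen D (j, k)" using k by (auto simp: a_def)
    ultimately show "a (Suc k) = inv\<^bsub>G\<^esub> (arc_gen D (over_arc D (j, k)) [^]\<^bsub>G\<^esub> csign D (j, k)) \<otimes>\<^bsub>G\<^esub> a k \<otimes>\<^bsub>G\<^esub>
        arc_gen D (over_arc D (j, k)) [^]\<^bsub>G\<^esub> csign D (j, k)"
      using wirtinger_relation[OF D jk] by (simp add: G_def)
  qed
  then have "?x = inv\<^bsub>G\<^esub> ?P \<otimes>\<^bsub>G\<^esub> (?x \<otimes>\<^bsub>G\<^esub> ?P)"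
    using N x P by (simp add: a_def meridian_def m_assoc)
  then have "?P \<otimes>\<^bsub>G\<^esub> ?x = ?x \<otimes>\<^bsub>G\<^esub> ?P"
    using x P by (metis m_closed mult_inv_cancel)
  moreover have "?x \<otimes>\<^bsub>G\<^esub> ?x [^]\<^bsub>G\<^esub> (- w) = ?x [^]\<^bsub>G\<^esub> (- w) \<otimes>\<^bsub>G\<^esub> ?x"
    using x by (metis int_pow_1 int_pow_mult add.commute)
  ultimately show "?x \<otimes>\<^bsub>G\<^esub> framed_longitude D j w = framed_longitude D j w \<otimes>\<^bsub>G\<^esub> ?x"
    using x P unfolding framed_longitude_eq G_def[symmetric] meridian_def[symmetric]
    by (metis int_pow_closed m_assoc)
  show "framed_longitude D j w \<in> carrier G"
    using x P unfolding framed_longitude_eq G_def[symmetric] meridian_def[symmetric] by simp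
qed

text \<open>The map respects the Wirtinger relations because the two under-arcs belong to one
  component and the over-arc occurs with opposite exponents.\<close>

lemma linking_number_hom:
  assumes D: "link_diagram D"
  shows "group_hom (link_group D) integer_group (linking_number D j)"
    and "a \<in> arcs D \<Longrightarrow> linking_number D j (arc_gen D a) = (if fst a = j then 1 else 0)"
proof -
  let ?g = "\<lambda>a :: arc. if fst a = j then 1 else 0 :: int"
  have R: "word_eval integer_group ?g r = word_eval integer_group ?g s"
    if "(r, s) \<in> wirtinger_rels D" for r s
    using that by (auto simp: wirtinger_rels_def word_eval_Cons next_arc_def split: prod.splits)
  show "group_hom (link_group D) integer_group (linking_number D j)"
    unfolding link_group_def linking_number_def
    by (intro group_hom.intro group_hom_axioms.intro group_presented_group group_integer_group
        group.pres_lift_hom R) auto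
  show "linking_number D j (arc_gen D a) = (if fst a = j then 1 else 0)" if "a \<in> arcs D"
    unfolding linking_number_def arc_gen_def using that
    by (subst group.pres_lift_class[OF group_integer_group _ _ R]) (auto simp: word_eval_Cons)
qed

text \<open>The linking number of the framed longitude is -w plus a constant, so exactly one framing
  is selected by the definite description in \<open>longitude\<close>.\<close>

lemma longitude_linking_number:
  assumes D: "link_diagram D" and j: "j \<in> {1..ncomp D}"
  obtains w where "longitude D j = framed_longitude D j w" "linking_number D j (longitude D j) = 0"
proof -
  interpret L: group_hom "link_group D" integer_group "linking_number D j"
    by (rule linking_number_hom[OF D])
  have x: "meridian D j \<in> carrier (link_group D)" and P: "blackboard D j \<in> carrier (link_group D)"
    using meridian_closed[OF D j] blackboard_closed[OF D j] by simp_all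
  have "linking_number D j (meridian D j) = 1"
    unfolding meridian_def using D j
    by (subst linking_number_hom(2)) (auto simp: arcs_def link_diagram_def)
  then have "linking_number D j (framed_longitude D j w) = - w + linking_number D j (blackboard D j)" for w
    unfolding framed_longitude_eq meridian_def[symmetric] using x P
    by (simp add: L.hom_mult L.hom_int_pow)
  then have "\<exists>!w. linking_number D j (framed_longitude D j w) = 0"
    by (intro ex1I[of _ "linking_number D j (blackboard D j)"]) auto
  from theI'[OF this] show thesis
    by (intro that[of "THE w. linking_number D j (framed_longitude D j w) = 0"]) (auto simp: longitude_def)
qed

section \<open>The values of \<open>f\<^sub>m\<close>\<close>

locale milnor_link =
  fixes D :: diagram and m :: nat and f :: "nat \<Rightarrow> arc word set \<Rightarrow> nat word set set"
  assumes D: "link_diagram D" and m: "2 \<le> m" and A: "assumption_A D m f"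
begin

abbreviation "q \<equiv> ncomp D"
abbreviation "cls x \<equiv> Gam q m #>\<^bsub>free_group q\<^esub> x"

lemma f_hom: "group_hom (link_group D) (nil_quot q m) (f m)"
proof -
  interpret P: group_hom "free_group q" "nil_quot q m" cls
    using m by (intro nil_quot_hom) simp
  show ?thesis
    using A m by (intro group_hom.intro group_hom_axioms.intro group_link_group P.H.is_group)
      (simp add: assumption_A_def Let_def)
qed

lemma f_meridian: "j \<in> {1..q} \<Longrightarrow> f m (meridian D j) = cls (free_gen q j)"
  using A m by (simp add: assumption_A_def Let_def)

lemma f_representative:
  assumes "g \<in> carrier (link_group D)"
  obtains x where "x \<in> carrier (free_group q)" "f m g = cls x"
  using nil_quot_carrierE[OF group_hom.hom_closed[OF f_hom assms]] by blast

text \<open>All constant terms are 1, so degree 1 coefficients add under multiplication.\<close>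

lemma exponent_sum_hom: "group_hom (free_group q) integer_group (\<lambda>x. ncoeff (Magnus x) [j])"
proof (intro group_hom.intro group_hom_axioms.intro group_free_group group_integer_group homI)
  fix x y assume "x \<in> carrier (free_group q)" "y \<in> carrier (free_group q)"
  then show "ncoeff (Magnus (x \<otimes>\<^bsub>free_group q\<^esub> y)) [j] =
      ncoeff (Magnus x) [j] \<otimes>\<^bsub>integer_group\<^esub> ncoeff (Magnus y) [j]"
    by (simp add: free_magnus.M_mult ncoeff_times_Cons Magnus_ncoeff_Nil)
qed simp

text \<open>The normalization prescribes \<open>f m\<close> only on the first arc of each component.
  The Wirtinger relations carry the exponent sums to the other arcs, as conjugation does not change
  them.\<close>

lemma f_arc_exponent_sum:
  assumes i: "i \<in> {1..q}" and k: "k \<in> {1..narcs D i}"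
  shows "\<exists>x\<in>carrier (free_group q). f m (arc_gen D (i, k)) = cls x \<and>
    ncoeff (Magnus x) [j] = (if i = j then 1 else 0)"
proof -
  interpret P: group_hom "free_group q" "nil_quot q m" cls
    using m by (intro nil_quot_hom) simp
  interpret E: group_hom "free_group q" integer_group "\<lambda>x. ncoeff (Magnus x) [j]"
    by (rule exponent_sum_hom)
  interpret f: group_hom "link_group D" "nil_quot q m" "f m" by (rule f_hom)
  have "1 \<le> k" "k \<le> narcs D i" using k by auto
  then show ?thesis
  proof (induction k rule: dec_induct)
    case base
    then show ?case
      using f_meridian[OF i] Magnus_free_gen[OF i] free_gen_closed[OF i]
      by (auto simp: meridian_def ncoeff_one ncoeff_nvar intro!: bexI[of _ "free_gen q i"])
  next
    case (step k)
    then have ik: "(i, k) \<in> arcs D" and k: "k \<in> {1..narcs D i}" using i by (auto simp: arcs_def)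
    obtain x where x: "x \<in> carrier (free_group q)" "f m (arc_gen D (i, k)) = cls x"
      "ncoeff (Magnus x) [j] = (if i = j then 1 else 0)" using step by auto
    let ?b = "arc_gen D (over_arc D (i, k))" and ?e = "csign D (i, k)"
    have b: "?b \<in> carrier (link_group D)" by (rule over_arc_closed[OF D i k])
    obtain y where y: "y \<in> carrier (free_group q)" "f m ?b = cls y" using f_representative[OF b] .
    let ?z = "inv\<^bsub>free_group q\<^esub> (y [^]\<^bsub>free_group q\<^esub> ?e) \<otimes>\<^bsub>free_group q\<^esub> x \<otimes>\<^bsub>free_group q\<^esub> y [^]\<^bsub>free_group q\<^esub> ?e"
    have "next_arc D (i, k) = (i, Suc k)" using step by (simp add: next_arc_def)
    then have "f m (arc_gen D (i, Suc k)) = cls ?z"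
      using wirtinger_relation[OF D ik] b x y arc_gen_closed[OF ik]
      by (simp add: f.hom_int_pow P.hom_int_pow)
    moreover have "ncoeff (Magnus ?z) [j] = (if i = j then 1 else 0)"
      using x y E.hom_mult E.hom_inv by simp
    ultimately show ?case using x(1) y(1) by (intro bexI[of _ ?z]) auto
  qed
qed

text \<open>Some representative with the right exponent sum is built along the generation by arcs.
  Since m is at least 2, all representatives share their degree 1 coefficients.\<close>

lemma f_exponent_sum:
  assumes g: "g \<in> carrier (link_group D)" and x: "x \<in> carrier (free_group q)" "f m g = cls x"
  shows "ncoeff (Magnus x) [j] = linking_number D j g"
proof -
  interpret P: group_hom "free_group q" "nil_quot q m" cls
    using m by (intro nil_quot_hom) simp
  interpret E: group_hom "free_group q" integer_group "\<lambda>x. ncoeff (Magnus x) [j]"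
    by (rule exponent_sum_hom)
  interpret L: group_hom "link_group D" integer_group "linking_number D j"
    by (rule linking_number_hom[OF D])
  interpret f: group_hom "link_group D" "nil_quot q m" "f m" by (rule f_hom)
  let ?S = "arc_gen D ` arcs D"
  have gen: "carrier (link_group D) = generate (link_group D) ?S"
    using presented_group_generate[of "arcs D" "wirtinger_rels D"]
    unfolding link_group_def arc_gen_def .
  have arc: "\<exists>y\<in>carrier (free_group q). f m (arc_gen D a) = cls y \<and>
      ncoeff (Magnus y) [j] = linking_number D j (arc_gen D a)" if "a \<in> arcs D" for a
    using that f_arc_exponent_sum[of "fst a" "snd a" j] linking_number_hom(2)[OF D that]
    by (auto simp: arcs_def)
  have "g \<in> generate (link_group D) ?S" using g gen by simp
  then have "g \<in> carrier (link_group D) \<and> (\<exists>y\<in>carrier (free_group q). f m g = cls y \<and>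
      ncoeff (Magnus y) [j] = linking_number D j g)"
  proof induction
    case one
    have "f m \<one>\<^bsub>link_group D\<^esub> = cls \<one>\<^bsub>free_group q\<^esub>" using P.hom_one f.hom_one by simp
    moreover have "ncoeff (Magnus \<one>\<^bsub>free_group q\<^esub>) [j] = linking_number D j \<one>\<^bsub>link_group D\<^esub>"
      using E.hom_one L.hom_one by simp
    ultimately show ?case by blast
  next
    case (incl a)
    then show ?case using arc arc_gen_closed by auto
  next
    case (inv a)
    then obtain c where a: "a = arc_gen D c" "c \<in> arcs D" by auto
    from arc[OF a(2)] obtain y where y: "y \<in> carrier (free_group q)"
      "f m a = cls y" "ncoeff (Magnus y) [j] = linking_number D j a" unfolding a(1) by blast
    have ac: "a \<in> carrier (link_group D)" using a arc_gen_closed by simp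
    have "f m (inv\<^bsub>link_group D\<^esub> a) = cls (inv\<^bsub>free_group q\<^esub> y)"
      using P.hom_inv[OF y(1)] f.hom_inv[OF ac] y by simp
    moreover have "ncoeff (Magnus (inv\<^bsub>free_group q\<^esub> y)) [j] = linking_number D j (inv\<^bsub>link_group D\<^esub> a)"
      using E.hom_inv[OF y(1)] L.hom_inv[OF ac] y by simp
    ultimately show ?case using ac y(1) by blast
  next
    case (eng a b)
    then obtain y z where y: "y \<in> carrier (free_group q)"
      "f m a = cls y" "ncoeff (Magnus y) [j] = linking_number D j a"
      and z: "z \<in> carrier (free_group q)"
      "f m b = cls z" "ncoeff (Magnus z) [j] = linking_number D j b"
      and ab: "a \<in> carrier (link_group D)" "b \<in> carrier (link_group D)" by blast
    have "f m (a \<otimes>\<^bsub>link_group D\<^esub> b) = cls (y \<otimes>\<^bsub>free_group q\<^esub> z)"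
      using P.hom_mult[OF y(1) z(1)] f.hom_mult[OF ab] y z by simp
    moreover have "ncoeff (Magnus (y \<otimes>\<^bsub>free_group q\<^esub> z)) [j] = linking_number D j (a \<otimes>\<^bsub>link_group D\<^esub> b)"
      using E.hom_mult[OF y(1) z(1)] L.hom_mult[OF ab] y z by simp
    ultimately show ?case using ab y(1) z(1) by blast
  qed
  then obtain y where y: "y \<in> carrier (free_group q)" "f m g = cls y"
    "ncoeff (Magnus y) [j] = linking_number D j g" by blast
  then have "ord_ge m (Magnus x - Magnus y)"
    using coset_eq_iff[of m x q y] x m by simp
  then have "ncoeff (Magnus x - Magnus y) [j] = 0" using m by (auto simp: ord_ge_def)
  then show ?thesis using y by simp
qed

text \<open>The longitude commutes with the meridian, so the expansion of \<open>f\<^sub>m(l\<^sub>j)\<close> involves only powers of \<open>X\<^sub>j\<close> in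
  low degrees; these vanish because the linking number is zero.\<close>

lemma f_longitude:
  assumes j: "j \<in> {1..q}" and x: "x \<in> carrier (free_group q)" "f m (longitude D j) = cls x"
  shows "x \<in> Gam q (m - 1)"
proof -
  interpret P: group_hom "free_group q" "nil_quot q m" cls
    using m by (intro nil_quot_hom) simp
  interpret f: group_hom "link_group D" "nil_quot q m" "f m" by (rule f_hom)
  let ?x = "free_gen q j"
  obtain w where w: "longitude D j = framed_longitude D j w" "linking_number D j (longitude D j) = 0"
    using longitude_linking_number[OF D j] by blast
  have l: "longitude D j \<in> carrier (link_group D)"
    and comm: "meridian D j \<otimes>\<^bsub>link_group D\<^esub> longitude D j = longitude D j \<otimes>\<^bsub>link_group D\<^esub> meridian D j"
    using framed_longitude_commute[OF D j] w(1) by simp_all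
  have mer: "meridian D j \<in> carrier (link_group D)" by (rule meridian_closed[OF D j])
  have xj: "?x \<in> carrier (free_group q)" by (rule free_gen_closed[OF j])
  have "cls (?x \<otimes>\<^bsub>free_group q\<^esub> x) = cls (x \<otimes>\<^bsub>free_group q\<^esub> ?x)"
    using arg_cong[OF comm, of "f m"] f.hom_mult[OF mer l] f.hom_mult[OF l mer]
      P.hom_mult[OF xj x(1)] P.hom_mult[OF x(1) xj] x(2) f_meridian[OF j] by simp
  then have "ord_ge m (Magnus (?x \<otimes>\<^bsub>free_group q\<^esub> x) - Magnus (x \<otimes>\<^bsub>free_group q\<^esub> ?x))"
    using coset_eq_iff[of m "?x \<otimes>\<^bsub>free_group q\<^esub> x" q "x \<otimes>\<^bsub>free_group q\<^esub> ?x"] xj x(1) m by simp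
  moreover have "Magnus (?x \<otimes>\<^bsub>free_group q\<^esub> x) - Magnus (x \<otimes>\<^bsub>free_group q\<^esub> ?x) =
      nvar j * Magnus x - Magnus x * nvar j"
    using xj x(1) by (simp add: free_magnus.M_mult Magnus_free_gen[OF j] algebra_simps)
  ultimately have c: "ord_ge m (nvar j * Magnus x - Magnus x * nvar j)" by simp
  have e: "ncoeff (Magnus x) [j] = 0" using f_exponent_sum[OF l x] w(2) by simp
  have "ord_ge (m - 1) (Magnus x - 1)"
    unfolding ord_ge_def
  proof (intro allI impI)
    \<comment> \<open>Commutation modulo degree m compares words of length
      \<open>length v + 1\<close>, so it controls coefficients only below degree m - 1.\<close>
    fix v :: "nat list" assume v: "length v < m - 1"
    show "ncoeff (Magnus x - 1) v = 0"
    proof (cases "v = []")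
      case True
      then show ?thesis using Magnus_ncoeff_Nil[OF x(1)] by (simp add: ncoeff_one)
    next
      case False
      then have l: "length v \<ge> 1" by (simp add: Suc_leI)
      have "ncoeff (Magnus x) v = 0"
      proof (cases "v = replicate (length v) j")
        case True
        then show ?thesis using Magnus_power_coeff_zero[OF x(1) e l] by simp
      next
        case False
        then show ?thesis using v by (intro commute_nvar_coeff[OF c]) auto
      qed
      then show ?thesis using False by (simp add: ncoeff_one)
    qed
  qed
  then show ?thesis using Gam_iff[of "m - 1" x q] x m by simp
qed

text \<open>The matrices \<open>B k\<close> are lifted to elements \<open>b k\<close> of the free
  group, so that both sides become images of commutators there. The lifts need to match
  \<open>f m\<close> only at level m.\<close>

lemma Psi_eq_I_map:
  assumes j: "j \<in> {1..q}" and B: "admissible_lifts D m f j B"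
  shows "I_map q m j (Upsilon_quot m (f m (longitude D j))) = Psi D m j B"
proof -
  let ?F = "free_group q" and ?x = "free_gen q j" and ?N = "narcs D j"
  interpret P: group_hom ?F "nil_quot q m" cls
    using m by (intro nil_quot_hom) simp
  interpret f: group_hom "link_group D" "nil_quot q m" "f m" by (rule f_hom)
  interpret Q: group_hom "nil_quot q m" "GL m" "Upsilon_quot m"
    using m by (intro Upsilon_quot_hom) simp
  interpret U: group_hom ?F "GL m" "Upsilon m" by (rule Upsilon_hom)
  interpret V: group_hom ?F "GL (m + 1)" "Upsilon (m + 1)" by (rule Upsilon_hom)
  have m1: "m \<ge> 1" using m by simp
  have x: "?x \<in> carrier ?F" by (rule free_gen_closed[OF j])
  have N: "?N \<ge> 1" using D j by (auto simp: link_diagram_def)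
  let ?e = "\<lambda>k. csign D (j, k)" and ?b = "\<lambda>k. arc_gen D (over_arc D (j, k))"
  have "\<exists>y\<in>carrier ?F. B k = Upsilon (m + 1) y" if "k \<in> {1..?N}" for k
    using B that by (auto simp: admissible_lifts_def Im_Upsilon_def)
  then obtain b where b: "\<And>k. k \<in> {1..?N} \<Longrightarrow> b k \<in> carrier ?F"
    and Bb: "\<And>k. k \<in> {1..?N} \<Longrightarrow> B k = Upsilon (m + 1) (b k)" by metis
  have bf: "Upsilon m (b k) = Upsilon_quot m (f m (?b k))" if "k \<in> {1..?N}" for k
  proof -
    have "Im_proj q m (B k) = Upsilon_quot m (f m (?b k))"
      using B that unfolding admissible_lifts_def by blast
    then show ?thesis unfolding Bb[OF that] Im_proj_Upsilon[OF m1 b[OF that]] .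
  qed
  have bc: "?b k \<in> carrier (link_group D)" if "k \<in> {1..?N}" for k
    by (rule over_arc_closed[OF D j that])
  let ?y = "\<lambda>k. b k [^]\<^bsub>?F\<^esub> ?e k"
  have yc: "?y k \<in> carrier ?F" if "k \<in> {1..?N}" for k using b[OF that] by simp
  define R where "R = prodl ?F ?y ?N"
  have R: "R \<in> carrier ?F" unfolding R_def by (rule free_magnus.prodl_closed[OF yc])
  obtain w where w: "longitude D j = framed_longitude D j w"
    using longitude_linking_number[OF D j] by blast
  \<comment> \<open>\<open>I_map_Upsilon\<close> asks for an element of Gamma_{m-1}. The framing
    correction provides it: \<open>g\<close> qualifies, whereas \<open>R\<close> in general does
    not.\<close>
  define g where "g = ?x [^]\<^bsub>?F\<^esub> (- w) \<otimes>\<^bsub>?F\<^esub> R"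
  have g: "g \<in> carrier ?F" using x R by (simp add: g_def)
  have mer: "meridian D j \<in> carrier (link_group D)" by (rule meridian_closed[OF D j])
  have bb: "blackboard D j \<in> carrier (link_group D)" by (rule blackboard_closed[OF D j])
  have l: "longitude D j \<in> carrier (link_group D)"
    using framed_longitude_commute(1)[OF D j] w by simp
  have "Upsilon_quot m (f m (blackboard D j)) =
      prodl (GL m) (\<lambda>k. Upsilon_quot m (f m (?b k [^]\<^bsub>link_group D\<^esub> ?e k))) ?N"
    unfolding blackboard_def using bc
    by (subst f.hom_prodl, simp, subst Q.hom_prodl) (simp_all del: GL_simps)
  also have "\<dots> = prodl (GL m) (\<lambda>k. Upsilon m (?y k)) ?N"
    using bc b bf
    by (intro prodl_cong) (simp add: f.hom_int_pow Q.hom_int_pow U.hom_int_pow del: GL_simps)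
  also have "\<dots> = Upsilon m R"
    unfolding R_def by (rule U.hom_prodl[symmetric]) (rule yc)
  finally have "Upsilon_quot m (f m (blackboard D j)) = Upsilon m R" .
  moreover have "Upsilon_quot m (f m (meridian D j)) = Upsilon m ?x"
    using f_meridian[OF j] Upsilon_quot_coset[OF m1 x] by simp
  ultimately have Ul: "Upsilon_quot m (f m (longitude D j)) = Upsilon m g"
    unfolding w framed_longitude_eq meridian_def[symmetric] g_def using mer bb x R
    by (simp add: f.hom_int_pow Q.hom_int_pow U.hom_int_pow del: GL_simps)
  \<comment> \<open>\<open>f_longitude\<close> speaks about representatives of the class of the
    longitude. The expansions of \<open>g\<close> and \<open>z\<close> agree below degree m, so
    membership in Gamma_{m-1} passes from \<open>z\<close> to \<open>g\<close>.\<close>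
  obtain z where z: "z \<in> carrier ?F" "f m (longitude D j) = cls z" using f_representative[OF l] .
  have "z \<in> Gam q (m - 1)" by (rule f_longitude[OF j z])
  then have "ord_ge (m - 1) (Magnus z - 1)" by (rule free_magnus.lower_central_ord_ge)
  moreover have "ord_ge m (Magnus g - Magnus z)"
    using Ul z Upsilon_quot_coset[OF m1 z(1)] Upsilon_eq_iff[OF g z(1), of m] by simp
  ultimately have "ord_ge (m - 1) ((Magnus g - Magnus z) + (Magnus z - 1))"
    by (intro ord_ge_add) (auto intro: ord_ge_mono)
  then have gG: "g \<in> Gam q (m - 1)" using Gam_iff[of "m - 1" g q] g m by simp
  have C1: "C_assign D m j B 1 = Upsilon (m + 1) ?x" by simp
  note [simp del] = One_nat_def
  \<comment> \<open>\<open>C_assign\<close> is extended by the value obtained on returning to the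
    first arc, so that \<open>Psi\<close> is the inverse of the image of \<open>x_j\<close> times
    the last term of a conjugation chain.\<close>
  let ?C = "\<lambda>k. if k = Suc ?N then B ?N [^]\<^bsub>GL (m + 1)\<^esub> (- ?e ?N) \<otimes>\<^bsub>GL (m + 1)\<^esub>
    C_assign D m j B ?N \<otimes>\<^bsub>GL (m + 1)\<^esub> B ?N [^]\<^bsub>GL (m + 1)\<^esub> ?e ?N else C_assign D m j B k"
  have Vy: "Upsilon (m + 1) (?y k) = B k [^]\<^bsub>GL (m + 1)\<^esub> ?e k" if "k \<in> {1..?N}" for k
    unfolding Bb[OF that] by (rule V.hom_int_pow[OF b[OF that]])
  have "?C (Suc ?N) = inv\<^bsub>GL (m + 1)\<^esub> (prodl (GL (m + 1)) (\<lambda>k. Upsilon (m + 1) (?y k)) ?N)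
      \<otimes>\<^bsub>GL (m + 1)\<^esub> ?C 1 \<otimes>\<^bsub>GL (m + 1)\<^esub> prodl (GL (m + 1)) (\<lambda>k. Upsilon (m + 1) (?y k)) ?N"
  proof (rule V.H.conj_chain)
    show "?C 1 \<in> carrier (GL (m + 1))" using N V.hom_closed[OF x] by (simp add: C1 del: GL_simps)
    fix k assume k: "k \<in> {1..?N}"
    show "Upsilon (m + 1) (?y k) \<in> carrier (GL (m + 1))" using yc[OF k] by (rule V.hom_closed)
    have Bk: "B k \<in> carrier (GL (m + 1))" using Bb[OF k] V.hom_closed[OF b[OF k]] by simp
    obtain k' where k': "k = Suc k'" using k by (cases k) auto
    have "?C (Suc k) = B k [^]\<^bsub>GL (m + 1)\<^esub> (- ?e k) \<otimes>\<^bsub>GL (m + 1)\<^esub> C_assign D m j B k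
        \<otimes>\<^bsub>GL (m + 1)\<^esub> B k [^]\<^bsub>GL (m + 1)\<^esub> ?e k"
      using k' by (auto simp del: GL_simps)
    then show "?C (Suc k) = inv\<^bsub>GL (m + 1)\<^esub> (Upsilon (m + 1) (?y k)) \<otimes>\<^bsub>GL (m + 1)\<^esub> ?C k
        \<otimes>\<^bsub>GL (m + 1)\<^esub> Upsilon (m + 1) (?y k)"
      using k Bk unfolding Vy[OF k] by (simp add: V.H.int_pow_neg del: GL_simps)
  qed
  also have "prodl (GL (m + 1)) (\<lambda>k. Upsilon (m + 1) (?y k)) ?N = Upsilon (m + 1) R"
    unfolding R_def by (rule V.hom_prodl[symmetric]) (rule yc)
  finally have *: "?C (Suc ?N) = inv\<^bsub>GL (m + 1)\<^esub> (Upsilon (m + 1) R) \<otimes>\<^bsub>GL (m + 1)\<^esub> ?C 1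
      \<otimes>\<^bsub>GL (m + 1)\<^esub> Upsilon (m + 1) R" .
  have "Psi D m j B = inv\<^bsub>GL (m + 1)\<^esub> (Upsilon (m + 1) ?x) \<otimes>\<^bsub>GL (m + 1)\<^esub>
      (inv\<^bsub>GL (m + 1)\<^esub> (Upsilon (m + 1) R) \<otimes>\<^bsub>GL (m + 1)\<^esub> Upsilon (m + 1) ?x \<otimes>\<^bsub>GL (m + 1)\<^esub> Upsilon (m + 1) R)"
  proof -
    have Bk: "B k \<in> carrier (GL (m + 1))" if "k \<in> {1..?N}" for k
      using Bb[OF that] V.hom_closed[OF b[OF that]] by simp
    have C: "C_assign D m j B k \<in> carrier (GL (m + 1))" if "1 \<le> k" "k \<le> ?N" for k
      using that
    proof (induction k rule: dec_induct)
      case base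
      then show ?case using V.hom_closed[OF x] unfolding C1 by simp
    next
      case (step k)
      then obtain k' where "k = Suc k'" by (cases k) auto
      then show ?case using step Bk[of k] by (simp del: GL_simps)
    qed
    show ?thesis
      using * Bk[of ?N] C[of ?N] N V.hom_closed[OF x] V.hom_closed[OF R]
      by (simp add: C1 Psi_def Let_def V.H.m_assoc del: GL_simps)
  qed
  also have "\<dots> = Upsilon (m + 1) (commu ?F ?x R)"
    using x R by (simp add: V.H.m_assoc del: GL_simps)
  also have "commu ?F ?x R = commu ?F ?x g"
  proof -
    have "?x \<otimes>\<^bsub>?F\<^esub> ?x [^]\<^bsub>?F\<^esub> (- w) = ?x [^]\<^bsub>?F\<^esub> (- w) \<otimes>\<^bsub>?F\<^esub> ?x"
      using x by (metis free_magnus.int_pow_1 free_magnus.int_pow_mult add.commute)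
    then have "?x \<otimes>\<^bsub>?F\<^esub> (?x [^]\<^bsub>?F\<^esub> (- w) \<otimes>\<^bsub>?F\<^esub> R) = ?x [^]\<^bsub>?F\<^esub> (- w) \<otimes>\<^bsub>?F\<^esub> (?x \<otimes>\<^bsub>?F\<^esub> R)"
      using x R by (metis free_magnus.int_pow_closed free_magnus.m_assoc)
    then show ?thesis
      using x R by (simp add: g_def free_magnus.group_normalize)
  qed
  finally have "Psi D m j B = Upsilon (m + 1) (commu ?F ?x g)" .
  then show ?thesis unfolding Ul I_map_Upsilon[OF j m gG] by simp
qed

end

text \<open>As \<open>B\<close> is an arbitrary admissible family, the equality also shows that
  \<open>Psi\<close> does not depend on the choice of lifts. The bound on m in the second conjunct
  excludes m = 2, where \<open>x_j\<close> gives a nontrivial element of the kernel.\<close>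

theorem theorem4p1:
  fixes D :: diagram
    and m j :: nat
    and f :: "nat \<Rightarrow> arc word set \<Rightarrow> nat word set set"
    and B :: "nat \<Rightarrow> magnus_ring mat"
  assumes "2 \<le> m"
    and "link_diagram D"
    and "assumption_A D m f"
    and "j \<in> {1..ncomp D}"
    and "admissible_lifts D m f j B"
  shows "I_map (ncomp D) m j \<in> hom (Upsilon_Q (ncomp D) m) (Upsilon_Q (ncomp D) (m + 1))
    \<and> (3 \<le> m \<longrightarrow> inj_on (I_map (ncomp D) m j) (carrier (Upsilon_Q (ncomp D) m)))
    \<and> I_map (ncomp D) m j (Upsilon_quot m (f m (longitude D j))) = Psi D m j B"
proof -
  interpret milnor_link D m f by unfold_locales (use assms in auto)
  show ?thesis
    using I_map_hom[OF assms(4,1)] I_map_inj[OF assms(4)] Psi_eq_I_map[OF assms(4,5)] by blast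
qed

end
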